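(* Let $1\le r<\infty$ and let $X$ be a $\mathcal D^r$ submanifold of $F^n$. Then $X$ has a finite cover by definable subsets which are open in $X$ and each of which is a quasi-special $\mathcal C^r$ submanifold.
   Context: Throughout, $\mathcal F=(F,<,+,\cdot,0,1,\ldots)$ is a definably complete locally o-minimal expansion of an ordered field: locally o-minimal means that for every definable $X\subseteq F$ and every $a\in F$ there is an open interval $I\ni a$ such that $X\cap I$ is a finite union of points and open intervals; definably complete means every definable subset of $F$ has a supremum and an infimum in $F\cup\{\pm\infty\}$. "Definable" means definable with parameters. $\mathcal D^r$ means definable and of class $\mathcal C^r$; a $\mathcal D^r$ diffeomorphism is a definable bijection that is $\mathcal D^r$ with $\mathcal D^r$ inverse. A $\mathcal D^r$ submanifold of dimension $d$ of $F^n$ is a definable $N\subseteq F^n$ such that for each $a\in N$ there exist a definable open neighborhood $U$ of $a$ in $F^n$, a definable open neighborhood $V$ of the origin, and a $\mathcal D^r$ diffeomorphism $\varphi:U\to V$ with $\varphi(a)=0$ and $\varphi(N\cap U)=\{x\in V\;|\;x_{d+1}=\cdots=x_n=0\}$. For a coordinate projection $\pi:F^n\to F^d$, a definable set $Y\subseteq F^n$ is a $\pi$-quasi-special $\mathcal C^r$ submanifold if $\pi(Y)$ is open and for every $x\in\pi(Y)$ there is an open box $U\ni x$ in $F^d$ such that for every $y\in Y\cap\pi^{-1}(x)$ there exist an open box $V\ni y$ in $F^n$ and a $\mathcal D^r$ map $\tau:U\to F^n$ with $\pi(V)=U$, $\tau(U)=Y\cap V$ and $\pi\circ\tau=\mathrm{id}_U$;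 it is a quasi-special $\mathcal C^r$ submanifold if this holds for some coordinate projection $\pi$. (An open box is a product of nonempty open intervals.) *)

theory Defs
  imports Main
begin

text \<open>The ambient ordered field F is a type 'a :: linordered_field; points of F^n are
  lists of length n.  The expansion is represented by the collection D of its
  (parameter-)definable sets of all arities (a first-order structure in the sense of
  van den Dries).\<close>

definition Fn :: "nat \<Rightarrow> 'a list set" where
  "Fn n = {xs. length xs = n}"

definition definable_structure :: "('a::linordered_field list set \<Rightarrow> bool) \<Rightarrow> bool" where
  "definable_structure D \<longleftrightarrow>
     (\<forall>A. D A \<longrightarrow> (\<exists>n. A \<subseteq> Fn n)) \<and>
     (\<forall>n. D (Fn n)) \<and>
     (\<forall>A B. D A \<longrightarrow> D B \<longrightarrow> D (A \<inter> B)) \<and>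
     (\<forall>n A. D A \<longrightarrow> A \<subseteq> Fn n \<longrightarrow> D (Fn n - A)) \<and>
     (\<forall>A. D A \<longrightarrow> D {x @ [a] | x a. x \<in> A}) \<and>
     (\<forall>A. D A \<longrightarrow> D {a # x | a x. x \<in> A}) \<and>
     (\<forall>n i j. i < n \<longrightarrow> j < n \<longrightarrow> D {x \<in> Fn n. x ! i = x ! j}) \<and>
     (\<forall>A. D A \<longrightarrow> D (butlast ` A)) \<and>
     (\<forall>a. D {[a]}) \<and>
     D {[x, y, z] | x y z. z = x + y} \<and>
     D {[x, y, z] | x y z. z = x * y} \<and>
     D {[x, y] | x y. x < y}"

definition locally_o_minimal :: "('a::linordered_field list set \<Rightarrow> bool) \<Rightarrow> bool" where
  "locally_o_minimal D \<longleftrightarrow>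
     (\<forall>X a. D X \<longrightarrow> X \<subseteq> Fn 1 \<longrightarrow>
        (\<exists>l u. l < a \<and> a < u \<and>
           (\<exists>P J. finite P \<and> finite J \<and> (\<forall>(c, e)\<in>J. c < e) \<and>
              {x. [x] \<in> X \<and> l < x \<and> x < u} = P \<union> (\<Union>(c, e)\<in>J. {c<..<e}))))"

definition definably_complete :: "('a::linordered_field list set \<Rightarrow> bool) \<Rightarrow> bool" where
  "definably_complete D \<longleftrightarrow>
     (\<forall>X. D X \<longrightarrow> X \<subseteq> Fn 1 \<longrightarrow>
        ({x. [x] \<in> X} \<noteq> {} \<longrightarrow> (\<exists>b. \<forall>x. [x] \<in> X \<longrightarrow> x \<le> b) \<longrightarrow>
           (\<exists>s. (\<forall>x. [x] \<in> X \<longrightarrow> x \<le> s) \<and> (\<forall>t. (\<forall>x. [x] \<in> X \<longrightarrow> x \<le> t) \<longrightarrow> s \<le> t))) \<and>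
        ({x. [x] \<in> X} \<noteq> {} \<longrightarrow> (\<exists>b. \<forall>x. [x] \<in> X \<longrightarrow> b \<le> x) \<longrightarrow>
           (\<exists>s. (\<forall>x. [x] \<in> X \<longrightarrow> s \<le> x) \<and> (\<forall>t. (\<forall>x. [x] \<in> X \<longrightarrow> t \<le> x) \<longrightarrow> t \<le> s))))"

text \<open>Sup-norm distance on F^n (induces the product order topology).\<close>
definition lnorm :: "'a::linordered_field list \<Rightarrow> 'a" where
  "lnorm xs = foldr (\<lambda>a m. max \<bar>a\<bar> m) xs 0"

definition ldist :: "'a::linordered_field list \<Rightarrow> 'a list \<Rightarrow> 'a" where
  "ldist x y = lnorm (map2 (\<lambda>a b. a - b) x y)"

definition openF :: "nat \<Rightarrow> 'a::linordered_field list set \<Rightarrow> bool" where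
  "openF n U \<longleftrightarrow> U \<subseteq> Fn n \<and> (\<forall>x\<in>U. \<exists>e>0. \<forall>y\<in>Fn n. ldist x y < e \<longrightarrow> y \<in> U)"

definition open_in_set :: "'a::linordered_field list set \<Rightarrow> 'a list set \<Rightarrow> bool" where
  "open_in_set X W \<longleftrightarrow> W \<subseteq> X \<and> (\<forall>x\<in>W. \<exists>e>0. \<forall>y\<in>X. ldist x y < e \<longrightarrow> y \<in> W)"

definition contF :: "'a::linordered_field list set \<Rightarrow> ('a list \<Rightarrow> 'a) \<Rightarrow> bool" where
  "contF U g \<longleftrightarrow> (\<forall>x\<in>U. \<forall>e>0. \<exists>d>0. \<forall>y\<in>U. ldist x y < d \<longrightarrow> \<bar>g y - g x\<bar> < e)"

text \<open>c is the i-th partial derivative of g at x (within U; U will be open).\<close>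
definition has_partial :: "'a::linordered_field list set \<Rightarrow> ('a list \<Rightarrow> 'a) \<Rightarrow> nat \<Rightarrow> 'a list \<Rightarrow> 'a \<Rightarrow> bool" where
  "has_partial U g i x c \<longleftrightarrow>
     (\<forall>e>0. \<exists>d>0. \<forall>t. t \<noteq> 0 \<and> \<bar>t\<bar> < d \<and> x[i := x ! i + t] \<in> U \<longrightarrow>
        \<bar>(g (x[i := x ! i + t]) - g x) / t - c\<bar> < e)"

fun Cr :: "nat \<Rightarrow> nat \<Rightarrow> 'a::linordered_field list set \<Rightarrow> ('a list \<Rightarrow> 'a) \<Rightarrow> bool" where
  "Cr n 0 U g = contF U g"
| "Cr n (Suc r) U g = (contF U g \<and>
     (\<exists>ds. (\<forall>i<n. \<forall>x\<in>U. has_partial U g i x (ds i x)) \<and> (\<forall>i<n. Cr n r U (ds i))))"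

definition definable_map :: "('a::linordered_field list set \<Rightarrow> bool) \<Rightarrow> 'a list set \<Rightarrow> ('a list \<Rightarrow> 'a list) \<Rightarrow> bool" where
  "definable_map D U f \<longleftrightarrow> D {x @ f x | x. x \<in> U}"

definition Dr_map :: "('a::linordered_field list set \<Rightarrow> bool) \<Rightarrow> nat \<Rightarrow> nat \<Rightarrow> nat \<Rightarrow> 'a list set \<Rightarrow> ('a list \<Rightarrow> 'a list) \<Rightarrow> bool" where
  "Dr_map D n m r U f \<longleftrightarrow> definable_map D U f \<and> (\<forall>x\<in>U. length (f x) = m) \<and>
     (\<forall>j<m. Cr n r U (\<lambda>x. f x ! j))"

definition Dr_diffeo :: "('a::linordered_field list set \<Rightarrow> bool) \<Rightarrow> nat \<Rightarrow> nat \<Rightarrow> 'a list set \<Rightarrow> 'a list set \<Rightarrow> ('a list \<Rightarrow> 'a list) \<Rightarrow> bool" where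
  "Dr_diffeo D n r U V \<phi> \<longleftrightarrow> Dr_map D n n r U \<phi> \<and> \<phi> ` U = V \<and>
     (\<exists>\<psi>. Dr_map D n n r V \<psi> \<and> (\<forall>x\<in>U. \<psi> (\<phi> x) = x) \<and> (\<forall>y\<in>V. \<phi> (\<psi> y) = y))"

definition Dr_submanifold :: "('a::linordered_field list set \<Rightarrow> bool) \<Rightarrow> nat \<Rightarrow> nat \<Rightarrow> nat \<Rightarrow> 'a list set \<Rightarrow> bool" where
  "Dr_submanifold D r n d N \<longleftrightarrow> D N \<and> N \<subseteq> Fn n \<and> d \<le> n \<and>
     (\<forall>a\<in>N. \<exists>U V \<phi>. D U \<and> openF n U \<and> a \<in> U \<and> D V \<and> openF n V \<and> replicate n 0 \<in> V \<and>
        Dr_diffeo D n r U V \<phi> \<and> \<phi> a = replicate n 0 \<and>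
        \<phi> ` (N \<inter> U) = {x \<in> V. \<forall>i. d \<le> i \<and> i < n \<longrightarrow> x ! i = 0})"

definition proj :: "nat set \<Rightarrow> 'a list \<Rightarrow> 'a list" where
  "proj S x = map (\<lambda>i. x ! i) (sorted_list_of_set S)"

definition open_box :: "nat \<Rightarrow> 'a::linordered_field list set \<Rightarrow> bool" where
  "open_box n B \<longleftrightarrow> (\<exists>a b. length a = n \<and> length b = n \<and> (\<forall>i<n. a ! i < b ! i) \<and>
     B = {y \<in> Fn n. \<forall>i<n. a ! i < y ! i \<and> y ! i < b ! i})"

definition quasi_special_wrt :: "('a::linordered_field list set \<Rightarrow> bool) \<Rightarrow> nat \<Rightarrow> nat \<Rightarrow> nat set \<Rightarrow> 'a list set \<Rightarrow> bool" where
  "quasi_special_wrt D r n S Y \<longleftrightarrow> D Y \<and> Y \<subseteq> Fn n \<and> S \<subseteq> {..<n} \<and>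
     openF (card S) (proj S ` Y) \<and>
     (\<forall>x\<in>proj S ` Y. \<exists>U. open_box (card S) U \<and> x \<in> U \<and>
        (\<forall>y\<in>Y. proj S y = x \<longrightarrow>
           (\<exists>V \<tau>. open_box n V \<and> y \<in> V \<and> Dr_map D (card S) n r U \<tau> \<and>
              proj S ` V = U \<and> \<tau> ` U = Y \<inter> V \<and> (\<forall>u\<in>U. proj S (\<tau> u) = u))))"

definition quasi_special :: "('a::linordered_field list set \<Rightarrow> bool) \<Rightarrow> nat \<Rightarrow> nat \<Rightarrow> 'a list set \<Rightarrow> bool" where
  "quasi_special D r n Y \<longleftrightarrow> (\<exists>S. quasi_special_wrt D r n S Y)"

end

theory Submission
  imports Defs Complex_Main
begin

text \<open>
  For a set \<open>S\<close> of \<open>d\<close> coordinates let \<open>X_S\<close> consist of the points of \<open>X\<close> near which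
  \<open>|x - y| \<le> C |\<pi>_S x - \<pi>_S y|\<close> holds on \<open>X\<close> for some \<open>C\<close>.  Unlike smoothness this is a first-order condition,
  so \<open>X_S\<close> is definable, and it is open in \<open>X\<close>.  If a set is locally a \<open>C^r\<close> graph over some coordinates
  and satisfies a Lipschitz condition as above with respect to coordinates \<open>T\<close>, then the Lipschitz condition
  forces a partial derivative to be nonzero, and the implicit function theorem for one equation
  exchanges a coordinate outside \<open>T\<close> for one in \<open>T\<close>.  Applied to the graph of a chart this shows that the \<open>X_S\<close>
  cover \<open>X\<close>; applied to \<open>X\<close> itself, that \<open>X\<close> is a \<open>C^r\<close> graph over \<open>S\<close> near each point of \<open>X_S\<close>.

  The fibres of \<open>\<pi>_S\<close> on \<open>X_S\<close> are discrete.  A definable function on a discrete definable set takes its values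
  in a set without interior, so by local o-minimality a positive one is bounded away from \<open>0\<close>.
  Hence the sections through all the points of a fibre exist on one common box.
\<close>

section \<open>Definable sets and functions\<close>

text \<open>The obstacle is an order of quantifiers: the box \<open>U\<close> depends on the base
  point alone, before any point \<open>y\<close> of the fibre is chosen, and a fibre cannot be
  assumed finite, so no minimum over it is at hand. Hence the statement that a section through
  \<open>y\<close> exists over the box of radius \<open>e\<close> has to be put in first-order form.
  Only a point over each base point and a Lipschitz bound in a box are demanded. The bound gives
  uniqueness, and smoothness is regained afterwards, because the bound also keeps the section in the
  region where the set is known to be a \<open>C^r\<close> graph. The height of the box and the
  constant may vary along the fibre. The graph of the chart replaces an inverse function theorem: it
  is a graph from the outset, and exchanging single coordinates avoids matrices. Definable
  completeness gives instead an induction along intervals for definable predicates; this is why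
  derivatives have to be shown definable as well.\<close>

lemma Fn_iff [simp]: "x \<in> Fn n \<longleftrightarrow> length x = n"
  by (simp add: Fn_def)

locale definable_str =
  fixes D :: "'a::linordered_field list set \<Rightarrow> bool"
  assumes str: "definable_structure D"
begin

lemmas str_0 = str[unfolded definable_structure_def]
lemmas str_1 = conjunct2[OF str_0]
lemmas str_2 = conjunct2[OF str_1]
lemmas str_3 = conjunct2[OF str_2]
lemmas str_4 = conjunct2[OF str_3]
lemmas str_5 = conjunct2[OF str_4]
lemmas str_6 = conjunct2[OF str_5]
lemmas str_7 = conjunct2[OF str_6]
lemmas str_8 = conjunct2[OF str_7]
lemmas str_9 = conjunct2[OF str_8]
lemmas str_10 = conjunct2[OF str_9]
lemmas str_11 = conjunct2[OF str_10]

lemmas D_Fn = str_1[THEN conjunct1, rule_format]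
lemmas D_Int = str_2[THEN conjunct1, rule_format]
lemmas D_Diff = str_3[THEN conjunct1, rule_format]
lemmas D_Cons = str_5[THEN conjunct1, rule_format]
lemmas D_diag = str_6[THEN conjunct1, rule_format]
lemmas D_butlast = str_7[THEN conjunct1, rule_format]
lemmas D_single = str_8[THEN conjunct1, rule_format]
lemmas D_add = str_9[THEN conjunct1, rule_format]
lemmas D_mult = str_10[THEN conjunct1, rule_format]
lemmas D_less = str_11[rule_format]

section \<open>Projections and relabelling of coordinates\<close>

lemma D_prepend:
  assumes "D A" shows "D {x @ y | x y. x \<in> Fn m \<and> y \<in> A}"
proof (induction m)
  case 0
  have "{x @ y | x y. x \<in> Fn 0 \<and> y \<in> A} = A"
    by auto
  then show ?case using assms by (rule ssubst)
next
  case (Suc m)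
  have "{x @ y | x y. x \<in> Fn (Suc m) \<and> y \<in> A}
      = {a # x | a x. x \<in> {x @ y | x y. x \<in> Fn m \<and> y \<in> A}}"
    (is "?L = ?R")
  proof
    show "?L \<subseteq> ?R"
    proof
      fix z assume "z \<in> ?L"
      then obtain x y where z: "z = x @ y" "length x = Suc m" "y \<in> A" by auto
      then obtain a x' where x: "x = a # x'" by (cases x) auto
      have "x' @ y \<in> {x @ y | x y. x \<in> Fn m \<and> y \<in> A}" using z x by auto
      moreover have "z = a # (x' @ y)" using z x by simp
      ultimately show "z \<in> ?R" by blast
    qed
    show "?R \<subseteq> ?L"
    proof
      fix z assume "z \<in> ?R"
      then obtain a x y where z: "z = a # (x @ y)" "length x = m" "y \<in> A" by auto
      then have "z = (a # x) @ y" "a # x \<in> Fn (Suc m)" by auto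
      with z(3) show "z \<in> ?L" by blast
    qed
  qed
  then show ?case using D_Cons[OF Suc] by (rule ssubst)
qed

lemma D_take:
  assumes "D A" "A \<subseteq> Fn (m + n)" shows "D (take m ` A)"
  using assms
proof (induction n arbitrary: A)
  case 0
  then have "take m ` A = A" by (force simp: subset_iff image_iff)
  then show ?case using 0 by simp
next
  case (Suc n)
  have l: "length x = Suc (m + n)" if "x \<in> A" for x using Suc.prems that by auto
  have "butlast ` A \<subseteq> Fn (m + n)" using l by auto
  moreover have "take m ` butlast ` A = take m ` A"
    using l by (simp add: image_image take_butlast cong: image_cong)
  ultimately show ?case using Suc.IH[OF D_butlast[OF Suc.prems(1)]] by simp
qed

text \<open>The set is a projection of \<open>F^m \<times> A\<close> cut by finitely many diagonals.
  Depending on \<open>E\<close> this one construction permutes and repeats variables, adds dummy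
  ones and quantifies, since coordinates of \<open>y\<close> missing from \<open>E\<close> are
  projected away.\<close>

lemma D_rel:
  assumes A: "D A" "A \<subseteq> Fn n" and E: "finite E" "E \<subseteq> {..<m} \<times> {..<n}"
  shows "D {x \<in> Fn m. \<exists>y\<in>A. \<forall>(i, j)\<in>E. x ! i = y ! j}"
proof -
  have "D {z \<in> Fn (m + n). \<forall>(i, j)\<in>E. z ! i = z ! (m + j)}" using E
  proof (induction E)
    case empty
    then show ?case using D_Fn[of "m + n"] by (simp add: Fn_def)
  next
    case (insert p E)
    obtain i j where p: "p = (i, j)" by force
    have "{z \<in> Fn (m + n). \<forall>(i, j)\<in>insert p E. z ! i = z ! (m + j)}
      = {z \<in> Fn (m + n). \<forall>(i, j)\<in>E. z ! i = z ! (m + j)} \<inter> {z \<in> Fn (m + n). z ! i = z ! (m + j)}"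
      unfolding p by auto
    moreover have "D (\<dots>)" using insert p by (intro D_Int D_diag insert.IH) auto
    ultimately show ?case by (rule ssubst)
  qed
  then have "D (take m ` ({x @ y | x y. x \<in> Fn m \<and> y \<in> A} \<inter>
      {z \<in> Fn (m + n). \<forall>(i, j)\<in>E. z ! i = z ! (m + j)}))" (is "D (take m ` ?B)")
    by (intro D_take[of _ _ n] D_Int D_prepend A) auto
  moreover have "take m ` ?B = {x \<in> Fn m. \<exists>y\<in>A. \<forall>(i, j)\<in>E. x ! i = y ! j}" (is "_ = ?C")
  proof
    show "take m ` ?B \<subseteq> ?C" using E by (fastforce simp: nth_append)
    show "?C \<subseteq> take m ` ?B"
    proof
      fix x assume "x \<in> ?C"
      then obtain y where y: "length x = m" "y \<in> A" "\<forall>(i, j)\<in>E. x ! i = y ! j" by auto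
      then have "x @ y \<in> ?B" using E A by (fastforce simp: nth_append)
      then show "x \<in> take m ` ?B" using y by (intro image_eqI[of _ _ "x @ y"]) auto
    qed
  qed
  ultimately show ?thesis by simp
qed

text \<open>Formulas are handled semantically: a formula is a predicate on assignments of all variables,
  and binders follow de Bruijn's convention, so that variable 0 is the innermost bound one.\<close>

definition def_pred :: "((nat \<Rightarrow> 'a) \<Rightarrow> bool) \<Rightarrow> bool" where
  "def_pred P \<longleftrightarrow> (\<exists>n A. D A \<and> A \<subseteq> Fn n \<and> (\<forall>\<rho>. P \<rho> \<longleftrightarrow> map \<rho> [0..<n] \<in> A))"

definition def_term :: "((nat \<Rightarrow> 'a) \<Rightarrow> 'a) \<Rightarrow> bool" where
  "def_term t \<longleftrightarrow> def_pred (\<lambda>\<rho>. \<rho> 0 = t (\<lambda>i. \<rho> (Suc i)))"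

definition def_vec :: "nat \<Rightarrow> ((nat \<Rightarrow> 'a) \<Rightarrow> 'a list) \<Rightarrow> bool" where
  "def_vec n v \<longleftrightarrow> (\<forall>\<rho>. length (v \<rho>) = n) \<and> (\<forall>i<n. def_term (\<lambda>\<rho>. v \<rho> ! i))"

text \<open>The graph is taken over all of \<open>Fn n\<close>, so that such a function can be
  evaluated at any term without a side condition; functions with a smaller domain are later extended
  by 0.\<close>

definition def_fun :: "nat \<Rightarrow> ('a list \<Rightarrow> 'a) \<Rightarrow> bool" where
  "def_fun n g \<longleftrightarrow> D {x @ [g x] | x. x \<in> Fn n}"

lemma def_predI:
  "D A \<Longrightarrow> A \<subseteq> Fn n \<Longrightarrow> (\<And>\<rho>. map \<rho> [0..<n] \<in> A \<longleftrightarrow> P \<rho>) \<Longrightarrow> def_pred P"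
  unfolding def_pred_def by blast

lemma D_reindex:
  assumes "D A" "A \<subseteq> Fn n" "\<And>i. i < n \<Longrightarrow> \<sigma> i < m"
  shows "\<exists>B. D B \<and> B \<subseteq> Fn m \<and> (\<forall>\<rho>. map (\<lambda>i. \<rho> (\<sigma> i)) [0..<n] \<in> A \<longleftrightarrow> map \<rho> [0..<m] \<in> B)"
proof -
  let ?E = "(\<lambda>j. (\<sigma> j, j)) ` {..<n}"
  let ?B = "{x \<in> Fn m. \<exists>y\<in>A. \<forall>(i, j)\<in>?E. x ! i = y ! j}"
  have "D ?B" using assms by (intro D_rel) auto
  moreover have "map (\<lambda>i. \<rho> (\<sigma> i)) [0..<n] \<in> A \<longleftrightarrow> map \<rho> [0..<m] \<in> ?B" for \<rho>
  proof
    assume "map (\<lambda>i. \<rho> (\<sigma> i)) [0..<n] \<in> A"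
    then show "map \<rho> [0..<m] \<in> ?B" using assms(3)
      by (auto intro!: bexI[of _ "map (\<lambda>i. \<rho> (\<sigma> i)) [0..<n]"])
  next
    assume "map \<rho> [0..<m] \<in> ?B"
    then obtain y where y: "y \<in> A" "\<forall>j<n. \<rho> (\<sigma> j) = y ! j" using assms(3) by auto
    then have "map (\<lambda>i. \<rho> (\<sigma> i)) [0..<n] = y"
      using assms(2) by (intro nth_equalityI) auto
    then show "map (\<lambda>i. \<rho> (\<sigma> i)) [0..<n] \<in> A" using y by simp
  qed
  ultimately show ?thesis by (intro exI[of _ ?B]) auto
qed

lemma def_pred_subst:
  assumes "def_pred P" shows "def_pred (\<lambda>\<rho>. P (\<lambda>i. \<rho> (\<sigma> i)))"
proof -
  obtain n A where A: "D A" "A \<subseteq> Fn n" "\<And>\<rho>. P \<rho> \<longleftrightarrow> map \<rho> [0..<n] \<in> A"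
    using assms unfolding def_pred_def by blast
  \<comment> \<open>Any common bound for the finitely many indices \<open>\<sigma> i\<close> can be
    the new arity; the sum provides one.\<close>
  have "\<sigma> i < Suc (sum \<sigma> {..<n})" if "i < n" for i
    using member_le_sum[of i "{..<n}" \<sigma>] that by (simp add: less_Suc_eq_le)
  from D_reindex[OF A(1,2), of \<sigma>, OF this] show ?thesis
    unfolding def_pred_def A(3) by blast
qed

text \<open>Padding with dummy variables makes every large arity possible, which lets two predicates
  share one.\<close>

lemma def_pred_arity:
  assumes "def_pred P"
  shows "\<exists>n. \<forall>m\<ge>n. \<exists>A. D A \<and> A \<subseteq> Fn m \<and> (\<forall>\<rho>. P \<rho> \<longleftrightarrow> map \<rho> [0..<m] \<in> A)"
proof -
  obtain n A where A: "D A" "A \<subseteq> Fn n" "\<And>\<rho>. P \<rho> \<longleftrightarrow> map \<rho> [0..<n] \<in> A"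
    using assms unfolding def_pred_def by blast
  have "\<exists>B. D B \<and> B \<subseteq> Fn m \<and> (\<forall>\<rho>. P \<rho> \<longleftrightarrow> map \<rho> [0..<m] \<in> B)" if "m \<ge> n" for m
    using D_reindex[OF A(1,2), of "\<lambda>i. i" m] that A(3) by fastforce
  then show ?thesis by blast
qed

lemma def_pred_conj:
  assumes "def_pred P" "def_pred Q" shows "def_pred (\<lambda>\<rho>. P \<rho> \<and> Q \<rho>)"
proof -
  obtain n m where n: "\<And>k. k \<ge> n \<Longrightarrow> \<exists>A. D A \<and> A \<subseteq> Fn k \<and> (\<forall>\<rho>. P \<rho> \<longleftrightarrow> map \<rho> [0..<k] \<in> A)"
    and m: "\<And>k. k \<ge> m \<Longrightarrow> \<exists>A. D A \<and> A \<subseteq> Fn k \<and> (\<forall>\<rho>. Q \<rho> \<longleftrightarrow> map \<rho> [0..<k] \<in> A)"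
    using def_pred_arity assms by metis
  obtain A B where "D A" "A \<subseteq> Fn (max n m)" "\<And>\<rho>. P \<rho> \<longleftrightarrow> map \<rho> [0..<max n m] \<in> A"
    "D B" "B \<subseteq> Fn (max n m)" "\<And>\<rho>. Q \<rho> \<longleftrightarrow> map \<rho> [0..<max n m] \<in> B"
    using n[of "max n m"] m[of "max n m"] by auto
  then show ?thesis unfolding def_pred_def
    by (intro exI[of _ "max n m"] exI[of _ "A \<inter> B"]) (auto intro: D_Int)
qed

lemma def_pred_not:
  assumes "def_pred P" shows "def_pred (\<lambda>\<rho>. \<not> P \<rho>)"
proof -
  obtain n A where A: "D A" "A \<subseteq> Fn n" "\<And>\<rho>. P \<rho> \<longleftrightarrow> map \<rho> [0..<n] \<in> A"
    using assms unfolding def_pred_def by blast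
  then show ?thesis unfolding def_pred_def
    by (intro exI[of _ n] exI[of _ "Fn n - A"]) (auto intro: D_Diff)
qed

lemma def_pred_disj:
  assumes "def_pred P" "def_pred Q" shows "def_pred (\<lambda>\<rho>. P \<rho> \<or> Q \<rho>)"
proof -
  have "def_pred (\<lambda>\<rho>. \<not> (\<not> P \<rho> \<and> \<not> Q \<rho>))" by (intro def_pred_not def_pred_conj assms)
  then show ?thesis by simp
qed

lemma def_pred_imp:
  assumes "def_pred P" "def_pred Q" shows "def_pred (\<lambda>\<rho>. P \<rho> \<longrightarrow> Q \<rho>)"
  unfolding imp_conv_disj by (intro def_pred_not def_pred_disj assms)

lemma def_pred_const: "def_pred (\<lambda>\<rho>. P)"
proof -
  have "D {}" using D_Diff[OF D_Fn[of 0], of 0] by simp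
  then show ?thesis by (intro def_predI[of "if P then Fn 0 else {}" 0]) (auto intro: D_Fn)
qed

text \<open>Coordinate \<open>i\<close> of the parameters is tied to coordinate \<open>Suc i\<close>
  of a point of \<open>A\<close>, so coordinate 0, the bound variable, stays free and is projected
  away. The assignment \<open>case_nat a \<rho>\<close> puts a witness in front.\<close>

lemma def_pred_ex:
  assumes "def_pred (\<lambda>\<rho>. P (\<lambda>i. \<rho> (Suc i)) (\<rho> 0))"
  shows "def_pred (\<lambda>\<rho>. \<exists>a. P \<rho> a)"
proof -
  obtain n where "\<forall>m\<ge>n. \<exists>A. D A \<and> A \<subseteq> Fn m \<and> (\<forall>\<rho>. P (\<lambda>i. \<rho> (Suc i)) (\<rho> 0) \<longleftrightarrow> map \<rho> [0..<m] \<in> A)"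
    using def_pred_arity[OF assms] by blast
  then obtain A where A: "D A" "A \<subseteq> Fn (Suc n)"
    "\<And>\<rho>. P (\<lambda>i. \<rho> (Suc i)) (\<rho> 0) \<longleftrightarrow> map \<rho> [0..<Suc n] \<in> A"
    by (meson le_SucI order_refl)
  let ?E = "(\<lambda>i. (i, Suc i)) ` {..<n}"
  let ?B = "{x \<in> Fn n. \<exists>y\<in>A. \<forall>(i, j)\<in>?E. x ! i = y ! j}"
  have "D ?B" using A by (intro D_rel) auto
  moreover have "(\<exists>a. P \<rho> a) \<longleftrightarrow> map \<rho> [0..<n] \<in> ?B" for \<rho>
  proof
    assume "\<exists>a. P \<rho> a"
    then obtain a where "P \<rho> a" by blast
    then have "map (case_nat a \<rho>) [0..<Suc n] \<in> A" using A(3)[of "case_nat a \<rho>"] by simp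
    then show "map \<rho> [0..<n] \<in> ?B"
      by (auto simp del: upt_Suc intro!: bexI[of _ "map (case_nat a \<rho>) [0..<Suc n]"])
  next
    assume "map \<rho> [0..<n] \<in> ?B"
    then obtain y where y: "y \<in> A" "\<forall>i<n. \<rho> i = y ! Suc i" by auto
    have "map (case_nat (y ! 0) \<rho>) [0..<Suc n] = y"
      using y A(2) by (intro nth_equalityI) (auto simp del: upt_Suc split: nat.split)
    then have "P \<rho> (y ! 0)" using A(3)[of "case_nat (y ! 0) \<rho>"] y by simp
    then show "\<exists>a. P \<rho> a" by blast
  qed
  ultimately show ?thesis unfolding def_pred_def by (intro exI[of _ n] exI[of _ ?B]) auto
qed

lemma def_pred_all:
  assumes "def_pred (\<lambda>\<rho>. P (\<lambda>i. \<rho> (Suc i)) (\<rho> 0))"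
  shows "def_pred (\<lambda>\<rho>. \<forall>a. P \<rho> a)"
proof -
  have "def_pred (\<lambda>\<rho>. \<not> (\<exists>a. \<not> P \<rho> a))" by (intro def_pred_not def_pred_ex assms)
  then show ?thesis by simp
qed

lemma def_pred_ball_finite:
  assumes "finite I" "\<And>i. i \<in> I \<Longrightarrow> def_pred (\<lambda>\<rho>. P i \<rho>)"
  shows "def_pred (\<lambda>\<rho>. \<forall>i\<in>I. P i \<rho>)"
  using assms by (induction I) (auto intro: def_pred_const def_pred_conj)

lemma def_pred_all_less:
  fixes n :: nat
  assumes "\<And>i. i < n \<Longrightarrow> def_pred (\<lambda>\<rho>. P i \<rho>)"
  shows "def_pred (\<lambda>\<rho>. \<forall>i<n. P i \<rho>)"
proof -
  have "def_pred (\<lambda>\<rho>. \<forall>i\<in>{..<n}. P i \<rho>)" using assms by (intro def_pred_ball_finite) auto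
  then show ?thesis by (simp add: Ball_def)
qed

text \<open>The head of the vector is bound innermost: it becomes variable 0 and the tail the next
  variables, so that the vector reads \<open>map \<rho> [0..<n]\<close> and outer variables are
  shifted by \<open>n\<close>.\<close>

lemma def_pred_ex_vec:
  "def_pred (\<lambda>\<rho>. P (\<lambda>i. \<rho> (i + n)) (map \<rho> [0..<n])) \<Longrightarrow> def_pred (\<lambda>\<rho>. \<exists>x\<in>Fn n. P \<rho> x)"
proof (induction n arbitrary: P)
  case 0
  have "(\<exists>x\<in>Fn 0. P \<rho> x) = P \<rho> []" for \<rho> by auto
  then show ?case using 0 by simp
next
  case (Suc n)
  have "(\<exists>x\<in>Fn (Suc n). P \<rho> x) = (\<exists>x\<in>Fn n. \<exists>a. P \<rho> (a # x))" for \<rho>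
    by (auto simp: length_Suc_conv Fn_def) 
  moreover have "def_pred (\<lambda>\<rho>. \<exists>x\<in>Fn n. \<exists>a. P \<rho> (a # x))"
    using Suc.prems
    by (intro Suc.IH def_pred_ex) (simp add: map_upt_Suc del: upt_Suc)
  ultimately show ?case by simp
qed

lemma def_pred_all_vec:
  assumes "def_pred (\<lambda>\<rho>. P (\<lambda>i. \<rho> (i + n)) (map \<rho> [0..<n]))"
  shows "def_pred (\<lambda>\<rho>. \<forall>x\<in>Fn n. P \<rho> x)"
proof -
  have "def_pred (\<lambda>\<rho>. \<not> (\<exists>x\<in>Fn n. \<not> P \<rho> x))" by (intro def_pred_not def_pred_ex_vec assms)
  then show ?thesis by simp
qed

section \<open>Terms and the field operations\<close>

lemma def_pred_eq_var: "def_pred (\<lambda>\<rho>. \<rho> i = \<rho> j)"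
proof (rule def_predI[OF D_diag[of i "Suc (max i j)" j]])
  show "map \<rho> [0..<Suc (max i j)] \<in> {x \<in> Fn (Suc (max i j)). x ! i = x ! j} \<longleftrightarrow> \<rho> i = \<rho> j" for \<rho> :: "nat \<Rightarrow> 'a"
    by (simp del: upt_Suc)
qed auto

lemma def_term_var: "def_term (\<lambda>\<rho>. \<rho> i)"
  unfolding def_term_def by (rule def_pred_eq_var)

lemma def_term_const: "def_term (\<lambda>\<rho>. c)"
  unfolding def_term_def by (rule def_predI[OF D_single[of c], of 1]) auto

lemma def_term_subst: "def_term t \<Longrightarrow> def_term (\<lambda>\<rho>. t (\<lambda>i. \<rho> (\<sigma> i)))"
  unfolding def_term_def
  using def_pred_subst[of "\<lambda>\<rho>. \<rho> 0 = t (\<lambda>i. \<rho> (Suc i))" "case_nat 0 (\<lambda>i. Suc (\<sigma> i))"] by simp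

text \<open>Terms are substituted into formulas by means of an auxiliary bound variable.\<close>

lemma def_pred_term:
  assumes t: "def_term t" and P: "def_pred (\<lambda>\<rho>. P (\<lambda>i. \<rho> (Suc i)) (\<rho> 0))"
  shows "def_pred (\<lambda>\<rho>. P \<rho> (t \<rho>))"
proof -
  have t': "def_pred (\<lambda>\<rho>. \<rho> 0 = t (\<lambda>i. \<rho> (Suc i)))" using t by (simp only: def_term_def)
  have "def_pred (\<lambda>\<rho>. \<exists>a. a = t \<rho> \<and> P \<rho> a)"
    by (intro def_pred_ex def_pred_conj t' P)
  then show ?thesis by simp
qed

lemma def_pred_eq: 
  assumes "def_term s" "def_term t" shows "def_pred (\<lambda>\<rho>. s \<rho> = t \<rho>)"
  using def_pred_term[OF assms(1), of "\<lambda>\<rho> a. a = t \<rho>"] assms(2) unfolding def_term_def by simp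

lemma def_pred_less: 
  assumes "def_term s" "def_term t" shows "def_pred (\<lambda>\<rho>. s \<rho> < t \<rho>)"
proof -
  have "def_pred (\<lambda>\<rho>. \<rho> 0 < \<rho> 1)"
    by (rule def_predI[OF D_less, of 2]) (auto simp: numeral_2_eq_2)
  then have 1: "def_pred (\<lambda>\<rho>. \<rho> i < \<rho> j)" for i j
    using def_pred_subst[of "\<lambda>\<rho>. \<rho> 0 < \<rho> 1" "\<lambda>k. if k = 0 then i else j"] by simp
  show ?thesis
    by (rule def_pred_term[OF assms(1)], rule def_pred_term[OF def_term_subst[OF assms(2)]], rule 1)
qed

lemma def_pred_le: 
  assumes "def_term s" "def_term t" shows "def_pred (\<lambda>\<rho>. s \<rho> \<le> t \<rho>)"
proof -
  have "def_pred (\<lambda>\<rho>. \<not> t \<rho> < s \<rho>)" by (intro def_pred_not def_pred_less assms)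
  then show ?thesis by (simp add: not_less)
qed

lemma def_term_binop:
  assumes f: "D {[x, y, z] | x y z. z = f x y}" and st: "def_term s" "def_term t"
  shows "def_term (\<lambda>\<rho>. f (s \<rho>) (t \<rho>))"
proof -
  have "def_pred (\<lambda>\<rho>. \<rho> 2 = f (\<rho> 0) (\<rho> 1))"
    by (rule def_predI[OF f, of 3]) (auto simp: numeral_3_eq_3 numeral_2_eq_2)
  then have 1: "def_pred (\<lambda>\<rho>. \<rho> k = f (\<rho> i) (\<rho> j))" for i j k
    using def_pred_subst[of "\<lambda>\<rho>. \<rho> 2 = f (\<rho> 0) (\<rho> 1)" "\<lambda>l. if l = 0 then i else if l = 1 then j else k"]
    by simp
  show ?thesis unfolding def_term_def
    by (rule def_pred_term[OF def_term_subst[OF st(1)]], rule def_pred_term[OF def_term_subst[OF st(2)]], rule 1)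
qed

lemmas def_term_add = def_term_binop[OF D_add]
lemmas def_term_mult = def_term_binop[OF D_mult]

lemma def_termI:
  assumes "def_pred (\<lambda>\<rho>. Q (\<lambda>i. \<rho> (Suc i)) (\<rho> 0))" "\<And>\<rho> a. Q \<rho> a \<longleftrightarrow> a = t \<rho>"
  shows "def_term t"
  using assms by (simp add: def_term_def)

lemma def_term_uminus:
  assumes "def_term t" shows "def_term (\<lambda>\<rho>. - t \<rho>)"
proof -
  have "def_term (\<lambda>\<rho>. (-1) * t \<rho>)" by (intro def_term_mult def_term_const assms)
  then show ?thesis by simp
qed

lemma def_term_diff:
  assumes "def_term s" "def_term t" shows "def_term (\<lambda>\<rho>. s \<rho> - t \<rho>)"
proof -
  have "def_term (\<lambda>\<rho>. s \<rho> + - t \<rho>)" by (intro def_term_add def_term_uminus assms)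
  then show ?thesis by simp
qed

lemma def_term_inverse:
  assumes "def_term t" shows "def_term (\<lambda>\<rho>. inverse (t \<rho>))"
\<comment> \<open>The first disjunct is there because \<open>inverse 0 = 0\<close>.\<close>
proof (rule def_termI[where Q = "\<lambda>\<rho> a. (t \<rho> = 0 \<and> a = 0) \<or> a * t \<rho> = 1"])
  show "def_pred (\<lambda>\<rho>. (t (\<lambda>i. \<rho> (Suc i)) = 0 \<and> \<rho> 0 = 0) \<or> \<rho> 0 * t (\<lambda>i. \<rho> (Suc i)) = 1)"
    by (intro def_pred_disj def_pred_conj def_pred_eq def_term_mult def_term_const def_term_var
        def_term_subst[OF assms])
  show "(t \<rho> = 0 \<and> a = 0) \<or> a * t \<rho> = 1 \<longleftrightarrow> a = inverse (t \<rho>)" for \<rho> a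
    by (cases "t \<rho> = 0") (auto simp: field_simps)
qed

lemma def_term_divide: "def_term s \<Longrightarrow> def_term t \<Longrightarrow> def_term (\<lambda>\<rho>. s \<rho> / t \<rho>)"
  unfolding divide_inverse by (intro def_term_mult def_term_inverse)

lemma def_term_if:
  assumes "def_pred P" "def_term s" "def_term t" shows "def_term (\<lambda>\<rho>. if P \<rho> then s \<rho> else t \<rho>)"
proof (rule def_termI[where Q = "\<lambda>\<rho> a. P \<rho> \<and> a = s \<rho> \<or> \<not> P \<rho> \<and> a = t \<rho>"])
  show "def_pred (\<lambda>\<rho>. P (\<lambda>i. \<rho> (Suc i)) \<and> \<rho> 0 = s (\<lambda>i. \<rho> (Suc i)) \<or> \<not> P (\<lambda>i. \<rho> (Suc i)) \<and> \<rho> 0 = t (\<lambda>i. \<rho> (Suc i)))"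
    by (intro def_pred_disj def_pred_conj def_pred_not def_pred_eq def_term_var
        def_pred_subst[OF assms(1)] def_term_subst[OF assms(2)] def_term_subst[OF assms(3)])
qed auto

lemma def_term_abs: "def_term t \<Longrightarrow> def_term (\<lambda>\<rho>. \<bar>t \<rho>\<bar>)"
  unfolding abs_if by (intro def_term_if def_pred_less def_term_const def_term_uminus)

lemma def_vec_length: "def_vec n v \<Longrightarrow> length (v \<rho>) = n"
  by (simp add: def_vec_def)

lemma def_term_nth: "def_vec n v \<Longrightarrow> i < n \<Longrightarrow> def_term (\<lambda>\<rho>. v \<rho> ! i)"
  by (simp add: def_vec_def)

lemma def_vec_subst: "def_vec n v \<Longrightarrow> def_vec n (\<lambda>\<rho>. v (\<lambda>i. \<rho> (\<sigma> i)))"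
  using def_term_subst by (auto simp: def_vec_def)

lemma def_vec_const: "length a = n \<Longrightarrow> def_vec n (\<lambda>\<rho>. a)"
  by (simp add: def_vec_def def_term_const)

lemma def_vec_map: "(\<And>i. i < n \<Longrightarrow> def_term (\<lambda>\<rho>. t i \<rho>)) \<Longrightarrow> def_vec n (\<lambda>\<rho>. map (\<lambda>i. t i \<rho>) [0..<n])"
  by (simp add: def_vec_def)

lemma def_vec_update:
  assumes v: "def_vec n v" and t: "def_term t" shows "def_vec n (\<lambda>\<rho>. (v \<rho>)[i := t \<rho>])"
  unfolding def_vec_def
proof (intro conjI allI impI)
  fix j assume "j < n"
  then show "def_term (\<lambda>\<rho>. (v \<rho>)[i := t \<rho>] ! j)"
    using t def_term_nth[OF v] by (cases "j = i") (simp_all add: def_vec_length[OF v])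
qed (simp add: def_vec_length[OF v])

lemma def_vec_single: "def_term t \<Longrightarrow> def_vec (Suc 0) (\<lambda>\<rho>. [t \<rho>])"
  by (simp add: def_vec_def)

lemma def_vec_append:
  assumes "def_vec n v" "def_vec m w" shows "def_vec (n + m) (\<lambda>\<rho>. v \<rho> @ w \<rho>)"
  unfolding def_vec_def
proof (intro conjI allI impI)
  fix i assume "i < n + m"
  then show "def_term (\<lambda>\<rho>. (v \<rho> @ w \<rho>) ! i)"
    by (cases "i < n") (auto simp: nth_append def_vec_length[OF assms(1)] intro: def_term_nth assms)
qed (simp add: def_vec_length[OF assms(1)] def_vec_length[OF assms(2)])

lemma def_pred_in:
  assumes A: "D A" "A \<subseteq> Fn n" and v: "def_vec n v" shows "def_pred (\<lambda>\<rho>. v \<rho> \<in> A)"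
proof -
  have "def_pred (\<lambda>\<rho>. map \<rho> [0..<n] \<in> A)" using A unfolding def_pred_def by blast
  then have "def_pred (\<lambda>\<rho>. \<exists>x\<in>Fn n. x \<in> A \<and> (\<forall>i<n. x ! i = v \<rho> ! i))"
    by (intro def_pred_ex_vec def_pred_conj def_pred_all_less def_pred_eq def_term_nth[OF def_vec_subst[OF v]]
        def_term_nth[OF def_vec_map] def_term_var)
  moreover have "(\<exists>x\<in>Fn n. x \<in> A \<and> (\<forall>i<n. x ! i = v \<rho> ! i)) \<longleftrightarrow> v \<rho> \<in> A" for \<rho>
    using def_vec_length[OF v] by (metis Fn_iff nth_equalityI)
  ultimately show ?thesis by simp
qed

text \<open>The way back from predicates to sets. The set that represents the predicate may live in
  a larger arity \<open>n + m\<close>; as the predicate sees only the first \<open>n\<close>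
  coordinates, the zeros used as padding are arbitrary.\<close>

lemma D_Collect:
  assumes "def_pred (\<lambda>\<rho>. P (map \<rho> [0..<n]))" shows "D {x \<in> Fn n. P x}"
proof -
  obtain m where "\<forall>k\<ge>m. \<exists>A. D A \<and> A \<subseteq> Fn k \<and> (\<forall>\<rho>. P (map \<rho> [0..<n]) \<longleftrightarrow> map \<rho> [0..<k] \<in> A)"
    using def_pred_arity[OF assms] by blast
  then obtain A where A: "D A" "A \<subseteq> Fn (n + m)" "\<And>\<rho>. P (map \<rho> [0..<n]) \<longleftrightarrow> map \<rho> [0..<n + m] \<in> A"
    by (meson le_add2)
  have P: "P (take n y) \<longleftrightarrow> y \<in> A" if y: "length y = n + m" for y
  proof -
    have "map ((!) y) [0..<n] = take n y" "map ((!) y) [0..<n + m] = y"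
      using y by (auto intro: nth_equalityI)
    then show ?thesis using A(3)[of "(!) y"] by simp
  qed
  have "{x \<in> Fn n. P x} = take n ` A"
  proof
    show "{x \<in> Fn n. P x} \<subseteq> take n ` A"
    proof
      fix x assume "x \<in> {x \<in> Fn n. P x}"
      then have "x @ replicate m 0 \<in> A" "x = take n (x @ replicate m 0)" using P[of "x @ replicate m 0"] by auto
      then show "x \<in> take n ` A" by blast
    qed
    show "take n ` A \<subseteq> {x \<in> Fn n. P x}" using P A(2) by auto
  qed
  then show ?thesis using D_take[OF A(1,2)] by simp
qed

lemma def_term_fun:
  assumes g: "def_fun n g" and v: "def_vec n v" shows "def_term (\<lambda>\<rho>. g (v \<rho>))"
proof (rule def_termI[where Q = "\<lambda>\<rho> a. v \<rho> @ [a] \<in> {x @ [g x] | x. x \<in> Fn n}"])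
  show "def_pred (\<lambda>\<rho>. v (\<lambda>i. \<rho> (Suc i)) @ [\<rho> 0] \<in> {x @ [g x] | x. x \<in> Fn n})"
    by (rule def_pred_in[OF g[unfolded def_fun_def] _
        def_vec_append[OF def_vec_subst[OF v] def_vec_single[OF def_term_var]]]) auto
  show "v \<rho> @ [a] \<in> {x @ [g x] | x. x \<in> Fn n} \<longleftrightarrow> a = g (v \<rho>)" for \<rho> a
    using def_vec_length[OF v] by auto
qed

lemma def_funI:
  assumes "def_term (\<lambda>\<rho>. g (map \<rho> [0..<n]))" shows "def_fun n g"
proof -
  have "def_pred (\<lambda>\<rho>. \<rho> n = g (map \<rho> [0..<n]))"
    by (intro def_pred_eq def_term_var assms)
  then have "def_pred (\<lambda>\<rho>. map \<rho> [0..<Suc n] ! n = g (take n (map \<rho> [0..<Suc n])))"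
    by (simp add: nth_append)
  then have "D {y \<in> Fn (Suc n). y ! n = g (take n y)}" by (rule D_Collect)
  moreover have "{y \<in> Fn (Suc n). y ! n = g (take n y)} = {x @ [g x] | x. x \<in> Fn n}"
    (is "?L = ?R")
  proof
    show "?L \<subseteq> ?R"
    proof
      fix y assume "y \<in> ?L"
      then have "length (take n y) = n" "y = take n y @ [g (take n y)]"
        using take_Suc_conv_app_nth[of n y] by auto
      then show "y \<in> ?R" by auto
    qed
  qed auto
  ultimately show ?thesis by (simp add: def_fun_def)
qed

lemma def_vec_take_map: "def_vec n (\<lambda>\<rho>. map (\<lambda>i. \<rho> (\<sigma> i)) [0..<n])"
  by (intro def_vec_map def_term_var)

end

section \<open>Cubes and limits\<close>

text \<open>The ball of \<open>ldist\<close>, with the fold replaced by bounds on coordinates.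
  Around the empty list it is \<open>{[]}\<close> for every \<open>e\<close>, so an inclusion of
  cubes compares radii only in positive dimension.\<close>

definition cube :: "'a::linordered_field list \<Rightarrow> 'a \<Rightarrow> 'a list set" where
  "cube x e = {y. length y = length x \<and> (\<forall>i<length x. \<bar>y ! i - x ! i\<bar> < e)}"

lemma lnorm_less: "e > 0 \<Longrightarrow> lnorm xs < e \<longleftrightarrow> (\<forall>i<length xs. \<bar>xs ! i\<bar> < e)"
proof (induction xs)
  case (Cons a xs)
  have "lnorm (a # xs) = max \<bar>a\<bar> (lnorm xs)" by (simp add: lnorm_def)
  then show ?case using Cons by (auto simp: nth_Cons split: nat.split)
qed (simp add: lnorm_def)

lemma ldist_less:
  "e > 0 \<Longrightarrow> length y = length x \<Longrightarrow> ldist x y < e \<longleftrightarrow> y \<in> cube x e"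
  by (auto simp: ldist_def lnorm_less cube_def abs_minus_commute)

lemma openF_iff: "openF n U \<longleftrightarrow> U \<subseteq> Fn n \<and> (\<forall>x\<in>U. \<exists>e>0. cube x e \<subseteq> U)"
  unfolding openF_def
proof (rule conj_cong[OF refl])
  have "(\<exists>e>0. \<forall>y\<in>Fn n. ldist x y < e \<longrightarrow> y \<in> U) \<longleftrightarrow> (\<exists>e>0. cube x e \<subseteq> U)" if x: "length x = n" for x
  proof (intro ex_cong1 conj_cong refl)
    fix e :: 'a assume e: "e > 0"
    have "ldist x y < e \<longleftrightarrow> y \<in> cube x e" if "y \<in> Fn n" for y
      using that x e by (intro ldist_less) auto
    moreover have "cube x e \<subseteq> Fn n" using x by (auto simp: cube_def)
    ultimately show "(\<forall>y\<in>Fn n. ldist x y < e \<longrightarrow> y \<in> U) \<longleftrightarrow> cube x e \<subseteq> U" by blast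
  qed
  note * = this
  assume U: "U \<subseteq> Fn n"
  show "(\<forall>x\<in>U. \<exists>e>0. \<forall>y\<in>Fn n. ldist x y < e \<longrightarrow> y \<in> U) \<longleftrightarrow> (\<forall>x\<in>U. \<exists>e>0. cube x e \<subseteq> U)"
  proof (intro ball_cong refl)
    fix x assume "x \<in> U"
    with U have "length x = n" by auto
    then show "(\<exists>e>0. \<forall>y\<in>Fn n. ldist x y < e \<longrightarrow> y \<in> U) \<longleftrightarrow> (\<exists>e>0. cube x e \<subseteq> U)" by (rule *)
  qed
qed

lemma cube_mono: "d \<le> e \<Longrightarrow> cube x d \<subseteq> cube x e"
  by (force simp: cube_def)

lemma cube_center: "e > 0 \<Longrightarrow> x \<in> cube x e"
  by (simp add: cube_def)

lemma cube_cube: "y \<in> cube x d \<Longrightarrow> z \<in> cube y e \<Longrightarrow> z \<in> cube x (d + e)"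
proof -
  assume y: "y \<in> cube x d" and z: "z \<in> cube y e"
  have "\<bar>z ! i - x ! i\<bar> < d + e" if "i < length x" for i
  proof -
    have "\<bar>y ! i - x ! i\<bar> < d" "\<bar>z ! i - y ! i\<bar> < e" using y z that by (auto simp: cube_def)
    then show ?thesis by linarith
  qed
  then show "z \<in> cube x (d + e)" using y z by (auto simp: cube_def)
qed

lemma openF_cube: "openF (length x) (cube x e)"
  unfolding openF_iff
proof (intro conjI ballI)
  fix y assume y: "y \<in> cube x e"
  have "\<exists>d>0. \<forall>i<length x. \<bar>y ! i - x ! i\<bar> + d \<le> e"
  proof -
    \<comment> \<open>The distance to the nearest face; the 1 keeps the minimum defined in dimension
      0.\<close>
    define d where "d = Min (insert 1 ((\<lambda>i. e - \<bar>y ! i - x ! i\<bar>) ` {..<length x}))"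
    have "d > 0" using y unfolding d_def by (subst Min_gr_iff) (auto simp: cube_def)
    moreover have "d \<le> e - \<bar>y ! i - x ! i\<bar>" if "i < length x" for i
      unfolding d_def using that by (intro Min_le) auto
    ultimately show ?thesis by (intro exI[of _ d]) (auto simp: algebra_simps)
  qed
  then obtain d where d: "d > 0" "\<forall>i<length x. \<bar>y ! i - x ! i\<bar> + d \<le> e" by blast
  have "cube y d \<subseteq> cube x e"
  proof
    fix z assume z: "z \<in> cube y d"
    show "z \<in> cube x e" unfolding cube_def
    proof (intro CollectI conjI allI impI)
      show "length z = length x" using y z by (simp add: cube_def)
      fix i assume i: "i < length x"
      then have "\<bar>z ! i - y ! i\<bar> < d" using y z by (simp add: cube_def)
      then show "\<bar>z ! i - x ! i\<bar> < e" using d(2)[rule_format, OF i] by linarith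
    qed
  qed
  then show "\<exists>d>0. cube y d \<subseteq> cube x e" using d by blast
qed (auto simp: cube_def)

lemma cube_update:
  "y \<in> cube x e \<Longrightarrow> i < length x \<Longrightarrow> \<bar>u - x ! i\<bar> < e \<Longrightarrow> y[i := u] \<in> cube x e"
  by (auto simp: cube_def nth_list_update)

section \<open>Limits and difference quotients\<close>

definition tends :: "('a \<Rightarrow> 'b::linordered_field) \<Rightarrow> 'b \<Rightarrow> 'a filter \<Rightarrow> bool" where
  "tends f c F \<longleftrightarrow> (\<forall>e>0. eventually (\<lambda>x. \<bar>f x - c\<bar> < e) F)"

lemma tendsD: "tends f c F \<Longrightarrow> e > 0 \<Longrightarrow> eventually (\<lambda>x. \<bar>f x - c\<bar> < e) F"
  by (simp add: tends_def)

lemma tends_const: "tends (\<lambda>x. c) c F"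
  by (simp add: tends_def)

lemma tends_cong:
  fixes f g :: "'a \<Rightarrow> 'b::linordered_field"
  assumes "tends f c F" "eventually (\<lambda>x. f x = g x) F" shows "tends g c F"
  unfolding tends_def
proof (intro allI impI)
  fix e :: 'b assume "0 < e"
  from tendsD[OF assms(1) this] assms(2) show "eventually (\<lambda>x. \<bar>g x - c\<bar> < e) F"
    by eventually_elim simp
qed

lemma tends_add:
  fixes f g :: "'a \<Rightarrow> 'b::linordered_field"
  assumes "tends f c F" "tends g d F" shows "tends (\<lambda>x. f x + g x) (c + d) F"
  unfolding tends_def
proof (intro allI impI)
  fix e :: 'b assume "0 < e"
  then have "e / 2 > 0" by simp
  from tendsD[OF assms(1) this] tendsD[OF assms(2) this]
  show "eventually (\<lambda>x. \<bar>f x + g x - (c + d)\<bar> < e) F"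
  proof eventually_elim
    case (elim x)
    have "\<bar>f x + g x - (c + d)\<bar> \<le> \<bar>f x - c\<bar> + \<bar>g x - d\<bar>" by linarith
    also have "\<dots> < e / 2 + e / 2" using elim by (intro add_strict_mono)
    finally show ?case by simp
  qed
qed

text \<open>Product and reciprocal rules reduce to this: once the limit is subtracted, a factor
  tending to 0 meets a bounded one. \<open>K'\<close> is \<open>K\<close> made positive.\<close>

lemma tends_zero_mult:
  fixes f g :: "'a \<Rightarrow> 'b::linordered_field"
  assumes "tends f 0 F" "eventually (\<lambda>x. \<bar>g x\<bar> \<le> K) F" shows "tends (\<lambda>x. f x * g x) 0 F"
  unfolding tends_def
proof (intro allI impI)
  fix e :: 'b assume e: "0 < e"
  define K' where "K' = max K 1"
  have K': "K' > 0" by (simp add: K'_def)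
  then have "e / K' > 0" using e by simp
  from tendsD[OF assms(1) this] assms(2) show "eventually (\<lambda>x. \<bar>f x * g x - 0\<bar> < e) F"
  proof eventually_elim
    case (elim x)
    have "\<bar>f x * g x\<bar> = \<bar>f x\<bar> * \<bar>g x\<bar>" by (rule abs_mult)
    also have "\<dots> \<le> \<bar>f x\<bar> * K'" using elim by (intro mult_left_mono) (auto simp: K'_def)
    also have "\<dots> < (e / K') * K'" using elim K' by (intro mult_strict_right_mono) auto
    finally show ?case using K' by simp
  qed
qed

lemma tends_bounded: 
  assumes "tends f c F" shows "eventually (\<lambda>x. \<bar>f x\<bar> \<le> \<bar>c\<bar> + 1) F"
  using tendsD[OF assms, of 1] by (auto elim!: eventually_mono)

lemma tends_diff_zero: "tends f c F \<longleftrightarrow> tends (\<lambda>x. f x - c) 0 F"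
  by (simp add: tends_def)

lemma tends_mult:
  fixes f g :: "'a \<Rightarrow> 'b::linordered_field"
  assumes "tends f c F" "tends g d F" shows "tends (\<lambda>x. f x * g x) (c * d) F"
proof -
  have "tends (\<lambda>x. (f x - c) * g x + (g x - d) * c) (0 + 0) F"
    using assms by (intro tends_add tends_zero_mult[OF _ tends_bounded[OF assms(2)]] 
        tends_zero_mult[where K = "\<bar>c\<bar>"]) (simp_all add: tends_diff_zero[symmetric])
  then have "tends (\<lambda>x. f x * g x - c * d) 0 F" by (simp add: algebra_simps)
  then show ?thesis by (simp add: tends_diff_zero[symmetric])
qed

lemma tends_nonzero:
  fixes f :: "'a \<Rightarrow> 'b::linordered_field"
  assumes "tends f c F" "c \<noteq> 0" shows "eventually (\<lambda>x. \<bar>f x\<bar> > \<bar>c\<bar> / 2) F"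
proof -
  have "\<bar>c\<bar> / 2 > 0" using assms by simp
  from tendsD[OF assms(1) this] show ?thesis by eventually_elim linarith
qed

lemma tends_inverse:
  fixes f :: "'a \<Rightarrow> 'b::linordered_field"
  assumes "tends f c F" "c \<noteq> 0" shows "tends (\<lambda>x. inverse (f x)) (inverse c) F"
proof -
  \<comment> \<open>The expression equals \<open>1 / f x - 1 / c\<close>, and its second factor is
    bounded because eventually \<open>\<bar>f x\<bar> > \<bar>c\<bar> / 2\<close>.\<close>
  have "tends (\<lambda>x. (f x - c) * (- inverse (f x) * inverse c)) 0 F"
  proof (rule tends_zero_mult)
    show "tends (\<lambda>x. f x - c) 0 F" using assms by (simp add: tends_diff_zero[symmetric])
    show "eventually (\<lambda>x. \<bar>- inverse (f x) * inverse c\<bar> \<le> inverse (\<bar>c\<bar> / 2) * inverse \<bar>c\<bar>) F"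
      using tends_nonzero[OF assms]
    proof eventually_elim
      case (elim x)
      have "inverse \<bar>f x\<bar> \<le> inverse (\<bar>c\<bar> / 2)" using elim assms by (intro le_imp_inverse_le) auto
      then have "inverse \<bar>f x\<bar> * inverse \<bar>c\<bar> \<le> inverse (\<bar>c\<bar> / 2) * inverse \<bar>c\<bar>"
        by (rule mult_right_mono) simp
      then show ?case by (simp add: abs_mult abs_inverse)
    qed
  qed
  then have "tends (\<lambda>x. inverse (f x) - inverse c) 0 F"
  proof (rule tends_cong)
    show "eventually (\<lambda>x. (f x - c) * (- inverse (f x) * inverse c) = inverse (f x) - inverse c) F"
      using tends_nonzero[OF assms]
    proof eventually_elim
      case (elim x)
      then have "f x \<noteq> 0" using assms by auto
      then show ?case using assms by (simp add: field_simps)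
    qed
  qed
  then show ?thesis by (simp add: tends_diff_zero[symmetric])
qed

definition near :: "'a::linordered_field list set \<Rightarrow> 'a list \<Rightarrow> 'a list filter" where
  "near U x = (INF e\<in>{0<..}. principal (U \<inter> cube x e))"

lemma eventually_near:
  "eventually P (near U x) \<longleftrightarrow> (\<exists>e>0. \<forall>y\<in>U \<inter> cube x e. P y)"
proof -
  have "eventually P (near U x) \<longleftrightarrow> (\<exists>e\<in>{0<..}. eventually P (principal (U \<inter> cube x e)))"
    unfolding near_def
  proof (rule eventually_INF_base)
    show "{0::'a<..} \<noteq> {}" using zero_less_one by blast
    fix a b :: 'a assume "a \<in> {0<..}" "b \<in> {0<..}"
    then show "\<exists>c\<in>{0<..}. principal (U \<inter> cube x c) \<le> inf (principal (U \<inter> cube x a)) (principal (U \<inter> cube x b))"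
      using cube_mono[of "min a b" a x] cube_mono[of "min a b" b x]
      by (intro bexI[of _ "min a b"]) auto
  qed
  then show ?thesis by (auto simp: eventually_principal)
qed

definition step :: "'a::linordered_field list set \<Rightarrow> nat \<Rightarrow> 'a list \<Rightarrow> 'a filter" where
  "step U i x = (INF e\<in>{0<..}. principal {t. t \<noteq> 0 \<and> \<bar>t\<bar> < e \<and> x[i := x ! i + t] \<in> U})"

lemma eventually_step:
  "eventually P (step U i x) \<longleftrightarrow> (\<exists>e>0. \<forall>t. t \<noteq> 0 \<and> \<bar>t\<bar> < e \<and> x[i := x ! i + t] \<in> U \<longrightarrow> P t)"
proof -
  have "eventually P (step U i x) \<longleftrightarrow> 
    (\<exists>e\<in>{0<..}. eventually P (principal {t. t \<noteq> 0 \<and> \<bar>t\<bar> < e \<and> x[i := x ! i + t] \<in> U}))"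
    unfolding step_def
  proof (rule eventually_INF_base)
    show "{0::'a<..} \<noteq> {}" using zero_less_one by blast
    fix a b :: 'a assume "a \<in> {0<..}" "b \<in> {0<..}"
    then show "\<exists>c\<in>{0<..}. principal {t. t \<noteq> 0 \<and> \<bar>t\<bar> < c \<and> x[i := x ! i + t] \<in> U}
      \<le> inf (principal {t. t \<noteq> 0 \<and> \<bar>t\<bar> < a \<and> x[i := x ! i + t] \<in> U})
         (principal {t. t \<noteq> 0 \<and> \<bar>t\<bar> < b \<and> x[i := x ! i + t] \<in> U})"
      by (intro bexI[of _ "min a b"]) auto
  qed
  then show ?thesis by (auto simp: eventually_principal)
qed

lemma has_partial_iff:
  "has_partial U g i x c \<longleftrightarrow> tends (\<lambda>t. (g (x[i := x ! i + t]) - g x) / t) c (step U i x)"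
  by (simp add: has_partial_def tends_def eventually_step)

lemma contF_iff:
  assumes "U \<subseteq> Fn n" shows "contF U g \<longleftrightarrow> (\<forall>x\<in>U. tends g (g x) (near U x))"
proof -
  have "(\<exists>d>0. \<forall>y\<in>U. ldist x y < d \<longrightarrow> \<bar>g y - g x\<bar> < e) \<longleftrightarrow>
      (\<exists>d>0. \<forall>y\<in>U \<inter> cube x d. \<bar>g y - g x\<bar> < e)" if "x \<in> U" for x and e :: 'a
  proof (intro ex_cong1 conj_cong refl)
    fix d :: 'a assume "d > 0"
    then have "ldist x y < d \<longleftrightarrow> y \<in> cube x d" if "y \<in> U" for y
      using subsetD[OF assms \<open>x \<in> U\<close>] subsetD[OF assms that] by (intro ldist_less) auto
    then show "(\<forall>y\<in>U. ldist x y < d \<longrightarrow> \<bar>g y - g x\<bar> < e) \<longleftrightarrow> (\<forall>y\<in>U \<inter> cube x d. \<bar>g y - g x\<bar> < e)"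
      by blast
  qed
  then show ?thesis unfolding contF_def tends_def eventually_near by (intro ball_cong refl) simp
qed

lemma contF_subset: "contF U g \<Longrightarrow> V \<subseteq> U \<Longrightarrow> contF V g"
  unfolding contF_def by (meson subsetD)

lemma has_partial_subset: "has_partial U g i x c \<Longrightarrow> V \<subseteq> U \<Longrightarrow> has_partial V g i x c"
  unfolding has_partial_def by (meson subsetD)

lemma has_partial_cong:
  assumes "has_partial U g i x c" "\<And>y. y \<in> U \<Longrightarrow> g y = h y" "x \<in> U" shows "has_partial U h i x c"
proof -
  have "\<bar>(h (x[i := x ! i + t]) - h x) / t - c\<bar> = \<bar>(g (x[i := x ! i + t]) - g x) / t - c\<bar>"
    if "x[i := x ! i + t] \<in> U" for t using assms(2,3) that by simp
  then show ?thesis using assms(1) unfolding has_partial_def by metis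
qed

lemma contF_cong: "contF U g \<Longrightarrow> (\<And>y. y \<in> U \<Longrightarrow> g y = h y) \<Longrightarrow> contF U h"
  unfolding contF_def by simp

lemma update_in_cube: "e > 0 \<Longrightarrow> \<bar>t\<bar> < e \<Longrightarrow> x[i := x ! i + t] \<in> cube x e"
  unfolding cube_def
proof (intro CollectI conjI allI impI)
  fix j assume "0 < e" "\<bar>t\<bar> < e" "j < length x"
  then show "\<bar>x[i := x ! i + t] ! j - x ! j\<bar> < e" by (cases "j = i") auto
qed simp

lemma eventually_step_small: "e > 0 \<Longrightarrow> eventually (\<lambda>t. t \<noteq> 0 \<and> \<bar>t\<bar> < e \<and> x[i := x ! i + t] \<in> U) (step U i x)"
  unfolding eventually_step by blast

text \<open>Inside an open set \<open>step\<close> is a proper filter, so an eventual property has a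
  witness. This yields uniqueness of derivatives and, later, a point of the graph close to
  \<open>a\<close>.\<close>

lemma step_frequently:
  assumes "cube x e \<subseteq> U" "e > 0" "eventually P (step U i x)" shows "\<exists>t. P t"
proof -
  obtain d where d: "d > 0" "\<forall>t. t \<noteq> 0 \<and> \<bar>t\<bar> < d \<and> x[i := x ! i + t] \<in> U \<longrightarrow> P t"
    using assms(3) unfolding eventually_step by blast
  define t where "t = min (d / 2) (e / 2)"
  have t: "t \<noteq> 0" "\<bar>t\<bar> < d" "\<bar>t\<bar> < e" using d assms by (auto simp: t_def min_def)
  then have "x[i := x ! i + t] \<in> U" using update_in_cube[of e t x i] assms by auto
  then show ?thesis using d t by blast
qed

lemma has_partial_unique:
  assumes "openF n U" "x \<in> U" "has_partial U g i x c" "has_partial U g i x c'"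
  shows "c = c'"
proof (rule ccontr)
  assume "c \<noteq> c'"
  then have e: "\<bar>c - c'\<bar> / 2 > 0" by simp
  obtain r where r: "r > 0" "cube x r \<subseteq> U" using assms(1,2) unfolding openF_iff by blast
  let ?q = "\<lambda>t. (g (x[i := x ! i + t]) - g x) / t"
  have "eventually (\<lambda>t. \<bar>?q t - c\<bar> < \<bar>c - c'\<bar> / 2 \<and> \<bar>?q t - c'\<bar> < \<bar>c - c'\<bar> / 2) (step U i x)"
    using assms(3,4)[unfolded has_partial_iff] tendsD e by (intro eventually_conj) blast+
  from step_frequently[OF r(2,1) this] obtain t where
    "\<bar>?q t - c\<bar> < \<bar>c - c'\<bar> / 2" "\<bar>?q t - c'\<bar> < \<bar>c - c'\<bar> / 2" by blast
  from add_strict_mono[OF this] have "\<bar>?q t - c\<bar> + \<bar>?q t - c'\<bar> < \<bar>c - c'\<bar>" by simp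
  then show False by linarith
qed

lemma has_partial_local:
  assumes "has_partial (cube x e) g i x c" "e > 0" shows "has_partial U g i x c"
  unfolding has_partial_def
proof (intro allI impI)
  fix r :: 'a assume "r > 0"
  then obtain d where d: "d > 0" "\<forall>t. t \<noteq> 0 \<and> \<bar>t\<bar> < d \<and> x[i := x ! i + t] \<in> cube x e \<longrightarrow>
      \<bar>(g (x[i := x ! i + t]) - g x) / t - c\<bar> < r"
    using assms(1) unfolding has_partial_def by blast
  then show "\<exists>d>0. \<forall>t. t \<noteq> 0 \<and> \<bar>t\<bar> < d \<and> x[i := x ! i + t] \<in> U \<longrightarrow>
      \<bar>(g (x[i := x ! i + t]) - g x) / t - c\<bar> < r"
    using assms(2) update_in_cube[of e _ x i] by (intro exI[of _ "min d e"]) simp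
qed

context definable_str
begin

lemmas def_intros = def_pred_all def_pred_ex def_pred_imp def_pred_conj def_pred_disj def_pred_not
  def_pred_less def_pred_le def_pred_eq def_pred_all_less def_term_add def_term_diff def_term_mult
  def_term_divide def_term_abs def_term_uminus def_term_inverse def_term_var def_term_const
  def_vec_update def_vec_take_map def_pred_const

text \<open>The \<epsilon>-\<delta> condition quantifies over field elements only. Together with
  uniqueness this makes the derivative a definable function.\<close>

lemma def_pred_has_partial:
  assumes U: "D U" "U \<subseteq> Fn n" and g: "def_fun n g" and i: "i < n"
    and v: "def_vec n v" and t: "def_term t"
  shows "def_pred (\<lambda>\<rho>. has_partial U g i (v \<rho>) (t \<rho>))"
  unfolding has_partial_def
  by (intro def_intros def_pred_in[OF U] def_term_fun[OF g] def_term_nth[OF def_vec_subst[OF v] i]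
      def_vec_subst[OF v] def_term_subst[OF t])

end

section \<open>Calculus in definably complete fields\<close>

locale def_complete = definable_str +
  assumes complete: "definably_complete D"
begin

section \<open>Real induction and the mean value inequality\<close>

lemma inf_exists:
  assumes "def_pred (\<lambda>\<rho>. Q (\<rho> 0))" "Q x0" "\<And>x. Q x \<Longrightarrow> b \<le> x"
  shows "\<exists>s. (\<forall>x. Q x \<longrightarrow> s \<le> x) \<and> (\<forall>t. (\<forall>x. Q x \<longrightarrow> t \<le> x) \<longrightarrow> t \<le> s)"
proof -
  define X where "X = {y \<in> Fn 1. Q (y ! 0)}"
  have X: "D X" unfolding X_def by (rule D_Collect) (use assms(1) in simp)
  have Q: "[x] \<in> X \<longleftrightarrow> Q x" for x by (simp add: X_def)
  have "X \<subseteq> Fn 1" by (auto simp: X_def)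
  note * = complete[unfolded definably_complete_def, THEN spec, THEN mp, THEN mp, OF X this,
      THEN conjunct2, unfolded Q, THEN mp, THEN mp]
  show ?thesis by (rule *) (use assms(2,3) in blast)+
qed

lemma sup_exists:
  assumes "def_pred (\<lambda>\<rho>. Q (\<rho> 0))" "Q x0" "\<And>x. Q x \<Longrightarrow> x \<le> b"
  shows "\<exists>s. (\<forall>x. Q x \<longrightarrow> x \<le> s) \<and> (\<forall>t. (\<forall>x. Q x \<longrightarrow> x \<le> t) \<longrightarrow> s \<le> t)"
proof -
  define X where "X = {y \<in> Fn 1. Q (y ! 0)}"
  have X: "D X" unfolding X_def by (rule D_Collect) (use assms(1) in simp)
  have Q: "[x] \<in> X \<longleftrightarrow> Q x" for x by (simp add: X_def)
  have "X \<subseteq> Fn 1" by (auto simp: X_def)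
  note * = complete[unfolded definably_complete_def, THEN spec, THEN mp, THEN mp, OF X this,
      THEN conjunct1, unfolded Q, THEN mp, THEN mp]
  show ?thesis by (rule *) (use assms(2,3) in blast)+
qed

text \<open>This takes the place of compactness and connectedness of an interval. Let
  \<open>s\<close> be the infimum of the counterexamples: \<open>base\<close> or \<open>left\<close>
  gives \<open>P s\<close>, and \<open>right\<close> extends \<open>P\<close> past \<open>s\<close>,
  against the choice of \<open>s\<close>.\<close>

lemma real_induction:
  assumes P: "def_pred (\<lambda>\<rho>. P (\<rho> 0))" and base: "P a"
    and right: "\<And>t. a \<le> t \<Longrightarrow> t < b \<Longrightarrow> (\<And>s. a \<le> s \<Longrightarrow> s \<le> t \<Longrightarrow> P s) \<Longrightarrow>
      \<exists>u>t. \<forall>s. t < s \<and> s < u \<and> s \<le> b \<longrightarrow> P s"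
    and left: "\<And>t. a < t \<Longrightarrow> t \<le> b \<Longrightarrow> (\<And>s. a \<le> s \<Longrightarrow> s < t \<Longrightarrow> P s) \<Longrightarrow> P t"
    and t: "a \<le> t" "t \<le> b"
  shows "P t"
proof (rule ccontr)
  assume nP: "\<not> P t"
  let ?N = "\<lambda>x. a \<le> x \<and> x \<le> b \<and> \<not> P x"
  have "def_pred (\<lambda>\<rho>. ?N (\<rho> 0))" by (intro def_intros P)
  from inf_exists[OF this, of t a] t nP
  obtain s where s: "\<And>x. ?N x \<Longrightarrow> s \<le> x" "\<And>u. (\<forall>x. ?N x \<longrightarrow> u \<le> x) \<Longrightarrow> u \<le> s" by blast
  have as: "a \<le> s" by (rule s(2)) blast
  have st: "s \<le> t" using t nP by (intro s(1)) blast
  have below: "P x" if "a \<le> x" "x < s" for x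
    using s(1)[of x] that st t by force
  have Ps: "P s"
  proof (cases "s = a")
    case False
    show ?thesis
    proof (rule left)
      show "a < s" using as False by simp
      show "s \<le> b" using st t by simp
    qed (rule below)
  qed (use base in simp)
  have "s \<noteq> t" using Ps nP by blast
  then have "s < b" using st t by simp
  have "P x" if "a \<le> x" "x \<le> s" for x
    using below[of x] that Ps by (cases "x = s") simp_all
  from right[OF as \<open>s < b\<close> this] obtain u where u: "u > s" "\<forall>x. s < x \<and> x < u \<and> x \<le> b \<longrightarrow> P x"
    by blast
  have "u \<le> x" if "?N x" for x
  proof (rule ccontr)
    assume "\<not> u \<le> x"
    moreover have "s \<noteq> x" using that Ps by blast
    ultimately have "P x" using s(1)[OF that] u(2)[rule_format, of x] that by simp
    then show False using that by simp
  qed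
  then have "u \<le> s" by (intro s(2)) blast
  then show False using u(1) by simp
qed

text \<open>The radius may depend on \<open>x\<close> without any uniformity; real induction for
  "\<open>t = a\<close> or \<open>f a < f t\<close>" glues the local comparisons.\<close>

lemma strictly_increasing_if_locally:
  assumes f: "def_term (\<lambda>\<rho>. f (\<rho> 0))" and ab: "a < b"
    and loc: "\<And>x. a \<le> x \<Longrightarrow> x \<le> b \<Longrightarrow>
      \<exists>d>0. \<forall>y. a \<le> y \<and> y \<le> b \<and> \<bar>y - x\<bar> < d \<longrightarrow> (x < y \<longrightarrow> f x < f y) \<and> (y < x \<longrightarrow> f y < f x)"
  shows "f a < f b"
proof -
  have "b = a \<or> f a < f b"
  proof (rule real_induction[where P = "\<lambda>t. t = a \<or> f a < f t" and a = a and b = b])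
    show "def_pred (\<lambda>\<rho>. \<rho> 0 = a \<or> f a < f (\<rho> 0))" by (intro def_intros f)
  next
    fix t assume t: "a \<le> t" "t < b" and P: "\<And>s. a \<le> s \<Longrightarrow> s \<le> t \<Longrightarrow> s = a \<or> f a < f s"
    obtain d where d: "d > 0" "\<forall>y. a \<le> y \<and> y \<le> b \<and> \<bar>y - t\<bar> < d \<longrightarrow> (t < y \<longrightarrow> f t < f y)"
      using loc[of t] t by (meson less_imp_le)
    have "f a < f s" if "t < s" "s < t + d" "s \<le> b" for s
    proof -
      have "f t < f s" using d(2) that t by auto
      then show ?thesis using P[of t] t by auto
    qed
    then show "\<exists>u>t. \<forall>s. t < s \<and> s < u \<and> s \<le> b \<longrightarrow> s = a \<or> f a < f s"
      using d(1) by (intro exI[of _ "t + d"]) auto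
  next
    fix t assume t: "a < t" "t \<le> b" and P: "\<And>s. a \<le> s \<Longrightarrow> s < t \<Longrightarrow> s = a \<or> f a < f s"
    obtain d where d: "d > 0" "\<forall>y. a \<le> y \<and> y \<le> b \<and> \<bar>y - t\<bar> < d \<longrightarrow> (y < t \<longrightarrow> f y < f t)"
      using loc[of t] t by (meson less_imp_le)
    obtain y where y: "max a (t - d) < y" "y < t" using dense[of "max a (t - d)" t] t d by auto
    then have "f a < f y" "f y < f t" using P[of y] d(2) t by (auto simp: abs_if)
    then show "t = a \<or> f a < f t" by auto
  qed (use ab in auto)
  then show ?thesis using ab by auto
qed

text \<open>Differentiability with derivative \<open>m\<close> relative to the closed interval,
  hence one-sided at its ends. It is written without a quotient, so that \<open>y = x\<close> is no
  exception.\<close>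

definition slope_at :: "('a \<Rightarrow> 'a) \<Rightarrow> 'a \<Rightarrow> 'a \<Rightarrow> 'a \<Rightarrow> 'a \<Rightarrow> bool" where
  "slope_at f a b x m \<longleftrightarrow> (\<forall>r>0. \<exists>d>0. \<forall>y. a \<le> y \<and> y \<le> b \<and> \<bar>y - x\<bar> < d \<longrightarrow>
    \<bar>f y - f x - m * (y - x)\<bar> \<le> r * \<bar>y - x\<bar>)"

text \<open>Subtracting \<open>c * t\<close> leaves a function of positive slope, which is strictly
  increasing; neither extreme values nor an intermediate point enter.\<close>

lemma mean_value_lower:
  assumes f: "def_term (\<lambda>\<rho>. f (\<rho> 0))" and ab: "a < b"
    and loc: "\<And>x. a \<le> x \<Longrightarrow> x \<le> b \<Longrightarrow> \<exists>m>c. slope_at f a b x m"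
  shows "c * (b - a) < f b - f a"
proof -
  have "f a - c * a < f b - c * b"
  proof (rule strictly_increasing_if_locally[where f = "\<lambda>t. f t - c * t", OF _ ab])
    show "def_term (\<lambda>\<rho>. f (\<rho> 0) - c * \<rho> 0)" by (intro def_intros f)
    fix x assume "a \<le> x" "x \<le> b"
    then obtain m where m: "m > c" "slope_at f a b x m" using loc by blast
    \<comment> \<open>With half of the surplus slope as tolerance, the linear term outweighs the
      error.\<close>
    define r where "r = (m - c) / 2"
    have r: "r > 0" "m - c = 2 * r" using m(1) by (auto simp: r_def)
    from m(2) r(1) obtain d where d: "d > 0" "\<forall>y. a \<le> y \<and> y \<le> b \<and> \<bar>y - x\<bar> < d \<longrightarrow>
      \<bar>f y - f x - m * (y - x)\<bar> \<le> r * \<bar>y - x\<bar>" unfolding slope_at_def by blast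
    have "(x < y \<longrightarrow> f x - c * x < f y - c * y) \<and> (y < x \<longrightarrow> f y - c * y < f x - c * x)"
      if "a \<le> y \<and> y \<le> b \<and> \<bar>y - x\<bar> < d" for y
    proof -
      have 1: "\<bar>f y - f x - m * (y - x)\<bar> \<le> r * \<bar>y - x\<bar>" using d(2) that by blast
      have 2: "(f y - c * y) - (f x - c * x) = (f y - f x - m * (y - x)) + (m - c) * (y - x)"
        by (simp add: algebra_simps)
      have 3: "(m - c) * (y - x) = 2 * (r * (y - x))" using r by simp
      have 4: "x < y \<Longrightarrow> r * (y - x) > 0" "y < x \<Longrightarrow> r * (y - x) < 0"
        using r by (simp_all add: mult_pos_neg)
      have 5: "x < y \<Longrightarrow> r * \<bar>y - x\<bar> = r * (y - x)" "y < x \<Longrightarrow> r * \<bar>y - x\<bar> = - (r * (y - x))"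
        by (simp_all add: algebra_simps)
      show ?thesis
      proof (intro conjI impI)
        assume "x < y"
        then show "f x - c * x < f y - c * y" using 1 2 3 4(1) 5(1) by linarith
      next
        assume "y < x"
        then show "f y - c * y < f x - c * x" using 1 2 3 4(2) 5(2) by linarith
      qed
    qed
    then show "\<exists>d>0. \<forall>y. a \<le> y \<and> y \<le> b \<and> \<bar>y - x\<bar> < d \<longrightarrow> (x < y \<longrightarrow> f x - c * x < f y - c * y) \<and>
       (y < x \<longrightarrow> f y - c * y < f x - c * x)" using d(1) by blast
  qed
  then show ?thesis by (simp add: algebra_simps)
qed

text \<open>The lower bound is applied to \<open>f\<close> with slope \<open>c - e\<close> and to
  \<open>- f\<close> with slope \<open>- (c + e)\<close>. Comparison with a fixed slope
  \<open>c\<close> is the form from which both Lipschitz constants and limits of quotients are read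
  off.\<close>

lemma mean_value_bound:
  assumes f: "def_term (\<lambda>\<rho>. f (\<rho> 0))" and ab: "a < b"
    and loc: "\<And>x. a \<le> x \<Longrightarrow> x \<le> b \<Longrightarrow> \<exists>m. \<bar>m - c\<bar> < e \<and> slope_at f a b x m"
  shows "\<bar>f b - f a - c * (b - a)\<bar> \<le> e * (b - a)"
proof -
  have "(c - e) * (b - a) < f b - f a"
  proof (rule mean_value_lower[OF f ab])
    fix x assume "a \<le> x" "x \<le> b"
    from loc[OF this] obtain m where m: "\<bar>m - c\<bar> < e" "slope_at f a b x m" by blast
    have "m > c - e" using m(1) by linarith
    with m(2) show "\<exists>m>c - e. slope_at f a b x m" by blast
  qed
  moreover have "(- (c + e)) * (b - a) < (- f b) - (- f a)"
  proof (rule mean_value_lower[where f = "\<lambda>t. - f t", OF _ ab])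
    show "def_term (\<lambda>\<rho>. - f (\<rho> 0))" by (intro def_intros f)
    fix x assume "a \<le> x" "x \<le> b"
    from loc[OF this] obtain m where m: "\<bar>m - c\<bar> < e" "slope_at f a b x m" by blast
    have "- m > - (c + e)" using m(1) by linarith
    moreover have "\<bar>- f y - - f x - (- m) * (y - x)\<bar> = \<bar>f y - f x - m * (y - x)\<bar>" for y
      by (subst abs_minus_cancel[symmetric]) (simp add: algebra_simps)
    ultimately show "\<exists>m>- (c + e). slope_at (\<lambda>t. - f t) a b x m"
      using m(2) by (intro exI[of _ "- m"]) (simp add: slope_at_def)
  qed
  ultimately show ?thesis by (simp add: abs_le_iff algebra_simps)
qed

lemma partial_linear:
  assumes p: "has_partial U g i x m" and i: "i < length x" and r: "r > 0"
  shows "\<exists>d>0. \<forall>u. \<bar>u - x ! i\<bar> < d \<and> x[i := u] \<in> U \<longrightarrow>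
    \<bar>g (x[i := u]) - g x - m * (u - x ! i)\<bar> \<le> r * \<bar>u - x ! i\<bar>"
proof -
  obtain d where d: "d > 0" "\<And>t. t \<noteq> 0 \<Longrightarrow> \<bar>t\<bar> < d \<Longrightarrow> x[i := x ! i + t] \<in> U \<Longrightarrow>
      \<bar>(g (x[i := x ! i + t]) - g x) / t - m\<bar> < r"
    using p r unfolding has_partial_def by blast
  have "\<bar>g (x[i := u]) - g x - m * (u - x ! i)\<bar> \<le> r * \<bar>u - x ! i\<bar>"
    if u: "\<bar>u - x ! i\<bar> < d" "x[i := u] \<in> U" for u
  proof (cases "u = x ! i")
    case False
    let ?t = "u - x ! i"
    have t: "?t \<noteq> 0" using False by simp
    have "\<bar>(g (x[i := u]) - g x) / ?t - m\<bar> < r" using d(2)[OF t] u by simp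
    then have "\<bar>(g (x[i := u]) - g x) / ?t - m\<bar> * \<bar>?t\<bar> \<le> r * \<bar>?t\<bar>" by (intro mult_right_mono) auto
    moreover have "\<bar>(g (x[i := u]) - g x) / ?t - m\<bar> * \<bar>?t\<bar> = \<bar>g (x[i := u]) - g x - m * ?t\<bar>"
      unfolding abs_mult[symmetric] by (subst left_diff_distrib) (use t in simp)
    ultimately show ?thesis by simp
  qed simp
  then show ?thesis using d(1) by blast
qed

lemma slope_bound_less:
  assumes g: "def_fun n g" and i: "i < n" and y0: "length y0 = n"
    and dg: "\<And>x. x \<in> cube y0 d \<Longrightarrow> has_partial U g i x (dg x) \<and> \<bar>dg x - c\<bar> < e"
    and sub: "cube y0 d \<subseteq> U"
    and y: "y \<in> cube y0 d" "y[i := u] \<in> cube y0 d" and u: "y ! i < u"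
  shows "\<bar>g (y[i := u]) - g y - c * (u - y ! i)\<bar> \<le> e * (u - y ! i)"
proof -
  have l: "length y = n" using y y0 by (simp add: cube_def)
  have "\<bar>g (y[i := u]) - g (y[i := y ! i]) - c * (u - y ! i)\<bar> \<le> e * (u - y ! i)"
  proof (rule mean_value_bound[where f = "\<lambda>t. g (y[i := t])", OF _ u])
    show "def_term (\<lambda>\<rho>. g (y[i := \<rho> 0]))"
      by (intro def_term_fun[OF g] def_intros def_vec_const l)
    fix x assume x: "y ! i \<le> x" "x \<le> u"
    have in_cube: "y[i := z] \<in> cube y0 d" if "y ! i \<le> z" "z \<le> u" for z
    proof (rule cube_update[OF y(1)])
      show "i < length y0" using i y0 by simp
      have "\<bar>y ! i - y0 ! i\<bar> < d" "\<bar>u - y0 ! i\<bar> < d"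
        using y i y0 l by (auto simp: cube_def dest!: spec[of _ i])
      then show "\<bar>z - y0 ! i\<bar> < d" using that by linarith
    qed
    let ?x = "y[i := x]"
    have px: "has_partial U g i ?x (dg ?x)" "\<bar>dg ?x - c\<bar> < e" using dg in_cube x by auto
    have "\<exists>s>0. \<forall>z. y ! i \<le> z \<and> z \<le> u \<and> \<bar>z - x\<bar> < s \<longrightarrow>
        \<bar>g (y[i := z]) - g ?x - dg ?x * (z - x)\<bar> \<le> r * \<bar>z - x\<bar>" if r: "r > 0" for r
    proof -
      have i': "i < length ?x" using l i by simp
      from partial_linear[OF px(1) i' r] obtain s where "s > 0"
        "\<forall>z. \<bar>z - x\<bar> < s \<and> y[i := z] \<in> U \<longrightarrow> \<bar>g (y[i := z]) - g ?x - dg ?x * (z - x)\<bar> \<le> r * \<bar>z - x\<bar>"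
        using l i by auto
      then show ?thesis using in_cube sub by blast
    qed
    with px(2) show "\<exists>m. \<bar>m - c\<bar> < e \<and> slope_at (\<lambda>t. g (y[i := t])) (y ! i) u x m"
      unfolding slope_at_def by blast
  qed
  then show ?thesis by simp
qed

text \<open>A segment between two points of a cube that differ in one coordinate stays in the cube,
  so the one-variable bound applies along it; for \<open>u < y ! i\<close> the end points are
  swapped.\<close>

lemma slope_bound:
  assumes g: "def_fun n g" and i: "i < n" and y0: "length y0 = n"
    and dg: "\<And>x. x \<in> cube y0 d \<Longrightarrow> has_partial U g i x (dg x) \<and> \<bar>dg x - c\<bar> < e"
    and sub: "cube y0 d \<subseteq> U"
    and y: "y \<in> cube y0 d" "y[i := u] \<in> cube y0 d"
  shows "\<bar>g (y[i := u]) - g y - c * (u - y ! i)\<bar> \<le> e * \<bar>u - y ! i\<bar>"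
proof -
  consider "y ! i < u" | "u = y ! i" | "u < y ! i" by fastforce
  then show ?thesis
  proof cases
    case 1
    then show ?thesis using slope_bound_less[OF g i y0 dg sub y] by simp
  next
    case 3
    have l: "length y = n" using y y0 by (simp add: cube_def)
    have "\<bar>g (y[i := u, i := y ! i]) - g (y[i := u]) - c * (y ! i - y[i := u] ! i)\<bar> \<le> e * (y ! i - y[i := u] ! i)"
      using 3 y l i by (intro slope_bound_less[OF g i y0 dg sub]) auto
    then have "\<bar>g y - g (y[i := u]) - c * (y ! i - u)\<bar> \<le> e * (y ! i - u)"
      using l i by simp
    moreover have "\<bar>g (y[i := u]) - g y - c * (u - y ! i)\<bar> = \<bar>g y - g (y[i := u]) - c * (y ! i - u)\<bar>"
      by (subst abs_minus_cancel[symmetric]) (simp add: algebra_simps)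
    ultimately show ?thesis using 3 by simp
  qed simp
qed

end

section \<open>Functions of class \<open>C^r\<close>\<close>

text \<open>No induction is involved: the partial derivatives of \<open>g\<close> serve unchanged
  for \<open>h\<close>.\<close>

lemma Cr_cong: "Cr n r U g \<Longrightarrow> (\<And>x. x \<in> U \<Longrightarrow> g x = h x) \<Longrightarrow> Cr n r U h"
proof (cases r)
  case 0
  assume "Cr n r U g" "\<And>x. x \<in> U \<Longrightarrow> g x = h x"
  then show ?thesis using 0 contF_cong[of U g h] by simp
next
  case (Suc m)
  assume C: "Cr n r U g" and eq: "\<And>x. x \<in> U \<Longrightarrow> g x = h x"
  then obtain ds where ds: "\<And>i x. i < n \<Longrightarrow> x \<in> U \<Longrightarrow> has_partial U g i x (ds i x)" "\<And>i. i < n \<Longrightarrow> Cr n m U (ds i)"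
    and "contF U g" using Suc by auto
  then have "contF U h" using eq contF_cong[of U g h] by simp
  moreover have "has_partial U h i x (ds i x)" if "i < n" "x \<in> U" for i x
    using has_partial_cong[OF ds(1)[OF that] eq that(2)] .
  ultimately show ?thesis unfolding Suc Cr.simps using ds(2) by blast
qed

lemma contF_local:
  assumes "\<And>x. x \<in> U \<Longrightarrow> \<exists>e>0. cube x e \<subseteq> U \<and> contF (cube x e) g" and U: "U \<subseteq> Fn n"
  shows "contF U g"
  unfolding contF_iff[OF U] tends_def eventually_near
proof (intro ballI allI impI)
  fix x and r :: 'a assume x: "x \<in> U" and r: "0 < r"
  obtain e where e: "e > 0" "cube x e \<subseteq> U" "contF (cube x e) g" using assms(1)[OF x] by blast
  have "cube x e \<subseteq> Fn n" using e(2) U by blast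
  from e(3)[unfolded contF_iff[OF this] tends_def eventually_near, THEN bspec, OF cube_center[OF e(1)]] r
  obtain d where d: "d > 0" "\<forall>y\<in>cube x e \<inter> cube x d. \<bar>g y - g x\<bar> < r" by blast
  have "U \<inter> cube x (min d e) \<subseteq> cube x e \<inter> cube x d"
    using cube_mono[of "min d e" d x] cube_mono[of "min d e" e x] by auto
  then show "\<exists>d>0. \<forall>y\<in>U \<inter> cube x d. \<bar>g y - g x\<bar> < r"
    using d e(1) by (intro exI[of _ "min d e"]) auto
qed

text \<open>\<open>Cr\<close> asks for derivative functions on all of \<open>U\<close>, while the
  hypothesis supplies some on each cube. Uniqueness of derivatives makes them agree on overlaps. The
  sections constructed at the end are shown smooth near one point at a time.\<close>

lemma Cr_local:
  assumes "\<And>x. x \<in> U \<Longrightarrow> \<exists>e>0. cube x e \<subseteq> U \<and> Cr n r (cube x e) g" and U: "U \<subseteq> Fn n"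
  shows "Cr n r U g"
  using assms(1)
proof (induction r arbitrary: g)
  case 0
  then show ?case unfolding Cr.simps by (rule contF_local[OF _ U])
next
  case (Suc r)
  have "\<exists>e ds. e > 0 \<and> cube x e \<subseteq> U \<and> (\<forall>i<n. \<forall>z\<in>cube x e. has_partial (cube x e) g i z (ds i z)) \<and> (\<forall>i<n. Cr n r (cube x e) (ds i))"
    if "x \<in> U" for x using Suc.prems[OF that] unfolding Cr.simps by blast
  then obtain e ds where e: "\<And>x. x \<in> U \<Longrightarrow> e x > 0" "\<And>x. x \<in> U \<Longrightarrow> cube x (e x) \<subseteq> U"
    and ds: "\<And>x i z. x \<in> U \<Longrightarrow> i < n \<Longrightarrow> z \<in> cube x (e x) \<Longrightarrow> has_partial (cube x (e x)) g i z (ds x i z)"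
      "\<And>x i. x \<in> U \<Longrightarrow> i < n \<Longrightarrow> Cr n r (cube x (e x)) (ds x i)" by metis
  have oU: "openF n U" unfolding openF_iff using U e by blast
  have p: "has_partial U g i z (ds x i z)" if x: "x \<in> U" and i: "i < n" and z: "z \<in> cube x (e x)" for x i z
  proof -
    obtain d where d: "d > 0" "cube z d \<subseteq> cube x (e x)"
      using openF_cube[of x "e x"] z unfolding openF_iff by blast
    show ?thesis
      by (rule has_partial_local[OF has_partial_subset[OF ds(1)[OF x i z] d(2)] d(1)])
  qed
  \<comment> \<open>Diagonal choice: at \<open>z\<close> the derivative is taken from the cube
    around \<open>z\<close> itself.\<close>
  define dg where "dg = (\<lambda>i z. ds z i z)"
  have dg: "has_partial U g i z (dg i z)" if "i < n" "z \<in> U" for i z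
    unfolding dg_def using p[OF that(2,1)] cube_center[OF e(1)[OF that(2)]] by blast
  have "Cr n r U (dg i)" if i: "i < n" for i
  proof (rule Suc.IH)
    fix x assume x: "x \<in> U"
    have "ds x i z = dg i z" if "z \<in> cube x (e x)" for z
      using has_partial_unique[OF oU _ p[OF x i that] dg[OF i]] that e(2)[OF x] by blast
    then have "Cr n r (cube x (e x)) (dg i)" using Cr_cong[OF ds(2)[OF x i]] by blast
    then show "\<exists>e>0. cube x e \<subseteq> U \<and> Cr n r (cube x e) (dg i)" using e x by blast
  qed
  moreover have "contF U g"
    by (rule contF_local[OF _ U]) (use Suc.prems in \<open>unfold Cr.simps, blast\<close>)
  ultimately show ?case unfolding Cr.simps using dg by blast
qed

context def_complete
begin

text \<open>\<open>Cr\<close> with all functions totally definable, so that the mean value bound applies to them.\<close>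

primrec DC :: "nat \<Rightarrow> nat \<Rightarrow> 'a list set \<Rightarrow> ('a list \<Rightarrow> 'a) \<Rightarrow> bool" where
  "DC n 0 U g = (def_fun n g \<and> contF U g)"
| "DC n (Suc r) U g = (def_fun n g \<and> contF U g \<and>
     (\<exists>ds. (\<forall>i<n. \<forall>x\<in>U. has_partial U g i x (ds i x)) \<and> (\<forall>i<n. DC n r U (ds i))))"

lemma DC_contF: "DC n r U g \<Longrightarrow> contF U g"
  by (cases r) simp_all

lemma DC_SucI:
  assumes "def_fun n g" "contF U g" "\<And>i x. i < n \<Longrightarrow> x \<in> U \<Longrightarrow> has_partial U g i x (ds i x)"
    "\<And>i. i < n \<Longrightarrow> DC n r U (ds i)"
  shows "DC n (Suc r) U g"
  unfolding DC.simps using assms by blast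

lemma DC_SucE:
  assumes "DC n (Suc r) U g"
  obtains ds where "def_fun n g" "contF U g" "\<And>i x. i < n \<Longrightarrow> x \<in> U \<Longrightarrow> has_partial U g i x (ds i x)"
    "\<And>i. i < n \<Longrightarrow> DC n r U (ds i)"
  using assms unfolding DC.simps by blast

lemma DC_imp_Cr: "DC n r U g \<Longrightarrow> Cr n r U g"
proof (induction r arbitrary: g)
  case (Suc r)
  from Suc.prems show ?case unfolding Cr.simps by (rule DC_SucE) (use Suc.IH in blast)
qed simp

lemma DC_Suc_imp: "DC n (Suc r) U g \<Longrightarrow> DC n r U g"
proof (induction r arbitrary: g)
  case (Suc r)
  from Suc.prems obtain ds where ds: "def_fun n g" "contF U g"
    "\<And>i x. i < n \<Longrightarrow> x \<in> U \<Longrightarrow> has_partial U g i x (ds i x)" "\<And>i. i < n \<Longrightarrow> DC n (Suc r) U (ds i)"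
    by (rule DC_SucE) blast
  show ?case by (rule DC_SucI[OF ds(1-3)]) (use Suc.IH ds(4) in auto)
qed auto

lemma DC_mono: "s \<le> r \<Longrightarrow> DC n r U g \<Longrightarrow> DC n s U g"
  by (induction rule: inc_induct) (auto intro: DC_Suc_imp simp del: DC.simps)

lemma DC_subset: "DC n r U g \<Longrightarrow> V \<subseteq> U \<Longrightarrow> DC n r V g"
proof (induction r arbitrary: g)
  case 0
  then show ?case using contF_subset[of U g V] by simp
next
  case (Suc r)
  from Suc.prems(1) obtain ds where ds: "def_fun n g" "contF U g"
    "\<And>i x. i < n \<Longrightarrow> x \<in> U \<Longrightarrow> has_partial U g i x (ds i x)" "\<And>i. i < n \<Longrightarrow> DC n r U (ds i)"
    by (rule DC_SucE) blast
  show ?case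
  proof (rule DC_SucI[OF ds(1) contF_subset[OF ds(2) Suc.prems(2)]])
    show "has_partial V g i x (ds i x)" if "i < n" "x \<in> V" for i x
      using has_partial_subset[OF ds(3)] that Suc.prems(2) by blast
  qed (use Suc.IH ds(4) Suc.prems(2) in auto)
qed

text \<open>The derivative functions named in \<open>Cr\<close> are arbitrary off \<open>U\<close>.
  Once set to 0 there they are determined by \<open>g\<close>, hence definable by
  \<open>def_pred_has_partial\<close>.\<close>

lemma Cr_imp_DC:
  assumes U: "D U" "openF n U"
  shows "def_fun n g \<Longrightarrow> Cr n r U g \<Longrightarrow> DC n r U g"
proof (induction r arbitrary: g)
  case (Suc r)
  then obtain ds where ds: "\<And>i x. i < n \<Longrightarrow> x \<in> U \<Longrightarrow> has_partial U g i x (ds i x)"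
    "\<And>i. i < n \<Longrightarrow> Cr n r U (ds i)" and c: "contF U g" unfolding Cr.simps by blast
  have UF: "U \<subseteq> Fn n" using U(2) by (simp add: openF_def)
  define ds' where "ds' = (\<lambda>i x. if x \<in> U then ds i x else 0)"
  show ?case
  proof (rule DC_SucI[OF Suc.prems(1) c])
    fix i assume i: "i < n"
    show "has_partial U g i x (ds' i x)" if "x \<in> U" for x
      using ds(1)[OF i that] that by (simp add: ds'_def)
    have "def_fun n (ds' i)"
    proof (rule def_funI, rule def_termI[where Q = "\<lambda>\<rho> a. (map \<rho> [0..<n] \<in> U \<and> has_partial U g i (map \<rho> [0..<n]) a) \<or>
        (map \<rho> [0..<n] \<notin> U \<and> a = 0)"])
      show "def_pred (\<lambda>\<rho>. (map (\<lambda>i. \<rho> (Suc i)) [0..<n] \<in> U \<and> has_partial U g i (map (\<lambda>i. \<rho> (Suc i)) [0..<n]) (\<rho> 0)) \<or>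
        (map (\<lambda>i. \<rho> (Suc i)) [0..<n] \<notin> U \<and> \<rho> 0 = 0))"
        by (intro def_intros def_pred_in[OF U(1) UF] def_pred_has_partial[OF U(1) UF Suc.prems(1) i])
      show "(map \<rho> [0..<n] \<in> U \<and> has_partial U g i (map \<rho> [0..<n]) a) \<or> (map \<rho> [0..<n] \<notin> U \<and> a = 0)
        \<longleftrightarrow> a = ds' i (map \<rho> [0..<n])" for \<rho> a
        using has_partial_unique[OF U(2) _ ds(1)[OF i]] ds(1)[OF i] by (cases "map \<rho> [0..<n] \<in> U") (auto simp: ds'_def)
    qed
    moreover have "Cr n r U (ds' i)"
      by (rule Cr_cong[OF ds(2)[OF i]]) (simp add: ds'_def)
    ultimately show "DC n r U (ds' i)" by (rule Suc.IH)
  qed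
qed simp

section \<open>Sums, products and reciprocals\<close>

lemma def_fun_term: "def_fun n g \<Longrightarrow> def_term (\<lambda>\<rho>. g (map (\<lambda>i. \<rho> (\<sigma> i)) [0..<n]))"
  by (rule def_term_fun[OF _ def_vec_take_map])

lemma contF_tends_step:
  fixes U :: "'a list set"
  assumes U: "U \<subseteq> Fn n" and c: "contF U g" and x: "x \<in> U"
  shows "tends (\<lambda>t. g (x[i := x ! i + t])) (g x) (step U i x)"
  unfolding tends_def eventually_step
proof (intro allI impI)
  fix r :: 'a assume "0 < r"
  then obtain e where e: "e > 0" "\<forall>y\<in>U \<inter> cube x e. \<bar>g y - g x\<bar> < r"
    using c x unfolding contF_iff[OF U] tends_def eventually_near by blast
  then show "\<exists>e>0. \<forall>t. t \<noteq> 0 \<and> \<bar>t\<bar> < e \<and> x[i := x ! i + t] \<in> U \<longrightarrow> \<bar>g (x[i := x ! i + t]) - g x\<bar> < r"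
    using update_in_cube[of e _ x i] by blast
qed

lemma contF_const: "contF U (\<lambda>x. c)"
  unfolding contF_def using zero_less_one by auto

lemma has_partial_const: "has_partial U (\<lambda>x. c) i x 0"
  unfolding has_partial_def using zero_less_one by auto

lemma def_fun_const: "def_fun n (\<lambda>x. c)"
  by (intro def_funI def_intros)

lemma def_fun_add:
  assumes "def_fun n f" "def_fun n g" shows "def_fun n (\<lambda>x. f x + g x)"
  by (intro def_funI def_intros assms[THEN def_fun_term])

lemma def_fun_mult:
  assumes "def_fun n f" "def_fun n g" shows "def_fun n (\<lambda>x. f x * g x)"
  by (intro def_funI def_intros assms[THEN def_fun_term])

lemma def_fun_inverse:
  assumes "def_fun n f" shows "def_fun n (\<lambda>x. inverse (f x))"
  by (intro def_funI def_intros def_fun_term[OF assms])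

lemma DC_const: "DC n r U (\<lambda>x. c)"
proof (induction r arbitrary: c)
  case 0
  show ?case by (simp add: def_fun_const contF_const)
next
  case (Suc r)
  show ?case
    by (rule DC_SucI[where ds = "\<lambda>i x. 0"]) (rule def_fun_const contF_const has_partial_const Suc.IH)+
qed

lemma DC_nth:
  assumes U: "U \<subseteq> Fn n" and j: "j < n" shows "DC n r U (\<lambda>x. x ! j)"
proof -
  have d: "def_fun n (\<lambda>x. x ! j)"
    by (intro def_funI def_term_nth[OF def_vec_take_map j])
  have c: "contF U (\<lambda>x. x ! j)" unfolding contF_iff[OF U] tends_def eventually_near
  proof (intro ballI allI impI)
    fix x and e :: 'a assume "x \<in> U" "0 < e"
    then show "\<exists>d>0. \<forall>y\<in>U \<inter> cube x d. \<bar>y ! j - x ! j\<bar> < e"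
      using U j by (intro exI[of _ e]) (auto simp: cube_def)
  qed
  show ?thesis
  proof (cases r)
    case 0
    then show ?thesis using d c by simp
  next
    case (Suc m)
    show ?thesis unfolding Suc
    proof (rule DC_SucI[OF d c])
      fix i x assume "i < n" and x: "x \<in> U"
      have l: "length x = n" using U x by auto
      have "(x[i := x ! i + t] ! j - x ! j) / t = (if i = j then 1 else 0)" if "t \<noteq> 0" for t
        using that l j by auto
      then show "has_partial U (\<lambda>x. x ! j) i x ((\<lambda>i x. if i = j then 1 else 0) i x)"
        unfolding has_partial_def using zero_less_one by auto
    next
      show "DC n m U ((\<lambda>i x. if i = j then 1 else 0) i)" for i by (rule DC_const)
    qed
  qed
qed

lemma contF_add: "U \<subseteq> Fn n \<Longrightarrow> contF U f \<Longrightarrow> contF U g \<Longrightarrow> contF U (\<lambda>x. f x + g x)"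
  by (simp add: contF_iff tends_add)

lemma contF_mult: "U \<subseteq> Fn n \<Longrightarrow> contF U f \<Longrightarrow> contF U g \<Longrightarrow> contF U (\<lambda>x. f x * g x)"
  by (simp add: contF_iff tends_mult)

lemma contF_inverse: "U \<subseteq> Fn n \<Longrightarrow> contF U f \<Longrightarrow> (\<And>x. x \<in> U \<Longrightarrow> f x \<noteq> 0) \<Longrightarrow> contF U (\<lambda>x. inverse (f x))"
  by (simp add: contF_iff tends_inverse)

lemma DC_add:
  assumes U: "U \<subseteq> Fn n" shows "DC n r U f \<Longrightarrow> DC n r U g \<Longrightarrow> DC n r U (\<lambda>x. f x + g x)"
proof (induction r arbitrary: f g)
  case 0
  then show ?case using contF_add[OF U] def_fun_add by simp
next
  case (Suc r)
  from Suc.prems(1) obtain df where f: "def_fun n f" "contF U f"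
    "\<And>i x. i < n \<Longrightarrow> x \<in> U \<Longrightarrow> has_partial U f i x (df i x)" "\<And>i. i < n \<Longrightarrow> DC n r U (df i)"
    by (rule DC_SucE) blast
  from Suc.prems(2) obtain dg where g: "def_fun n g" "contF U g"
    "\<And>i x. i < n \<Longrightarrow> x \<in> U \<Longrightarrow> has_partial U g i x (dg i x)" "\<And>i. i < n \<Longrightarrow> DC n r U (dg i)"
    by (rule DC_SucE) blast
  show ?case
  proof (rule DC_SucI[where ds = "\<lambda>i x. df i x + dg i x"])
    show "def_fun n (\<lambda>x. f x + g x)" by (rule def_fun_add[OF f(1) g(1)])
    show "contF U (\<lambda>x. f x + g x)" by (rule contF_add[OF U f(2) g(2)])
    show "DC n r U (\<lambda>x. df i x + dg i x)" if "i < n" for i by (rule Suc.IH[OF f(4) g(4)]) (use that in auto)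
    show "has_partial U (\<lambda>x. f x + g x) i x (df i x + dg i x)" if "i < n" "x \<in> U" for i x
      using tends_add[OF f(3)[OF that, unfolded has_partial_iff] g(3)[OF that, unfolded has_partial_iff]]
      unfolding has_partial_iff by (simp add: add_divide_distrib[symmetric] algebra_simps)
  qed
qed

lemma DC_mult:
  assumes U: "U \<subseteq> Fn n" shows "DC n r U f \<Longrightarrow> DC n r U g \<Longrightarrow> DC n r U (\<lambda>x. f x * g x)"
proof (induction r arbitrary: f g)
  case 0
  then show ?case using contF_mult[OF U] def_fun_mult by simp
next
  case (Suc r)
  from Suc.prems(1) obtain df where f: "def_fun n f" "contF U f"
    "\<And>i x. i < n \<Longrightarrow> x \<in> U \<Longrightarrow> has_partial U f i x (df i x)" "\<And>i. i < n \<Longrightarrow> DC n r U (df i)"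
    by (rule DC_SucE) blast
  from Suc.prems(2) obtain dg where g: "def_fun n g" "contF U g"
    "\<And>i x. i < n \<Longrightarrow> x \<in> U \<Longrightarrow> has_partial U g i x (dg i x)" "\<And>i. i < n \<Longrightarrow> DC n r U (dg i)"
    by (rule DC_SucE) blast
  note fg = Suc.prems[THEN DC_Suc_imp]
  show ?case
  proof (rule DC_SucI[where ds = "\<lambda>i x. df i x * g x + f x * dg i x"])
    show "def_fun n (\<lambda>x. f x * g x)" by (rule def_fun_mult[OF f(1) g(1)])
    show "contF U (\<lambda>x. f x * g x)" by (rule contF_mult[OF U f(2) g(2)])
    show "DC n r U (\<lambda>x. df i x * g x + f x * dg i x)" if "i < n" for i
      using that by (intro DC_add[OF U] Suc.IH f(4) g(4) fg)
    fix i x assume i: "i < n" and x: "x \<in> U"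
    have "tends (\<lambda>t. (f (x[i := x ! i + t]) - f x) / t * g (x[i := x ! i + t])
        + f x * ((g (x[i := x ! i + t]) - g x) / t)) (df i x * g x + f x * dg i x) (step U i x)"
      using f(3)[OF i x] g(3)[OF i x] contF_tends_step[OF U g(2) x] unfolding has_partial_iff
      by (intro tends_add tends_mult tends_const)
    moreover have "(f (x[i := x ! i + t]) - f x) / t * g (x[i := x ! i + t])
        + f x * ((g (x[i := x ! i + t]) - g x) / t) = (f (x[i := x ! i + t]) * g (x[i := x ! i + t]) - f x * g x) / t" for t
      by (simp add: add_divide_distrib[symmetric] algebra_simps)
    ultimately show "has_partial U (\<lambda>x. f x * g x) i x (df i x * g x + f x * dg i x)"
      unfolding has_partial_iff by simp
  qed
qed

lemma DC_inverse:
  assumes U: "U \<subseteq> Fn n" and nz: "\<And>x. x \<in> U \<Longrightarrow> f x \<noteq> 0"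
  shows "DC n r U f \<Longrightarrow> DC n r U (\<lambda>x. inverse (f x))"
proof (induction r)
  case 0
  then show ?case using contF_inverse[OF U _ nz] def_fun_inverse by simp
next
  case (Suc r)
  from Suc.prems(1) obtain df where f: "def_fun n f" "contF U f"
    "\<And>i x. i < n \<Longrightarrow> x \<in> U \<Longrightarrow> has_partial U f i x (df i x)" "\<And>i. i < n \<Longrightarrow> DC n r U (df i)"
    by (rule DC_SucE) blast
  have IH: "DC n r U (\<lambda>x. inverse (f x))" by (rule Suc.IH[OF DC_Suc_imp[OF Suc.prems]])
  show ?case
  \<comment> \<open>The derivative contains the reciprocal again, but only in class
    \<open>r\<close>, so the induction closes; the sign is a factor \<open>-1\<close> to stay within
    products and constants.\<close>
  proof (rule DC_SucI[where ds = "\<lambda>i x. (-1) * (df i x * (inverse (f x) * inverse (f x)))"])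
    show "def_fun n (\<lambda>x. inverse (f x))" by (rule def_fun_inverse[OF f(1)])
    show "contF U (\<lambda>x. inverse (f x))" by (rule contF_inverse[OF U f(2) nz])
    show "DC n r U (\<lambda>x. (-1) * (df i x * (inverse (f x) * inverse (f x))))" if "i < n" for i
      using that by (intro DC_mult[OF U] DC_const f(4) IH)
    fix i x assume i: "i < n" and x: "x \<in> U"
    have t: "tends (\<lambda>t. (-1) * ((f (x[i := x ! i + t]) - f x) / t * (inverse (f (x[i := x ! i + t])) * inverse (f x))))
       ((-1) * (df i x * (inverse (f x) * inverse (f x)))) (step U i x)"
      using f(3)[OF i x] contF_tends_step[OF U f(2) x] nz[OF x] unfolding has_partial_iff
      by (intro tends_add tends_mult tends_const tends_inverse)
    show "has_partial U (\<lambda>x. inverse (f x)) i x ((-1) * (df i x * (inverse (f x) * inverse (f x))))"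
      unfolding has_partial_iff
    proof (rule tends_cong[OF t])
      show "eventually (\<lambda>t. (-1) * ((f (x[i := x ! i + t]) - f x) / t * (inverse (f (x[i := x ! i + t])) * inverse (f x)))
        = (inverse (f (x[i := x ! i + t])) - inverse (f x)) / t) (step U i x)"
        using eventually_step_small[OF zero_less_one]
      proof eventually_elim
        case (elim t)
        then show ?case using nz[OF x] nz[of "x[i := x ! i + t]"] by (simp add: field_simps)
      qed
    qed
  qed
qed

end

section \<open>Substitution into one coordinate\<close>

lemma cube_update_update:
  "e > 0 \<Longrightarrow> z \<in> cube x e \<Longrightarrow> \<bar>v - u\<bar> < e \<Longrightarrow> z[i := v] \<in> cube (x[i := u]) e"
  unfolding cube_def
proof (intro CollectI conjI allI impI)
  fix j assume "z \<in> {y. length y = length x \<and> (\<forall>i<length x. \<bar>y ! i - x ! i\<bar> < e)}"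
    "\<bar>v - u\<bar> < e" "j < length (x[i := u])"
  then show "\<bar>z[i := v] ! j - x[i := u] ! j\<bar> < e" by (cases "j = i") auto
qed auto

text \<open>At an interior point \<open>step\<close> is the filter of all small nonzero increments,
  which is coarser than any other \<open>step\<close>. Limits can thus be carried over to other
  points, sets and coordinates.\<close>

lemma eventually_step_open:
  assumes U: "openF n U" "y \<in> U" and P: "eventually P (step U k y)" shows "eventually P (step V l x)"
proof -
  obtain d where d: "d > 0" "\<And>t. t \<noteq> 0 \<Longrightarrow> \<bar>t\<bar> < d \<Longrightarrow> y[k := y ! k + t] \<in> U \<Longrightarrow> P t"
    using P unfolding eventually_step by blast
  obtain e where e: "e > 0" "cube y e \<subseteq> U" using U unfolding openF_iff by blast
  have "P t" if "t \<noteq> 0" "\<bar>t\<bar> < min d e" for t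
    using d(2)[of t] update_in_cube[OF e(1), of t y k] that e(2) by auto
  then show ?thesis unfolding eventually_step using d(1) e(1) by (intro exI[of _ "min d e"]) simp
qed

lemma tends_step_open:
  "openF n U \<Longrightarrow> y \<in> U \<Longrightarrow> tends f c (step U k y) \<Longrightarrow> tends f c (step V l x)"
  using eventually_step_open unfolding tends_def by blast

lemma contF_cube_subset:
  assumes U: "openF n U" and c: "contF U f" and y: "y \<in> U" and r: "0 < r"
  obtains d where "d > 0" "cube y d \<subseteq> U" "\<And>z. z \<in> cube y d \<Longrightarrow> \<bar>f z - f y\<bar> < r"
proof -
  have UF: "U \<subseteq> Fn n" using U by (simp add: openF_def)
  obtain d where d: "d > 0" "\<forall>z\<in>U \<inter> cube y d. \<bar>f z - f y\<bar> < r"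
    using c[unfolded contF_iff[OF UF] tends_def eventually_near] y r by blast
  obtain e where e: "e > 0" "cube y e \<subseteq> U" using U y unfolding openF_iff by blast
  have "cube y (min d e) \<subseteq> cube y d" "cube y (min d e) \<subseteq> cube y e" by (intro cube_mono; simp)+
  then show thesis using d e by (intro that[of "min d e"]) auto
qed

lemma contF_cube:
  assumes "openF n U" "contF U f" "y \<in> U" "0 < r"
  obtains d where "d > 0" "\<And>z. z \<in> cube y d \<Longrightarrow> \<bar>f z - f y\<bar> < r"
  by (rule contF_cube_subset[OF assms]) (rule that)

lemma finite_min_pos:
  fixes f :: "'b \<Rightarrow> 'a::linordered_field"
  assumes "finite I" "\<And>i. i \<in> I \<Longrightarrow> 0 < f i"
  obtains d where "0 < d" "\<And>i. i \<in> I \<Longrightarrow> d \<le> f i"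
proof
  show "0 < Min (insert 1 (f ` I))" using assms by (subst Min_gr_iff) auto
  show "Min (insert 1 (f ` I)) \<le> f i" if "i \<in> I" for i using assms(1) that by (intro Min_le) auto
qed

lemma contF_cube_finite:
  fixes f :: "'b \<Rightarrow> 'a::linordered_field list \<Rightarrow> 'a"
  assumes U: "openF n U" "y \<in> U" and f: "finite I" "\<And>k. k \<in> I \<Longrightarrow> contF U (f k)" and r: "0 < r"
  obtains d where "0 < d" "cube y d \<subseteq> U" "\<And>k z. k \<in> I \<Longrightarrow> z \<in> cube y d \<Longrightarrow> \<bar>f k z - f k y\<bar> < r"
proof -
  have "\<exists>d>0. \<forall>z\<in>cube y d. \<bar>f k z - f k y\<bar> < r" if "k \<in> I" for k
    by (rule contF_cube[OF U(1) f(2)[OF that] U(2) r]) blast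
  then obtain F where F: "\<And>k. k \<in> I \<Longrightarrow> 0 < F k" "\<And>k z. k \<in> I \<Longrightarrow> z \<in> cube y (F k) \<Longrightarrow> \<bar>f k z - f k y\<bar> < r"
    by metis
  obtain d where d: "0 < d" "\<And>k. k \<in> I \<Longrightarrow> d \<le> F k"
    by (rule finite_min_pos[OF f(1), of F]) (use F(1) in auto)
  obtain e where e: "0 < e" "cube y e \<subseteq> U" using U unfolding openF_iff by blast
  show thesis
  proof (rule that[of "min d e"])
    show "cube y (min d e) \<subseteq> U" using cube_mono[of "min d e" e y] e(2) by auto
    show "\<bar>f k z - f k y\<bar> < r" if "k \<in> I" "z \<in> cube y (min d e)" for k z
      using F(2)[OF that(1)] cube_mono[of "min d e" "F k" y] d(2)[OF that(1)] that(2) by (auto simp: min.coboundedI1)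
  qed (use d e in simp)
qed

context def_complete
begin

text \<open>The common source of the chain rule and of implicit differentiation. The increment of
  \<open>g (x[i := h x])\<close> is split into a move of coordinate \<open>i\<close> by the
  increment of \<open>h\<close>, with quotient \<open>A\<close>, and a move of coordinate
  \<open>k\<close>, with quotient \<open>B\<close>. Of \<open>h\<close> only continuity is assumed,
  so this also applies when differentiability of \<open>h\<close> is the goal.\<close>

lemma increment_decomposition:
  assumes U: "openF n U" and V: "openF n V" and i: "i < n" and x: "x \<in> V"
    and img: "x[i := h x] \<in> U" and g: "def_fun n g" and h: "contF V h"
    and dg: "\<And>z. z \<in> U \<Longrightarrow> has_partial U g i z (dg z)" "contF U dg"
    and pk: "has_partial U g k (x[i := h x]) c"
  obtains A B where "tends A (dg (x[i := h x])) (step V k x)"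
    "tends B (if k = i then 0 else c) (step V k x)"
    "\<And>t. t \<noteq> 0 \<Longrightarrow> g ((x[k := x ! k + t])[i := h (x[k := x ! k + t])]) - g (x[i := h x])
       = A t * (h (x[k := x ! k + t]) - h x) + B t * t"
proof -
  define y where "y = x[i := h x]"
  \<comment> \<open>Coordinate \<open>k\<close> has moved while coordinate \<open>i\<close> keeps
    its old value \<open>h x\<close>; for \<open>k = i\<close> nothing moves, as that coordinate is
    overwritten anyway.\<close>
  define yt where "yt = (\<lambda>t. if k = i then y else y[k := y ! k + t])"
  define ht where "ht = (\<lambda>t. h (x[k := x ! k + t]))"
  \<comment> \<open>Where \<open>h\<close> does not change, the quotient gets its limit as value;
    this keeps both the identity and the limit true.\<close>
  define A where "A = (\<lambda>t. if ht t = h x then dg y else (g ((yt t)[i := ht t]) - g (yt t)) / (ht t - h x))"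
  define B where "B = (\<lambda>t. (g (yt t) - g y) / t)"
  have VF: "V \<subseteq> Fn n" using V by (simp add: openF_def)
  have l: "length x = n" "length y = n" using x VF by (auto simp: y_def)
  have yU: "y \<in> U" using img by (simp add: y_def)
  have upd: "(x[k := x ! k + t])[i := ht t] = (yt t)[i := ht t]" for t
    unfolding yt_def y_def using i l by (cases "k = i") (simp_all add: list_update_swap[of i k])
  have yti: "yt t ! i = h x" for t using i l by (simp add: yt_def y_def)
  have "tends B (if k = i then 0 else c) (step V k x)"
  proof (cases "k = i")
    case True
    then show ?thesis by (simp add: B_def yt_def tends_const)
  next
    case False
    have "tends B c (step U k y)" using pk False by (simp add: B_def yt_def y_def has_partial_iff)
    from tends_step_open[OF U yU this] show ?thesis using False by simp
  qed
  moreover have "tends A (dg y) (step V k x)" unfolding tends_def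
  proof (intro allI impI)
    fix e :: 'a assume "0 < e"
    then have e: "0 < e / 2" by simp
    obtain d where d: "d > 0" "cube y d \<subseteq> U" "\<And>z. z \<in> cube y d \<Longrightarrow> \<bar>dg z - dg y\<bar> < e / 2"
      by (rule contF_cube_subset[OF U dg(2) yU e]) (rule that)
    have "eventually (\<lambda>t. \<bar>ht t - h x\<bar> < d) (step V k x)"
      using tendsD[OF contF_tends_step[OF VF h x] d(1)] by (simp add: ht_def)
    then show "eventually (\<lambda>t. \<bar>A t - dg y\<bar> < e) (step V k x)"
      using eventually_step_small[OF d(1), of x k V]
    proof eventually_elim
      case (elim t)
      have 1: "yt t \<in> cube y d"
        unfolding yt_def using update_in_cube[OF d(1), of t y k] elim cube_center[OF d(1), of y] by simp
      have "y ! i = h x" using l i by (simp add: y_def)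
      then have 2: "(yt t)[i := ht t] \<in> cube y d"
        using cube_update[OF 1, of i "ht t"] elim i l by simp
      \<comment> \<open>The base point \<open>yt t\<close> moves with \<open>t\<close>, so
        differentiability at \<open>y\<close> is not enough; the mean value bound uses that
        \<open>dg\<close> stays within \<open>e / 2\<close> of \<open>dg y\<close> on a
        cube.\<close>
      have "\<bar>g ((yt t)[i := ht t]) - g (yt t) - dg y * (ht t - yt t ! i)\<bar> \<le> (e / 2) * \<bar>ht t - yt t ! i\<bar>"
        using dg(1) d(2,3) by (intro slope_bound[OF g i l(2) _ d(2) 1 2]) blast
      then have 3: "\<bar>g ((yt t)[i := ht t]) - g (yt t) - dg y * (ht t - h x)\<bar> \<le> (e / 2) * \<bar>ht t - h x\<bar>"
        by (simp add: yti)
      show ?case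
      proof (cases "ht t = h x")
        case False
        then have "(A t - dg y) * (ht t - h x) = g ((yt t)[i := ht t]) - g (yt t) - dg y * (ht t - h x)"
          by (subst left_diff_distrib) (simp add: A_def)
        then have "\<bar>A t - dg y\<bar> * \<bar>ht t - h x\<bar> \<le> (e / 2) * \<bar>ht t - h x\<bar>"
          unfolding abs_mult[symmetric] using 3 by simp
        then have "\<bar>A t - dg y\<bar> \<le> e / 2" using False by simp
        also have "\<dots> < e" using \<open>0 < e\<close> by simp
        finally show ?thesis .
      qed (use \<open>0 < e\<close> in \<open>simp add: A_def\<close>)
    qed
  qed
  moreover have "g ((x[k := x ! k + t])[i := ht t]) - g y = A t * (ht t - h x) + B t * t" if "t \<noteq> 0" for t
  proof -
    have "A t * (ht t - h x) = g ((yt t)[i := ht t]) - g (yt t)"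
    proof (cases "ht t = h x")
      case True
      have "(yt t)[i := ht t] = yt t" using list_update_id[of "yt t" i] unfolding True yti by simp
      then show ?thesis using True by simp
    qed (simp add: A_def)
    moreover have "B t * t = g (yt t) - g y" using that by (simp add: B_def)
    ultimately show ?thesis unfolding upd by simp
  qed
  ultimately show thesis by (intro that[of A B]) (simp_all add: y_def ht_def)
qed

lemma contF_subst:
  fixes U V :: "'a list set" and g h :: "'a list \<Rightarrow> 'a"
  assumes U: "openF n U" and V: "openF n V" and img: "\<And>x. x \<in> V \<Longrightarrow> x[i := h x] \<in> U"
    and g: "contF U g" and h: "contF V h"
  shows "contF V (\<lambda>x. g (x[i := h x]))"
proof -
  have VF: "V \<subseteq> Fn n" using V by (simp add: openF_def)
  show ?thesis unfolding contF_iff[OF VF] tends_def eventually_near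
  proof (intro ballI allI impI)
    fix x and r :: 'a assume x: "x \<in> V" and r: "0 < r"
    obtain e where e: "e > 0" "\<And>z. z \<in> cube (x[i := h x]) e \<Longrightarrow> \<bar>g z - g (x[i := h x])\<bar> < r"
      by (rule contF_cube[OF U g img[OF x] r]) (rule that)
    obtain d where d: "d > 0" "\<And>z. z \<in> cube x d \<Longrightarrow> \<bar>h z - h x\<bar> < e"
      by (rule contF_cube[OF V h x e(1)]) (rule that)
    have "\<bar>g (z[i := h z]) - g (x[i := h x])\<bar> < r" if "z \<in> cube x (min d e)" for z
    proof -
      have "z \<in> cube x d" "z \<in> cube x e" using that cube_mono[of "min d e" d x] cube_mono[of "min d e" e x] by auto
      then show ?thesis by (intro e(2) cube_update_update e(1) d(2))
    qed
    then show "\<exists>d>0. \<forall>z\<in>V \<inter> cube x d. \<bar>g (z[i := h z]) - g (x[i := h x])\<bar> < r"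
      using d(1) e(1) by (intro exI[of _ "min d e"]) auto
  qed
qed

lemma def_fun_subst:
  assumes g: "def_fun n g" and h: "def_fun n h" shows "def_fun n (\<lambda>x. g (x[i := h x]))"
  by (intro def_funI def_term_fun[OF g] def_vec_update def_vec_take_map def_fun_term[OF h])

text \<open>By the chain rule the derivatives involve the \<open>dg k\<close> at
  \<open>x[i := h x]\<close>, and these are of class \<open>r\<close> by induction, \<open>h\<close>
  being of class \<open>r\<close> as well. For \<open>k = i\<close> the direct contribution of
  coordinate \<open>k\<close> is absent.\<close>

lemma DC_subst:
  assumes U: "openF n U" and V: "openF n V" and i: "i < n" and img: "\<And>x. x \<in> V \<Longrightarrow> x[i := h x] \<in> U"
  shows "DC n r U g \<Longrightarrow> DC n r V h \<Longrightarrow> DC n r V (\<lambda>x. g (x[i := h x]))"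
proof (induction r arbitrary: g)
  case 0
  then show ?case using contF_subst[OF U V img] def_fun_subst by simp
next
  case (Suc r)
  have VF: "V \<subseteq> Fn n" using V by (simp add: openF_def)
  from Suc.prems(1) obtain dg where g: "def_fun n g" "contF U g"
    "\<And>i x. i < n \<Longrightarrow> x \<in> U \<Longrightarrow> has_partial U g i x (dg i x)" "\<And>i. i < n \<Longrightarrow> DC n r U (dg i)"
    by (rule DC_SucE) blast
  from Suc.prems(2) obtain dh where h: "def_fun n h" "contF V h"
    "\<And>i x. i < n \<Longrightarrow> x \<in> V \<Longrightarrow> has_partial V h i x (dh i x)" "\<And>i. i < n \<Longrightarrow> DC n r V (dh i)"
    by (rule DC_SucE) blast
  have comp: "DC n r V (\<lambda>x. dg k (x[i := h x]))" if "k < n" for k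
    by (rule Suc.IH[OF g(4)[OF that] DC_Suc_imp[OF Suc.prems(2)]])
  let ?d = "\<lambda>k x. (if k = i then 0 else dg k (x[i := h x])) + dg i (x[i := h x]) * dh k x"
  show ?case
  proof (rule DC_SucI[where ds = ?d])
    show "def_fun n (\<lambda>x. g (x[i := h x]))" by (rule def_fun_subst[OF g(1) h(1)])
    show "contF V (\<lambda>x. g (x[i := h x]))" by (rule contF_subst[OF U V img g(2) h(2)])
    fix k assume k: "k < n"
    have *: "DC n r V (\<lambda>x. if k = i then 0 else dg k (x[i := h x]))"
      using DC_const comp[OF k] by (cases "k = i") simp_all
    show "DC n r V (?d k)" by (intro DC_add[OF VF] DC_mult[OF VF] * comp h(4) i k)
    fix x assume x: "x \<in> V"
    obtain A B where AB: "tends A (dg i (x[i := h x])) (step V k x)"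
      "tends B (if k = i then 0 else dg k (x[i := h x])) (step V k x)"
      "\<And>t. t \<noteq> 0 \<Longrightarrow> g ((x[k := x ! k + t])[i := h (x[k := x ! k + t])]) - g (x[i := h x])
         = A t * (h (x[k := x ! k + t]) - h x) + B t * t"
      using increment_decomposition[OF U V i x img[OF x] g(1) h(2) g(3)[OF i] DC_contF[OF g(4)[OF i]] g(3)[OF k img[OF x]]]
      by blast
    have t: "tends (\<lambda>t. B t + A t * ((h (x[k := x ! k + t]) - h x) / t)) (?d k x) (step V k x)"
      using h(3)[OF k x] unfolding has_partial_iff by (intro tends_add tends_mult AB(1,2))
    show "has_partial V (\<lambda>x. g (x[i := h x])) k x (?d k x)" unfolding has_partial_iff
    proof (rule tends_cong[OF t])
      show "eventually (\<lambda>t. B t + A t * ((h (x[k := x ! k + t]) - h x) / t) =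
        (g ((x[k := x ! k + t])[i := h (x[k := x ! k + t])]) - g (x[i := h x])) / t) (step V k x)"
        using eventually_step_small[OF zero_less_one]
      proof eventually_elim
        case (elim t)
        then have "t \<noteq> 0" by blast
        then show ?case by (simp add: AB(3) add_divide_distrib)
      qed
    qed
  qed
qed

text \<open>\<open>L\<close> copies entries of \<open>z\<close> into some coordinates and fills the
  others from \<open>c\<close>. As \<open>\<sigma>\<close> is injective where it is defined, moving
  \<open>z ! k\<close> moves at most one coordinate of \<open>L z\<close>, so a partial derivative
  is one of \<open>g\<close> or 0. This carries functions between \<open>F^n\<close>,
  \<open>F^2n\<close> and the base of a projection.\<close>

lemma DC_reindex:
  fixes \<sigma> :: "nat \<Rightarrow> nat option" and c :: "'a list" and n :: nat
  defines "L \<equiv> \<lambda>z. map (\<lambda>j. case \<sigma> j of Some k \<Rightarrow> z ! k | None \<Rightarrow> c ! j) [0..<n]"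
  assumes U: "openF n U" and V: "openF m V" and img: "\<And>z. z \<in> V \<Longrightarrow> L z \<in> U"
    and \<sigma>: "\<And>j k. j < n \<Longrightarrow> \<sigma> j = Some k \<Longrightarrow> k < m"
    and inj: "\<And>j j' k. j < n \<Longrightarrow> j' < n \<Longrightarrow> \<sigma> j = Some k \<Longrightarrow> \<sigma> j' = Some k \<Longrightarrow> j = j'"
  shows "DC n r U g \<Longrightarrow> DC m r V (\<lambda>z. g (L z))"
proof (induction r arbitrary: g)
  have VF: "V \<subseteq> Fn m" using V by (simp add: openF_def)
  have L_cube: "L z \<in> cube (L x) e" if "z \<in> cube x e" "length x = m" "e > 0" for x z e
    unfolding cube_def
  proof (intro CollectI conjI allI impI)
    fix j assume "j < length (L x)"
    then have j: "j < n" by (simp add: L_def)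
    show "\<bar>L z ! j - L x ! j\<bar> < e"
    proof (cases "\<sigma> j")
      case (Some k)
      then show ?thesis using \<sigma>[OF j Some] that j by (simp add: L_def cube_def)
    qed (use j that in \<open>simp add: L_def\<close>)
  qed (simp add: L_def)
  have df: "def_fun m (\<lambda>z. g (L z))" if g: "def_fun n g" for g
  proof (rule def_funI, rule def_term_fun[OF g])
    have "def_term (\<lambda>\<rho>. case \<sigma> j of Some k \<Rightarrow> map \<rho> [0..<m] ! k | None \<Rightarrow> c ! j)" if "j < n" for j
      using \<sigma>[OF that] by (cases "\<sigma> j") (simp_all add: def_term_const def_term_var)
    then show "def_vec n (\<lambda>\<rho>. L (map \<rho> [0..<m]))" unfolding L_def by (rule def_vec_map)
  qed
  have cf: "contF V (\<lambda>z. g (L z))" if g: "contF U g" for g :: "'a list \<Rightarrow> 'a"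
    unfolding contF_iff[OF VF] tends_def eventually_near
  proof (intro ballI allI impI)
    fix x and r :: 'a assume x: "x \<in> V" and r: "0 < r"
    obtain e where e: "e > 0" "\<And>z. z \<in> cube (L x) e \<Longrightarrow> \<bar>g z - g (L x)\<bar> < r"
      by (rule contF_cube[OF U g img[OF x] r]) (rule that)
    have "length x = m" using VF x by auto
    then show "\<exists>d>0. \<forall>z\<in>V \<inter> cube x d. \<bar>g (L z) - g (L x)\<bar> < r"
      using e L_cube by blast
  qed
  {
    case 0
    then show ?case using df cf by simp
  next
    case (Suc r)
    from Suc.prems(1) obtain dg where g: "def_fun n g" "contF U g"
      "\<And>i x. i < n \<Longrightarrow> x \<in> U \<Longrightarrow> has_partial U g i x (dg i x)" "\<And>i. i < n \<Longrightarrow> DC n r U (dg i)"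
      by (rule DC_SucE) blast
    let ?E = "\<lambda>k. \<exists>j<n. \<sigma> j = Some k"
    define J where "J k = (SOME j. j < n \<and> \<sigma> j = Some k)" for k
    have J: "J k < n" "\<sigma> (J k) = Some k" if "?E k" for k
      using someI_ex[of "\<lambda>j. j < n \<and> \<sigma> j = Some k"] that unfolding J_def by auto
    let ?d = "\<lambda>k z. if ?E k then dg (J k) (L z) else 0"
    show ?case
    proof (rule DC_SucI[where ds = ?d])
      show "def_fun m (\<lambda>z. g (L z))" by (rule df[OF g(1)])
      show "contF V (\<lambda>z. g (L z))" by (rule cf[OF g(2)])
      show "DC m r V (?d k)" for k
      proof (cases "?E k")
        case True
        show ?thesis unfolding if_P[OF True] by (rule Suc.IH[OF g(4)[OF J(1)[OF True]]])
      next
        case False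
        show ?thesis unfolding if_not_P[OF False] by (rule DC_const)
      qed
      fix k z assume k: "k < m" and z: "z \<in> V"
      have l: "length z = m" using z VF by auto
      show "has_partial V (\<lambda>z. g (L z)) k z (?d k z)"
      proof (cases "?E k")
        case True
        have "L (z[k := z ! k + t]) = (L z)[J k := L z ! J k + t]" for t
        proof (rule nth_equalityI)
          fix j assume "j < length (L (z[k := z ! k + t]))"
          then have j: "j < n" by (simp add: L_def)
          show "L (z[k := z ! k + t]) ! j = (L z)[J k := L z ! J k + t] ! j"
          proof (cases "j = J k")
            case True
            then show ?thesis using j J(2)[OF \<open>?E k\<close>] k l by (simp add: L_def)
          next
            case False
            then have "\<sigma> j \<noteq> Some k" using inj[OF j J(1)[OF True] _ J(2)[OF True]] by blast
            then show ?thesis using j False by (cases "\<sigma> j") (auto simp: L_def)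
          qed
        qed (simp add: L_def)
        then show ?thesis
          unfolding if_P[OF True] has_partial_iff
          using tends_step_open[OF U img[OF z] g(3)[OF J(1)[OF True] img[OF z], unfolded has_partial_iff]] 
          by simp
      next
        case False
        have "L (z[k := z ! k + t]) = L z" for t
          unfolding L_def
        proof (rule map_cong[OF refl])
          fix j assume "j \<in> set [0..<n]"
          then have "\<sigma> j \<noteq> Some k" using False by auto
          then show "(case \<sigma> j of Some l \<Rightarrow> z[k := z ! k + t] ! l | None \<Rightarrow> c ! j) =
            (case \<sigma> j of Some l \<Rightarrow> z ! l | None \<Rightarrow> c ! j)" by (cases "\<sigma> j") auto
        qed
        then show ?thesis unfolding if_not_P[OF False] has_partial_def using zero_less_one by auto
      qed
    qed
  }
qed

section \<open>Implicit functions for one equation\<close>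

lemma intermediate_value:
  assumes f: "def_term (\<lambda>\<rho>. f (\<rho> 0))" and ab: "a < b" "f a < 0" "0 < f b"
    and cont: "\<And>t r. a \<le> t \<Longrightarrow> t \<le> b \<Longrightarrow> 0 < r \<Longrightarrow> \<exists>d>0. \<forall>s. \<bar>s - t\<bar> < d \<longrightarrow> \<bar>f s - f t\<bar> < r"
  shows "\<exists>t. a < t \<and> t < b \<and> f t = 0"
proof (rule ccontr)
  assume n: "\<not> ?thesis"
  have nz: "f t \<noteq> 0" if "a \<le> t" "t \<le> b" for t
    using n ab that by (cases "t = a \<or> t = b") auto
  \<comment> \<open>Without a zero the sign is locally constant, so real induction carries
    \<open>f < 0\<close> from \<open>a\<close> to \<open>b\<close>.\<close>
  have sign: "\<exists>d>0. \<forall>s. \<bar>s - t\<bar> < d \<longrightarrow> (f s < 0 \<longleftrightarrow> f t < 0)" if t: "a \<le> t" "t \<le> b" for t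
  proof -
    have "0 < \<bar>f t\<bar>" using nz[OF t] by simp
    then obtain d where d: "d > 0" "\<forall>s. \<bar>s - t\<bar> < d \<longrightarrow> \<bar>f s - f t\<bar> < \<bar>f t\<bar>"
      using cont[OF t] by blast
    have "f s < 0 \<longleftrightarrow> f t < 0" if "\<bar>s - t\<bar> < d" for s
    proof -
      have "\<bar>f s - f t\<bar> < \<bar>f t\<bar>" using d(2) that by blast
      then show ?thesis by linarith
    qed
    then show ?thesis using d(1) by blast
  qed
  have "f b < 0"
  proof (rule real_induction[where P = "\<lambda>t. f t < 0" and a = a and b = b])
    show "def_pred (\<lambda>\<rho>. f (\<rho> 0) < 0)" by (intro def_intros f)
  next
    fix t assume t: "a \<le> t" "t < b" and P: "\<And>s. a \<le> s \<Longrightarrow> s \<le> t \<Longrightarrow> f s < 0"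
    obtain d where d: "d > 0" "\<forall>s. \<bar>s - t\<bar> < d \<longrightarrow> (f s < 0 \<longleftrightarrow> f t < 0)"
      using sign[of t] t by auto
    have "f s < 0" if "t < s" "s < t + d" for s
      using d(2)[rule_format, of s] P[OF t(1) order_refl] that by simp
    then show "\<exists>u>t. \<forall>s. t < s \<and> s < u \<and> s \<le> b \<longrightarrow> f s < 0"
      using d(1) by (intro exI[of _ "t + d"]) simp
  next
    fix t assume t: "a < t" "t \<le> b" and P: "\<And>s. a \<le> s \<Longrightarrow> s < t \<Longrightarrow> f s < 0"
    obtain d where d: "d > 0" "\<forall>s. \<bar>s - t\<bar> < d \<longrightarrow> (f s < 0 \<longleftrightarrow> f t < 0)"
      using sign[of t] t by auto
    obtain s where s: "max a (t - d) < s" "s < t" using dense[of "max a (t - d)" t] t d by auto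
    then show "f t < 0" using d(2)[rule_format, of s] P[of s] by simp
  qed (use ab in auto)
  then show False using ab by simp
qed

text \<open>Near \<open>a\<close> the function \<open>q\<close> increases strictly in coordinate
  \<open>i\<close> and changes sign across a fixed window, so each line in direction
  \<open>i\<close> has exactly one zero there. The solution \<open>h\<close> stays a function on
  \<open>F^n\<close>; that it depends only on the values of \<open>q\<close> along such a line is
  recorded, since local graphs keep track of the variables they depend on.\<close>

lemma implicit_function:
  assumes q: "DC n (Suc r) (cube a e) q" and e: "e > 0" and a: "length a = n" and i: "i < n"
    and q0: "q a = 0" and c: "has_partial (cube a e) q i a c" "c > 0"
  obtains d h where "0 < d" "d \<le> e" "DC n (Suc r) (cube a d) h"
    "\<And>x. x \<in> cube a d \<Longrightarrow> q x = 0 \<longleftrightarrow> x ! i = h x"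
    "\<And>x y. length x = n \<Longrightarrow> length y = n \<Longrightarrow> (\<And>c. q (x[i := c]) = q (y[i := c])) \<Longrightarrow> h x = h y"
    "\<And>x. x \<in> cube a d \<Longrightarrow> x[i := h x] \<in> cube a e"
proof -
  define U where "U = cube a e"
  have U: "openF n U" using openF_cube[of a e] a by (simp add: U_def)
  have UF: "U \<subseteq> Fn n" using U by (simp add: openF_def)
  have aU: "a \<in> U" unfolding U_def by (rule cube_center[OF e])
  from q obtain dq where dq: "def_fun n q" "contF U q"
    "\<And>i x. i < n \<Longrightarrow> x \<in> U \<Longrightarrow> has_partial U q i x (dq i x)" "\<And>i. i < n \<Longrightarrow> DC n r U (dq i)"
    unfolding U_def by (rule DC_SucE) blast
  have dqa: "dq i a = c" using has_partial_unique[OF U aU dq(3)[OF i aU]] c(1) by (simp add: U_def)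
  \<comment> \<open>On \<open>cube a s\<close> the derivative stays within \<open>c / 2\<close> of
    \<open>c\<close>, hence above \<open>c / 2\<close>: this gives monotonicity now and a nonzero
    denominator later.\<close>
  define b where "b = c / 2"
  have b: "b > 0" "c = b + b" using c(2) by (simp_all add: b_def)
  obtain s where s: "s > 0" "cube a s \<subseteq> U" "\<And>z. z \<in> cube a s \<Longrightarrow> \<bar>dq i z - c\<bar> < b"
    by (rule contF_cube_subset[OF U DC_contF[OF dq(4)[OF i]] aU b(1), unfolded dqa]) (rule that)
  have mono: "q (x[i := u]) < q (x[i := v])"
    if "x \<in> cube a s" "\<bar>u - a ! i\<bar> < s" "\<bar>v - a ! i\<bar> < s" "u < v" for x u v
  proof -
    have l: "length x = n" using that a by (simp add: cube_def)
    have xu: "x[i := u] \<in> cube a s" "x[i := v] \<in> cube a s" using cube_update that i a by blast+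
    have "\<bar>q ((x[i := u])[i := v]) - q (x[i := u]) - c * (v - x[i := u] ! i)\<bar> \<le> b * (v - x[i := u] ! i)"
      by (rule slope_bound_less[OF dq(1) i a _ s(2)]) (use dq(3)[OF i] s(2,3) xu l i that in auto)
    then have "\<bar>q (x[i := v]) - q (x[i := u]) - c * (v - u)\<bar> \<le> b * (v - u)" using l i by simp
    moreover have "c * (v - u) = b * (v - u) + b * (v - u)" unfolding b(2) by (simp add: algebra_simps)
    moreover have "b * (v - u) > 0" using b(1) that by simp
    ultimately show ?thesis by linarith
  qed
  \<comment> \<open>Zeros are sought in the window of radius \<open>w\<close> around
    \<open>a ! i\<close>; \<open>w < s\<close> keeps its end points in range of the
    monotonicity.\<close>
  define w where "w = s / 2"
  have w: "w > 0" "w < s" using s(1) by (simp_all add: w_def)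
  \<comment> \<open>\<open>cube a s \<subseteq> cube a e\<close> bounds the radius only in positive
    dimension, which \<open>i < n\<close> ensures.\<close>
  have se: "s \<le> e" if "n > 0"
  proof (rule ccontr)
    assume "\<not> s \<le> e"
    then have "a[i := a ! i + e] \<in> cube a s" using update_in_cube[of s e a i] s(1) e by simp
    then have "a[i := a ! i + e] \<in> cube a e" using s(2) by (auto simp: U_def)
    then show False using i a e by (auto simp: cube_def dest!: spec[of _ i])
  qed
  have se: "s \<le> e" using se i by simp
  have as: "a \<in> cube a s" by (rule cube_center[OF s(1)])
  have hi: "a[i := a ! i + w] \<in> U" "a[i := a ! i - w] \<in> U"
    using update_in_cube[of s w a i] update_in_cube[of s "- w" a i] w s(1,2) by auto
  have "q (a[i := a ! i]) < q (a[i := a ! i + w])" "q (a[i := a ! i - w]) < q (a[i := a ! i])"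
    using w s(1) by (intro mono[OF as]; simp)+
  then have qhi: "0 < q (a[i := a ! i + w])" and qlo: "0 < - q (a[i := a ! i - w])" using q0 by simp_all
  obtain d1 where d1: "d1 > 0" "\<And>z. z \<in> cube (a[i := a ! i + w]) d1 \<Longrightarrow> \<bar>q z - q (a[i := a ! i + w])\<bar> < q (a[i := a ! i + w])"
    by (rule contF_cube[OF U dq(2) hi(1) qhi]) (rule that)
  obtain d2 where d2: "d2 > 0" "\<And>z. z \<in> cube (a[i := a ! i - w]) d2 \<Longrightarrow> \<bar>q z - q (a[i := a ! i - w])\<bar> < - q (a[i := a ! i - w])"
    by (rule contF_cube[OF U dq(2) hi(2) qlo]) (rule that)
  \<comment> \<open>\<open>d1\<close> and \<open>d2\<close> preserve the signs of \<open>q\<close>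
    at the two ends of the window; \<open>w\<close> keeps \<open>x ! i\<close> inside it.\<close>
  define d where "d = min (min d1 d2) w"
  have d: "d > 0" "d \<le> d1" "d \<le> d2" "d \<le> w" using d1(1) d2(1) w by (auto simp: d_def)
  define V where "V = cube a d"
  have V: "openF n V" using openF_cube[of a d] a by (simp add: V_def)
  have VF: "V \<subseteq> Fn n" using V by (simp add: openF_def)
  have Vs: "x \<in> cube a s" if "x \<in> V" for x
    using that cube_mono[of d s a] d w by (auto simp: V_def)
  have signs: "q (x[i := a ! i + w]) > 0 \<and> q (x[i := a ! i - w]) < 0" if x: "x \<in> V" for x
  proof -
    have "x \<in> cube a d1" "x \<in> cube a d2" using x cube_mono[OF d(2)] cube_mono[OF d(3)] by (auto simp: V_def)
    then have "x[i := a ! i + w] \<in> cube (a[i := a ! i + w]) d1" "x[i := a ! i - w] \<in> cube (a[i := a ! i - w]) d2"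
      using d1(1) d2(1) by (auto intro!: cube_update_update)
    from d1(2)[OF this(1)] d2(2)[OF this(2)] show ?thesis by linarith
  qed
  define Z where "Z = (\<lambda>x u. \<bar>u - a ! i\<bar> < w \<and> q (x[i := u]) = 0)"
  have Z_ex: "\<exists>u. Z x u" if x: "x \<in> V" for x
  proof -
    have l: "length x = n" using x VF by auto
    have "\<exists>u. a ! i - w < u \<and> u < a ! i + w \<and> q (x[i := u]) = 0"
    proof (rule intermediate_value[where f = "\<lambda>u. q (x[i := u])"])
      show "def_term (\<lambda>\<rho>. q (x[i := \<rho> 0]))" by (intro def_term_fun[OF dq(1)] def_intros def_vec_const l)
      fix u r :: 'a assume u: "a ! i - w \<le> u" "u \<le> a ! i + w" and r: "0 < r"
      have "\<bar>u - a ! i\<bar> < s" using u w by linarith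
      then have "x[i := u] \<in> U" using cube_update[OF Vs[OF x]] i a s(2) by blast
      then obtain t where t: "t > 0" "\<And>z. z \<in> cube (x[i := u]) t \<Longrightarrow> \<bar>q z - q (x[i := u])\<bar> < r"
        by (rule contF_cube[OF U dq(2) _ r]) (rule that)
      have "x[i := v] \<in> cube (x[i := u]) t" if "\<bar>v - u\<bar> < t" for v
        using cube_update_update[OF t(1) cube_center[OF t(1)] that] .
      then show "\<exists>d>0. \<forall>v. \<bar>v - u\<bar> < d \<longrightarrow> \<bar>q (x[i := v]) - q (x[i := u])\<bar> < r"
        using t by blast
    qed (use w signs[OF x] in auto)
    then obtain u where "a ! i - w < u" "u < a ! i + w" "q (x[i := u]) = 0" by blast
    then have "Z x u" unfolding Z_def by (auto simp: abs_less_iff)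
    then show ?thesis by blast
  qed
  have Z_unique: "u = v" if "x \<in> V" "Z x u" "Z x v" for x u v
  proof (rule ccontr)
    assume "u \<noteq> v"
    then have "u < v \<or> v < u" by auto
    moreover have "\<bar>u - a ! i\<bar> < s" "\<bar>v - a ! i\<bar> < s" using that(2,3) w(2) by (auto simp: Z_def)
    ultimately show False using mono[OF Vs[OF that(1)], of u v] mono[OF Vs[OF that(1)], of v u] that(2,3)
      by (auto simp: Z_def)
  qed
  \<comment> \<open>The default 0 makes \<open>h\<close> total and definable. The formula refers to
    \<open>x\<close> only through the values \<open>q (x[i := u])\<close>, whence the recorded
    dependence.\<close>
  define h where "h = (\<lambda>x. if \<exists>!u. Z x u then THE u. Z x u else 0)"
  have Zh: "Z x (h x)" if x: "x \<in> V" for x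
  proof -
    have *: "\<exists>!u. Z x u" using Z_ex[OF x] Z_unique[OF x] by blast
    show ?thesis unfolding h_def if_P[OF *] by (rule theI'[OF *])
  qed
  have h_eq: "h x = u" if "x \<in> V" "Z x u" for x u using Z_unique[OF that(1) Zh[OF that(1)] that(2)] .
  have img: "x[i := h x] \<in> cube a s" if "x \<in> V" for x
    using Zh[OF that] w i a by (intro cube_update[OF Vs[OF that]]) (auto simp: Z_def)
  then have imgU: "x[i := h x] \<in> U" if "x \<in> V" for x using that s(2) by blast
  have hd: "def_fun n h"
  proof (rule def_funI, rule def_termI[where Q = "\<lambda>\<rho> b. (Z (map \<rho> [0..<n]) b \<and> (\<forall>u. Z (map \<rho> [0..<n]) u \<longrightarrow> u = b)) \<or>
      (\<not> (\<exists>v. Z (map \<rho> [0..<n]) v \<and> (\<forall>u. Z (map \<rho> [0..<n]) u \<longrightarrow> u = v)) \<and> b = 0)"])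
    show "def_pred (\<lambda>\<rho>. (Z (map (\<lambda>i. \<rho> (Suc i)) [0..<n]) (\<rho> 0) \<and> (\<forall>u. Z (map (\<lambda>i. \<rho> (Suc i)) [0..<n]) u \<longrightarrow> u = \<rho> 0)) \<or>
      (\<not> (\<exists>v. Z (map (\<lambda>i. \<rho> (Suc i)) [0..<n]) v \<and> (\<forall>u. Z (map (\<lambda>i. \<rho> (Suc i)) [0..<n]) u \<longrightarrow> u = v)) \<and> \<rho> 0 = 0))"
      unfolding Z_def by (intro def_intros def_term_fun[OF dq(1)])
    show "(Z (map \<rho> [0..<n]) b \<and> (\<forall>u. Z (map \<rho> [0..<n]) u \<longrightarrow> u = b)) \<or>
      (\<not> (\<exists>v. Z (map \<rho> [0..<n]) v \<and> (\<forall>u. Z (map \<rho> [0..<n]) u \<longrightarrow> u = v)) \<and> b = 0) \<longleftrightarrow> b = h (map \<rho> [0..<n])" for \<rho> b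
    proof (cases "\<exists>!u. Z (map \<rho> [0..<n]) u")
      case True
      then obtain u where u: "Z (map \<rho> [0..<n]) u" "\<And>v. Z (map \<rho> [0..<n]) v \<Longrightarrow> v = u" by blast
      have "h (map \<rho> [0..<n]) = u" unfolding h_def if_P[OF True] using u by (rule the_equality)
      then show ?thesis using u by blast
    next
      case False
      have "h (map \<rho> [0..<n]) = 0" unfolding h_def if_not_P[OF False] ..
      then show ?thesis using False unfolding Ex1_def by metis
    qed
  qed
  have hc: "contF V h"
    unfolding contF_iff[OF VF] tends_def eventually_near
  proof (intro ballI allI impI)
    fix x and r :: 'a assume x: "x \<in> V" and r: "0 < r"
    define u where "u = h x"
    have u: "\<bar>u - a ! i\<bar> < w" "q (x[i := u]) = 0" using Zh[OF x] by (auto simp: Z_def u_def)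
    \<comment> \<open>\<open>p < r\<close>, and \<open>u - p\<close>, \<open>u + p\<close> still lie
      in the window. The opposite signs of \<open>q\<close> there persist for nearby
      \<open>z\<close> and trap \<open>h z\<close> in between.\<close>
    obtain p where p: "0 < p" "p < min r (w - \<bar>u - a ! i\<bar>)"
      using dense[of 0 "min r (w - \<bar>u - a ! i\<bar>)"] r u(1) by auto
    have us: "\<bar>u - a ! i\<bar> < s" "\<bar>u + p - a ! i\<bar> < s" "\<bar>u - p - a ! i\<bar> < s" using p u(1) w(2) by auto
    have "q (x[i := u]) < q (x[i := u + p])" "q (x[i := u - p]) < q (x[i := u])"
      using us p by (intro mono[OF Vs[OF x]]; simp)+
    then have sg: "0 < q (x[i := u + p])" "0 < - q (x[i := u - p])" using u(2) by simp_all
    have xs: "x[i := u + p] \<in> U" "x[i := u - p] \<in> U"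
      using cube_update[OF Vs[OF x]] us i a s(2) by blast+
    obtain e1 where e1: "e1 > 0" "\<And>z. z \<in> cube (x[i := u + p]) e1 \<Longrightarrow> \<bar>q z - q (x[i := u + p])\<bar> < q (x[i := u + p])"
      by (rule contF_cube[OF U dq(2) xs(1) sg(1)]) (rule that)
    obtain e2 where e2: "e2 > 0" "\<And>z. z \<in> cube (x[i := u - p]) e2 \<Longrightarrow> \<bar>q z - q (x[i := u - p])\<bar> < - q (x[i := u - p])"
      by (rule contF_cube[OF U dq(2) xs(2) sg(2)]) (rule that)
    have "\<bar>h z - h x\<bar> < r" if z: "z \<in> V" "z \<in> cube x (min e1 e2)" for z
    proof -
      have "z \<in> cube x e1" "z \<in> cube x e2" using z(2) cube_mono[of "min e1 e2" e1 x] cube_mono[of "min e1 e2" e2 x] by auto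
      then have "z[i := u + p] \<in> cube (x[i := u + p]) e1" "z[i := u - p] \<in> cube (x[i := u - p]) e2"
        using e1(1) e2(1) by (auto intro!: cube_update_update)
      from e1(2)[OF this(1)] e2(2)[OF this(2)]
      have sz: "0 < q (z[i := u + p])" "q (z[i := u - p]) < 0" by linarith+
      have v: "\<bar>h z - a ! i\<bar> < s" "q (z[i := h z]) = 0" using Zh[OF z(1)] w(2) by (auto simp: Z_def)
      have "\<not> u + p \<le> h z"
        using mono[OF Vs[OF z(1)] us(2) v(1)] v(2) sz(1) by (cases "h z = u + p") auto
      moreover have "\<not> h z \<le> u - p"
        using mono[OF Vs[OF z(1)] v(1) us(3)] v(2) sz(2) by (cases "h z = u - p") auto
      ultimately have "\<bar>h z - u\<bar> < p" by linarith
      then show ?thesis using p by (simp add: u_def)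
    qed
    then show "\<exists>d>0. \<forall>z\<in>V \<inter> cube x d. \<bar>h z - h x\<bar> < r"
      using e1(1) e2(1) by (intro exI[of _ "min e1 e2"]) simp
  qed
  have nz: "dq i (x[i := h x]) \<noteq> 0" if "x \<in> V" for x
  proof -
    have "\<bar>dq i (x[i := h x]) - c\<bar> < b" by (rule s(3)[OF img[OF that]])
    then show ?thesis using b by linarith
  qed
  \<comment> \<open>Implicit differentiation: minus the \<open>k\<close>-th derivative of
    \<open>q\<close> over the \<open>i\<close>-th one, and 0 for \<open>k = i\<close>, as
    \<open>h\<close> does not vary with coordinate \<open>i\<close>.\<close>
  let ?d = "\<lambda>k x. (-1) * ((if k = i then 0 else dq k (x[i := h x])) * inverse (dq i (x[i := h x])))"
  have hp: "has_partial V h k x (?d k x)" if k: "k < n" and x: "x \<in> V" for k x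
  proof -
    obtain A B where AB: "tends A (dq i (x[i := h x])) (step V k x)"
      "tends B (if k = i then 0 else dq k (x[i := h x])) (step V k x)"
      "\<And>t. t \<noteq> 0 \<Longrightarrow> q ((x[k := x ! k + t])[i := h (x[k := x ! k + t])]) - q (x[i := h x])
         = A t * (h (x[k := x ! k + t]) - h x) + B t * t"
      using increment_decomposition[OF U V i x imgU[OF x] dq(1) hc dq(3)[OF i] DC_contF[OF dq(4)[OF i]] dq(3)[OF k imgU[OF x]]]
      by blast
    have t: "tends (\<lambda>t. (-1) * (B t * inverse (A t))) (?d k x) (step V k x)"
      by (intro tends_mult tends_const tends_inverse AB(1,2) nz x)
    show ?thesis unfolding has_partial_iff
    proof (rule tends_cong[OF t])
      show "eventually (\<lambda>t. (-1) * (B t * inverse (A t)) = (h (x[k := x ! k + t]) - h x) / t) (step V k x)"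
        using eventually_step_small[OF zero_less_one] tends_nonzero[OF AB(1) nz[OF x]]
      proof eventually_elim
        case (elim t)
        then have t: "t \<noteq> 0" "x[k := x ! k + t] \<in> V" and At: "A t \<noteq> 0" by auto
        have "0 = A t * (h (x[k := x ! k + t]) - h x) + B t * t"
          using AB(3)[OF t(1)] Zh[OF t(2)] Zh[OF x] by (simp add: Z_def)
        then have "A t * (h (x[k := x ! k + t]) - h x) = - (B t * t)" by (simp add: eq_neg_iff_add_eq_0)
        then show ?case using t(1) At by (simp add: field_simps)
      qed
    qed
  qed
  \<comment> \<open>Bootstrapping: the derivatives of \<open>h\<close> are expressed through
    \<open>h\<close> itself, so class \<open>m\<close> of \<open>h\<close> gives class
    \<open>m\<close> of its derivatives.\<close>
  have hDC: "m \<le> Suc r \<Longrightarrow> DC n m V h" for m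
  proof (induction m)
    case 0
    then show ?case using hd hc by simp
  next
    case (Suc m)
    then have IH: "DC n m V h" by simp
    have comp: "DC n m V (\<lambda>x. dq k (x[i := h x]))" if "k < n" for k
      using DC_subst[OF U V i imgU DC_mono[OF _ dq(4)[OF that]] IH] Suc.prems by simp
    show ?case
    proof (rule DC_SucI[OF hd hc hp])
      fix k assume k: "k < n"
      have *: "DC n m V (\<lambda>x. if k = i then 0 else dq k (x[i := h x]))"
        using DC_const comp[OF k] by (cases "k = i") simp_all
      show "DC n m V (?d k)" by (intro DC_mult[OF VF] DC_const DC_inverse[OF VF] * comp i nz)
    qed
  qed
  show thesis
  proof (rule that[of d h])
    show "d \<le> e" using d(4) w(2) se by simp
    show "DC n (Suc r) (cube a d) h" using hDC[of "Suc r"] by (simp add: V_def)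
    show "q x = 0 \<longleftrightarrow> x ! i = h x" if "x \<in> cube a d" for x
    proof -
      have x: "x \<in> V" using that by (simp add: V_def)
      have "\<bar>x ! i - a ! i\<bar> < w" using that d(4) i a by (auto simp: cube_def)
      then have "Z x (x ! i) \<longleftrightarrow> q x = 0" by (simp add: Z_def)
      then show ?thesis using h_eq[OF x, of "x ! i"] Zh[OF x] by auto
    qed
    show "h x = h y" if "\<And>c. q (x[i := c]) = q (y[i := c])" for x y
      unfolding h_def Z_def that ..
    show "x[i := h x] \<in> cube a e" if "x \<in> cube a d" for x
      using imgU[of x] that by (simp add: V_def U_def)
  qed (rule d(1))
qed

end

section \<open>Local graphs and exchange of coordinates\<close>

text \<open>\<open>b\<close> stands for the sup-norm of the difference of the
  \<open>T\<close>-coordinates and spares a maximum in the formula. For \<open>b = 0\<close> it says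
  that the \<open>T\<close>-coordinates determine the first \<open>n\<close> coordinates on
  \<open>Q\<close>, also when \<open>T\<close> is empty.\<close>

definition lip_on :: "nat \<Rightarrow> 'a::linordered_field list set \<Rightarrow> nat set \<Rightarrow> 'a \<Rightarrow> bool" where
  "lip_on n Q T C \<longleftrightarrow> (\<forall>x\<in>Q. \<forall>y\<in>Q. \<forall>b\<ge>0. (\<forall>i\<in>T. \<bar>x ! i - y ! i\<bar> \<le> b) \<longrightarrow> (\<forall>k<n. \<bar>x ! k - y ! k\<bar> \<le> C * b))"

lemma lip_onD:
  "lip_on n Q T C \<Longrightarrow> x \<in> Q \<Longrightarrow> y \<in> Q \<Longrightarrow> 0 \<le> b \<Longrightarrow> (\<And>i. i \<in> T \<Longrightarrow> \<bar>x ! i - y ! i\<bar> \<le> b) \<Longrightarrow> k < n \<Longrightarrow>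
    \<bar>x ! k - y ! k\<bar> \<le> C * b"
  unfolding lip_on_def by blast

lemma lip_on_subset: "lip_on n Q T C \<Longrightarrow> Q' \<subseteq> Q \<Longrightarrow> lip_on n Q' T C"
  unfolding lip_on_def by blast

context def_complete
begin

text \<open>Near \<open>a\<close>, the set \<open>M\<close> is the graph of a map over the coordinates in \<open>S\<close>; the components of this map
  are functions on the ambient space which depend on the coordinates in \<open>S\<close> only.\<close>

definition local_graph ::
    "nat \<Rightarrow> nat \<Rightarrow> 'a list set \<Rightarrow> nat set \<Rightarrow> 'a list \<Rightarrow> 'a \<Rightarrow> (nat \<Rightarrow> 'a list \<Rightarrow> 'a) \<Rightarrow> bool" where
  "local_graph r n M S a e g \<longleftrightarrow> length a = n \<and> a \<in> M \<and> S \<subseteq> {..<n} \<and> 0 < e \<and>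
    (\<forall>k<n. k \<notin> S \<longrightarrow> DC n r (cube a e) (g k) \<and>
      (\<forall>x y. length x = n \<longrightarrow> length y = n \<longrightarrow> (\<forall>i\<in>S. x ! i = y ! i) \<longrightarrow> g k x = g k y)) \<and>
    (\<forall>x\<in>cube a e. x \<in> M \<longleftrightarrow> (\<forall>k<n. k \<notin> S \<longrightarrow> x ! k = g k x))"

definition graph_at :: "nat \<Rightarrow> nat \<Rightarrow> 'a list set \<Rightarrow> nat set \<Rightarrow> 'a list \<Rightarrow> bool" where
  "graph_at r n M S a \<longleftrightarrow> (\<exists>e g. local_graph r n M S a e g)"

lemma local_graphD:
  assumes "local_graph r n M S a e g"
  shows "length a = n" "a \<in> M" "S \<subseteq> {..<n}" "0 < e"
    "\<And>k. k < n \<Longrightarrow> k \<notin> S \<Longrightarrow> DC n r (cube a e) (g k)"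
    "\<And>k x y. k < n \<Longrightarrow> k \<notin> S \<Longrightarrow> length x = n \<Longrightarrow> length y = n \<Longrightarrow> \<forall>i\<in>S. x ! i = y ! i \<Longrightarrow> g k x = g k y"
    "\<And>x. x \<in> cube a e \<Longrightarrow> x \<in> M \<longleftrightarrow> (\<forall>k<n. k \<notin> S \<longrightarrow> x ! k = g k x)"
proof -
  from assms[unfolded local_graph_def] have *: "length a = n" "a \<in> M" "S \<subseteq> {..<n}" "0 < e"
    and 1: "\<forall>k<n. k \<notin> S \<longrightarrow> DC n r (cube a e) (g k) \<and>
      (\<forall>x y. length x = n \<longrightarrow> length y = n \<longrightarrow> (\<forall>i\<in>S. x ! i = y ! i) \<longrightarrow> g k x = g k y)"
    and 2: "\<forall>x\<in>cube a e. x \<in> M \<longleftrightarrow> (\<forall>k<n. k \<notin> S \<longrightarrow> x ! k = g k x)" by - (elim conjE, assumption)+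
  show "length a = n" "a \<in> M" "S \<subseteq> {..<n}" "0 < e" by (fact *)+
  show "DC n r (cube a e) (g k)" if "k < n" "k \<notin> S" for k using 1 that by blast
  show "g k x = g k y" if "k < n" "k \<notin> S" "length x = n" "length y = n" "\<forall>i\<in>S. x ! i = y ! i" for k x y
    using 1 that by blast
  show "x \<in> M \<longleftrightarrow> (\<forall>k<n. k \<notin> S \<longrightarrow> x ! k = g k x)" if "x \<in> cube a e" for x using 2 that by blast
qed

lemma graph_atI:
  assumes "length a = n" "a \<in> M" "S \<subseteq> {..<n}" "0 < e"
    "\<And>k. k < n \<Longrightarrow> k \<notin> S \<Longrightarrow> DC n r (cube a e) (g k)"
    "\<And>k x y. k < n \<Longrightarrow> k \<notin> S \<Longrightarrow> length x = n \<Longrightarrow> length y = n \<Longrightarrow> \<forall>i\<in>S. x ! i = y ! i \<Longrightarrow> g k x = g k y"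
    "\<And>x. x \<in> cube a e \<Longrightarrow> x \<in> M \<longleftrightarrow> (\<forall>k<n. k \<notin> S \<longrightarrow> x ! k = g k x)"
  shows "graph_at r n M S a"
  unfolding graph_at_def local_graph_def
  by (intro conjI exI[of _ e] exI[of _ g] allI impI ballI) (fact assms | rule assms; assumption)+

lemma graph_at_cong:
  assumes G: "graph_at r n M S a" and d: "0 < d" "\<And>x. x \<in> cube a d \<Longrightarrow> x \<in> M \<longleftrightarrow> x \<in> M'"
  shows "graph_at r n M' S a"
proof -
  from G obtain e g where lg: "local_graph r n M S a e g"
    unfolding graph_at_def by blast
  note g = local_graphD[OF lg]
  have sub: "cube a (min d e) \<subseteq> cube a d" "cube a (min d e) \<subseteq> cube a e" by (intro cube_mono; simp)+
  show ?thesis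
  proof (rule graph_atI[where e = "min d e" and g = g])
    show "a \<in> M'" using d(2)[OF cube_center[OF d(1)]] g(2) by blast
    show "DC n r (cube a (min d e)) (g k)" if "k < n" "k \<notin> S" for k
      by (rule DC_subset[OF g(5)[OF that] sub(2)])
    show "g k x = g k y" if "k < n" "k \<notin> S" "length x = n" "length y = n" "\<forall>i\<in>S. x ! i = y ! i" for k x y
      by (rule g(6)[OF that])
    show "x \<in> M' \<longleftrightarrow> (\<forall>k<n. k \<notin> S \<longrightarrow> x ! k = g k x)" if "x \<in> cube a (min d e)" for x
      using d(2)[of x] g(7)[of x] that sub by blast
  qed (use g d in auto)
qed

text \<open>The equation \<open>x ! j = g j x\<close> is solved for coordinate \<open>i\<close>.
  Substituting the solution \<open>h\<close> into the other \<open>g k\<close> removes their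
  dependence on coordinate \<open>i\<close>, so \<open>j\<close> takes its place.\<close>

lemma exchange_step:
  assumes lg: "local_graph (Suc r) n M S a e g"
    and i: "i \<in> S" and j: "j < n" "j \<notin> S" and c: "has_partial (cube a e) (g j) i a c" "c \<noteq> 0"
  shows "graph_at (Suc r) n M (insert j (S - {i})) a"
proof -
  note a = local_graphD(1,2)[OF lg] and S = local_graphD(3)[OF lg] and e = local_graphD(4)[OF lg]
    and DC = local_graphD(5)[OF lg] and dep = local_graphD(6)[OF lg] and M = local_graphD(7)[OF lg]
  have CF: "cube a e \<subseteq> Fn n" using a by (auto simp: cube_def)
  have i': "i < n" "i \<noteq> j" using i S j by auto
  have aC: "a \<in> cube a e" by (rule cube_center[OF e])
  \<comment> \<open>The factor \<open>c\<close> turns the \<open>i\<close>-th derivative at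
    \<open>a\<close> into \<open>c * c\<close>, positive whatever the sign of
    \<open>c\<close>.\<close>
  define q where "q = (\<lambda>x. c * (g j x + (-1) * x ! j))"
  have q: "DC n (Suc r) (cube a e) q"
    unfolding q_def by (intro DC_add[OF CF] DC_mult[OF CF] DC_const DC_nth[OF CF] DC j)
  have q0: "q x = 0 \<longleftrightarrow> x ! j = g j x" for x using c(2) by (auto simp: q_def)
  have qa: "q a = 0" using M[OF aC] a j by (simp add: q0)
  have "tends (\<lambda>t. c * ((g j (a[i := a ! i + t]) - g j a) / t)) (c * c) (step (cube a e) i a)"
    by (intro tends_mult tends_const c(1)[unfolded has_partial_iff])
  moreover have "c * ((g j (a[i := a ! i + t]) - g j a) / t) = (q (a[i := a ! i + t]) - q a) / t" for t
    using i' by (simp add: q_def algebra_simps)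
  ultimately have qp: "has_partial (cube a e) q i a (c * c)" by (simp only: has_partial_iff)
  have cc: "0 < c * c" using c(2) by (simp add: zero_less_mult_iff) linarith
  obtain d h where h: "0 < d" "d \<le> e" "DC n (Suc r) (cube a d) h"
    "\<And>x. x \<in> cube a d \<Longrightarrow> q x = 0 \<longleftrightarrow> x ! i = h x"
    "\<And>x y. length x = n \<Longrightarrow> length y = n \<Longrightarrow> (\<And>c. q (x[i := c]) = q (y[i := c])) \<Longrightarrow> h x = h y"
    "\<And>x. x \<in> cube a d \<Longrightarrow> x[i := h x] \<in> cube a e"
    by (rule implicit_function[OF q e a(1) i'(1) qa qp cc]) (rule that, assumption, assumption, assumption, blast, blast, blast)
  let ?S = "insert j (S - {i})"
  let ?g = "\<lambda>k. if k = i then h else (\<lambda>x. g k (x[i := h x]))"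
  have agree: "x[i := u] ! l = y[i := u] ! l"
    if "length x = n" "length y = n" "\<forall>l\<in>?S. x ! l = y ! l" "l \<in> S" for x y u l
    using that i' by (cases "l = i") auto
  have hdep: "h x = h y" if xy: "length x = n" "length y = n" "\<forall>l\<in>?S. x ! l = y ! l" for x y
  proof (rule h(5)[OF xy(1,2)])
    fix u
    have "g j (x[i := u]) = g j (y[i := u])" using agree[OF xy] xy(1,2) by (intro dep[OF j]) auto
    moreover have "x ! j = y ! j" using xy(3) by simp
    ultimately show "q (x[i := u]) = q (y[i := u])" using i' by (simp add: q_def)
  qed
  show ?thesis
  proof (rule graph_atI[where e = d and g = ?g])
    show "?S \<subseteq> {..<n}" using S j by auto
    show "DC n (Suc r) (cube a d) (?g k)" if k: "k < n" "k \<notin> ?S" for k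
    proof (cases "k = i")
      case False
      then have "k \<notin> S" using k by auto
      have "DC n (Suc r) (cube a d) (\<lambda>x. g k (x[i := h x]))"
        using openF_cube[of a e] openF_cube[of a d] a(1) h(6)
        by (intro DC_subst[OF _ _ i'(1) _ DC[OF k(1) \<open>k \<notin> S\<close>] h(3)]) auto
      then show ?thesis using False by simp
    qed (use h(3) in simp)
    show "?g k x = ?g k y" if k: "k < n" "k \<notin> ?S" and xy: "length x = n" "length y = n" "\<forall>l\<in>?S. x ! l = y ! l" for k x y
    proof (cases "k = i")
      case False
      then have "k \<notin> S" using k by auto
      have "g k (x[i := h x]) = g k (y[i := h x])"
        using agree[OF xy] xy(1,2) by (intro dep[OF k(1) \<open>k \<notin> S\<close>]) auto
      then show ?thesis using False hdep[OF xy] by simp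
    qed (use hdep[OF xy] in simp)
    fix x assume x: "x \<in> cube a d"
    then have xe: "x \<in> cube a e" using cube_mono[OF h(2)] by blast
    show "x \<in> M \<longleftrightarrow> (\<forall>k<n. k \<notin> ?S \<longrightarrow> x ! k = ?g k x)"
    proof
      assume xM: "x \<in> M"
      then have eq: "x ! k = g k x" if "k < n" "k \<notin> S" for k using M[OF xe] that by blast
      have "q x = 0" using eq[OF j] by (simp add: q0)
      then have xi: "x ! i = h x" using h(4)[OF x] by blast
      then have "x[i := h x] = x" by (metis list_update_id)
      then show "\<forall>k<n. k \<notin> ?S \<longrightarrow> x ! k = ?g k x" using xi eq by auto
    next
      assume eq: "\<forall>k<n. k \<notin> ?S \<longrightarrow> x ! k = ?g k x"
      then have xi: "x ! i = h x" using i' by auto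
      then have u: "x[i := h x] = x" by (metis list_update_id)
      have "q x = 0" using h(4)[OF x] xi by blast
      then have "x ! j = g j x" by (simp add: q0)
      then have "x ! k = g k x" if "k < n" "k \<notin> S" for k
        using eq[rule_format, of k] that i u by (cases "k = j") auto
      then show "x \<in> M" using M[OF xe] by blast
    qed
  qed (use a h(1) in auto)
qed

text \<open>If each \<open>g j\<close> with \<open>j\<close> in \<open>T - S\<close> had derivative
  0 in direction \<open>i\<close>, a small step \<open>t\<close> along \<open>i\<close> within
  \<open>M\<close> would change the \<open>T\<close>-coordinates by less than a prescribed fraction
  of \<open>t\<close>, but coordinate \<open>i\<close> by \<open>t\<close> itself, against the
  Lipschitz condition. Coordinates in \<open>S \<inter> T\<close> do not move, as \<open>i\<close>
  is not in \<open>T\<close>.\<close>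

lemma exchange:
  assumes G: "graph_at (Suc r) n M S a" and d: "0 < d" and lip: "lip_on n (M \<inter> cube a d) T C"
    and T: "T \<subseteq> {..<n}" and i: "i \<in> S" "i \<notin> T"
  shows "\<exists>j\<in>T - S. graph_at (Suc r) n M (insert j (S - {i})) a"
proof (rule ccontr)
  assume neg: "\<not> ?thesis"
  from G obtain e g where lg: "local_graph (Suc r) n M S a e g"
    unfolding graph_at_def by blast
  note g = local_graphD[OF lg]
  have CF: "cube a e \<subseteq> Fn n" using g(1) by (auto simp: cube_def)
  have aC: "a \<in> cube a e" by (rule cube_center[OF g(4)])
  have ag: "a ! k = g k a" if "k < n" "k \<notin> S" for k using g(7)[OF aC] g(2) that by blast
  have i': "i < n" using i g(3) by auto
  have p: "has_partial (cube a e) (g j) i a 0" if j: "j \<in> T - S" for j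
  proof -
    have jn: "j < n" "j \<notin> S" using j T by auto
    from g(5)[OF jn] obtain c where c: "has_partial (cube a e) (g j) i a c"
      using i' aC by (elim DC_SucE) blast
    have "c = 0"
    proof (rule ccontr)
      assume "c \<noteq> 0"
      from exchange_step[OF lg i(1) jn c this] neg j show False by blast
    qed
    then show ?thesis using c by simp
  qed
  define m where "m = min d e"
  have m: "0 < m" using d g(4) by (simp add: m_def)
  \<comment> \<open>Chosen to make \<open>C * s < 1\<close> whatever the sign of
    \<open>C\<close>.\<close>
  define s where "s = inverse (\<bar>C\<bar> + 1)"
  have s: "0 < s" by (simp add: s_def add_nonneg_pos)
  have Cs: "C * s < 1"
  proof -
    have "C * s < (\<bar>C\<bar> + 1) * s" using s by (intro mult_strict_right_mono) auto
    also have "\<dots> = 1" unfolding s_def by (rule right_inverse) (use abs_ge_zero[of C] in linarith)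
    finally show ?thesis .
  qed
  let ?at = "\<lambda>t. a[i := a ! i + t]"
  have fin: "finite (T - S)" using T finite_subset by blast
  have e1: "eventually (\<lambda>t. \<forall>j\<in>T - S. \<bar>(g j (?at t) - g j a) / t - 0\<bar> < s) (step (cube a e) i a)"
    using p s by (intro eventually_ball_finite[OF fin] ballI tendsD) (simp_all add: has_partial_iff)
  have e2: "eventually (\<lambda>t. \<forall>k\<in>{..<n} - S. \<bar>g k (?at t) - g k a\<bar> < m) (step (cube a e) i a)"
    using contF_tends_step[OF CF DC_contF[OF g(5)] aC] m by (intro eventually_ball_finite ballI tendsD) auto
  note ev = eventually_conj[OF e1 eventually_conj[OF e2 eventually_step_small[OF m, of a i "cube a e"]]]
  from step_frequently[OF order_refl g(4) ev] obtain t where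
    t1: "\<And>j. j \<in> T - S \<Longrightarrow> \<bar>(g j (?at t) - g j a) / t\<bar> < s" and
    t2: "\<And>k. k < n \<Longrightarrow> k \<notin> S \<Longrightarrow> \<bar>g k (?at t) - g k a\<bar> < m" and
    t: "t \<noteq> 0" "\<bar>t\<bar> < m" by auto
  \<comment> \<open>The point of \<open>M\<close> over the \<open>S\<close>-coordinates of
    \<open>a\<close> after coordinate \<open>i\<close> has moved by \<open>t\<close>.\<close>
  define x where "x = map (\<lambda>k. if k \<in> S then ?at t ! k else g k (?at t)) [0..<n]"
  have lx: "length x = n" by (simp add: x_def)
  have xS: "x ! k = ?at t ! k" if "k \<in> S" for k using that g(3) by (auto simp: x_def)
  have xk: "x ! k = g k (?at t)" if "k < n" "k \<notin> S" for k using that by (simp add: x_def)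
  have at: "?at t ! k = (if k = i then a ! i + t else a ! k)" for k using i' g(1) by simp
  have "x \<in> cube a m" unfolding cube_def
  proof (intro CollectI conjI allI impI)
    fix k assume "k < length a"
    then have k: "k < n" using g(1) by simp
    show "\<bar>x ! k - a ! k\<bar> < m"
    proof (cases "k \<in> S")
      case True
      then show ?thesis using xS at t m by simp
    next
      case False
      then show ?thesis using t2[OF k False] xk[OF k False] ag[OF k False] by simp
    qed
  qed (use lx g(1) in simp)
  then have xd: "x \<in> cube a d" "x \<in> cube a e" using cube_mono[of m d a] cube_mono[of m e a] by (auto simp: m_def)
  have "g k x = g k (?at t)" if "k < n" "k \<notin> S" for k
    using xS lx g(1) by (intro g(6)[OF that]) auto
  then have "x \<in> M" using g(7)[OF xd(2)] xk by simp
  have "\<bar>x ! i - a ! i\<bar> \<le> C * (s * \<bar>t\<bar>)"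
  proof (rule lip_onD[OF lip])
    show "x \<in> M \<inter> cube a d" "a \<in> M \<inter> cube a d" using \<open>x \<in> M\<close> xd g(2) cube_center[OF d] by auto
    show "0 \<le> s * \<bar>t\<bar>" using s by simp
    fix l assume l: "l \<in> T"
    show "\<bar>x ! l - a ! l\<bar> \<le> s * \<bar>t\<bar>"
    proof (cases "l \<in> S")
      case True
      then have "x ! l = a ! l" using xS at l i by auto
      then show ?thesis using s by simp
    next
      case False
      have ln: "l < n" using l T by auto
      have "\<bar>g l (?at t) - g l a\<bar> / \<bar>t\<bar> < s" using t1[of l] l False by (simp add: abs_divide)
      then have "\<bar>g l (?at t) - g l a\<bar> < s * \<bar>t\<bar>" using t(1) by (simp add: pos_divide_less_eq)
      then show ?thesis using xk[OF ln False] ag[OF ln False] by simp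
    qed
  qed (rule i')
  then have "1 * \<bar>t\<bar> \<le> (C * s) * \<bar>t\<bar>" using xS[OF i(1)] at by (simp add: mult.assoc)
  moreover have "(C * s) * \<bar>t\<bar> < 1 * \<bar>t\<bar>" using Cs t(1) by (intro mult_strict_right_mono) auto
  ultimately show False by linarith
qed

text \<open>As in the Steinitz lemma, each exchange lowers the number of elements of
  \<open>S\<close> outside \<open>T\<close> by one and preserves the cardinality.\<close>

lemma exchange_into:
  assumes d: "0 < d" and lip: "lip_on n (M \<inter> cube a d) T C" and T: "T \<subseteq> {..<n}"
  shows "graph_at (Suc r) n M S a \<Longrightarrow> \<exists>S'\<subseteq>T. card S' = card S \<and> graph_at (Suc r) n M S' a"
proof (induction "card (S - T)" arbitrary: S)
  case 0
  have "finite S" using 0(2) finite_subset unfolding graph_at_def local_graph_def by blast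
  then have "S \<subseteq> T" using 0(1) by auto
  then show ?case using 0 by blast
next
  case (Suc m)
  have fin: "finite S" using Suc(3) finite_subset unfolding graph_at_def local_graph_def by blast
  obtain i where i: "i \<in> S" "i \<notin> T" using Suc(2) by (metis DiffE card.empty ex_in_conv nat.distinct(1))
  obtain j where j: "j \<in> T" "j \<notin> S" "graph_at (Suc r) n M (insert j (S - {i})) a"
    using exchange[OF Suc(3) d lip T i] by blast
  have "insert j (S - {i}) - T = (S - T) - {i}" using j by auto
  moreover have "card ((S - T) - {i}) = m" using Suc(2) i fin by (simp add: card_Diff_singleton)
  ultimately have "m = card (insert j (S - {i}) - T)" by simp
  from Suc(1)[OF this j(3)] obtain S' where "S' \<subseteq> T" "card S' = card (insert j (S - {i}))" "graph_at (Suc r) n M S' a"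
    by blast
  moreover have "card (insert j (S - {i})) = card S" using i j fin by (simp add: card_Suc_Diff1 del: card_Diff_insert)
  ultimately show ?case by auto
qed

section \<open>Lipschitz estimates for functions and graphs\<close>

lemma DC_lipschitz:
  assumes g: "DC n (Suc r) U g" and U: "openF n U" and a: "a \<in> U"
  obtains d K where "0 < d" "0 \<le> K" "cube a d \<subseteq> U"
    "\<And>x y b. x \<in> cube a d \<Longrightarrow> y \<in> cube a d \<Longrightarrow> 0 \<le> b \<Longrightarrow> \<forall>i<n. \<bar>x ! i - y ! i\<bar> \<le> b \<Longrightarrow>
      \<bar>g x - g y\<bar> \<le> K * b"
proof -
  have la: "length a = n" using U a by (auto simp: openF_def)
  from g obtain dg where dg: "def_fun n g" "contF U g"
    "\<And>i x. i < n \<Longrightarrow> x \<in> U \<Longrightarrow> has_partial U g i x (dg i x)" "\<And>i. i < n \<Longrightarrow> DC n r U (dg i)"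
    by (rule DC_SucE) blast
  obtain d where d: "0 < d" "cube a d \<subseteq> U" "\<And>i z. i \<in> {..<n} \<Longrightarrow> z \<in> cube a d \<Longrightarrow> \<bar>dg i z - dg i a\<bar> < 1"
  proof (rule contF_cube_finite[OF U a finite_lessThan _ zero_less_one, where f = dg])
    show "contF U (dg k)" if "k \<in> {..<n}" for k by (rule DC_contF[OF dg(4)]) (use that in simp)
  qed (rule that)
  define K where "K = (\<lambda>i. \<bar>dg i a\<bar> + 1)"
  have K: "0 \<le> K i" for i by (simp add: K_def)
  have step: "\<bar>g (y[i := u]) - g y\<bar> \<le> K i * \<bar>u - y ! i\<bar>"
    if "i < n" "y \<in> cube a d" "y[i := u] \<in> cube a d" for y i u
  proof -
    have "has_partial U g i x (dg i x) \<and> \<bar>dg i x - 0\<bar> < K i" if x: "x \<in> cube a d" for x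
    proof -
      have "\<bar>dg i x - dg i a\<bar> < 1" using d(3) x \<open>i < n\<close> by simp
      then have "\<bar>dg i x - 0\<bar> < K i" unfolding K_def by linarith
      then show ?thesis using dg(3)[OF \<open>i < n\<close>] x d(2) by blast
    qed
    from slope_bound[OF dg(1) that(1) la this d(2) that(2,3)] show ?thesis by simp
  qed
  show thesis
  proof (rule that[of d "\<Sum>i<n. K i"])
    show "0 \<le> (\<Sum>i<n. K i)" by (simp add: sum_nonneg K)
    fix x y and b :: 'a assume x: "x \<in> cube a d" and y: "y \<in> cube a d" and b: "0 \<le> b" "\<forall>i<n. \<bar>x ! i - y ! i\<bar> \<le> b"
    have l: "length x = n" "length y = n" using x y la by (auto simp: cube_def)
    \<comment> \<open>A path from \<open>y\<close> to \<open>x\<close> that changes one coordinate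
      at a time; it stays in the cube, and the estimates add up to the sum of the
      \<open>K i\<close>.\<close>
    let ?z = "\<lambda>m. take m x @ drop m y"
    have zc: "?z m \<in> cube a d" if "m \<le> n" for m
      using x y l la that unfolding cube_def by (auto simp: nth_append)
    have "m \<le> n \<Longrightarrow> \<bar>g (?z m) - g y\<bar> \<le> (\<Sum>i<m. K i) * b" for m
    proof (induction m)
      case (Suc m)
      have m: "m < n" using Suc.prems by simp
      have zS: "?z (Suc m) = (?z m)[m := x ! m]"
        using m l by (simp add: take_Suc_conv_app_nth list_update_append Cons_nth_drop_Suc[symmetric])
      have "?z m ! m = y ! m" using m l by (simp add: nth_append)
      then have "\<bar>g (?z (Suc m)) - g (?z m)\<bar> \<le> K m * \<bar>x ! m - y ! m\<bar>"
        using step[OF m zc[of m], of "x ! m"] zc[OF Suc.prems] m unfolding zS by simp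
      also have "\<dots> \<le> K m * b" using b(2)[rule_format, OF m] K by (rule mult_left_mono)
      finally have "\<bar>g (?z (Suc m)) - g y\<bar> \<le> K m * b + (\<Sum>i<m. K i) * b" using Suc by linarith
      then show ?case by (simp add: algebra_simps)
    qed simp
    from this[of n] show "\<bar>g x - g y\<bar> \<le> (\<Sum>i<n. K i) * b" using l by simp
  qed (use d in auto)
qed

lemma DC_lipschitz_finite:
  assumes g: "finite I" "\<And>k. k \<in> I \<Longrightarrow> DC n (Suc r) U (g k)" and U: "openF n U" "a \<in> U"
  obtains d C where "0 < d" "1 \<le> C"
    "\<And>k x y b. k \<in> I \<Longrightarrow> x \<in> cube a d \<Longrightarrow> y \<in> cube a d \<Longrightarrow> 0 \<le> b \<Longrightarrow> \<forall>i<n. \<bar>x ! i - y ! i\<bar> \<le> b \<Longrightarrow>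
      \<bar>g k x - g k y\<bar> \<le> C * b"
proof -
  have "\<exists>d K. 0 < d \<and> 0 \<le> K \<and> (\<forall>x\<in>cube a d. \<forall>y\<in>cube a d. \<forall>b\<ge>0.
     (\<forall>i<n. \<bar>x ! i - y ! i\<bar> \<le> b) \<longrightarrow> \<bar>g k x - g k y\<bar> \<le> K * b)" if k: "k \<in> I" for k
    by (rule DC_lipschitz[OF g(2)[OF k] U]) blast
  then obtain F K where F: "\<And>k. k \<in> I \<Longrightarrow> 0 < F k" "\<And>k. k \<in> I \<Longrightarrow> 0 \<le> K k"
     "\<And>k x y b. k \<in> I \<Longrightarrow> x \<in> cube a (F k) \<Longrightarrow> y \<in> cube a (F k) \<Longrightarrow> b \<ge> 0 \<Longrightarrow>
     (\<forall>i<n. \<bar>x ! i - y ! i\<bar> \<le> b) \<Longrightarrow> \<bar>g k x - g k y\<bar> \<le> K k * b" by metis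
  obtain d where d: "0 < d" "\<And>k. k \<in> I \<Longrightarrow> d \<le> F k"
    by (rule finite_min_pos[OF g(1), of F]) (use F(1) in auto)
  \<comment> \<open>Dominates every \<open>K k\<close>; the 1 gives \<open>C \<ge> 1\<close>, so
    that the constant later also covers coordinates that are bounded by \<open>b\<close>
    itself.\<close>
  define C where "C = 1 + (\<Sum>k\<in>I. K k)"
  show thesis
  proof (rule that[OF d(1), of C])
    show "1 \<le> C" unfolding C_def using sum_nonneg[of I K] F(2) by simp
    fix k x y b assume k: "k \<in> I" and xy: "x \<in> cube a d" "y \<in> cube a d"
      and b: "0 \<le> b" "\<forall>i<n. \<bar>x ! i - y ! i\<bar> \<le> b"
    have "\<bar>g k x - g k y\<bar> \<le> K k * b"
      using cube_mono[OF d(2)[OF k]] xy b by (intro F(3)[OF k]) auto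
    also have "K k \<le> C"
      unfolding C_def using member_le_sum[of k I K] F(2) g(1) k by auto
    then have "K k * b \<le> C * b" using b(1) by (rule mult_right_mono)
    finally show "\<bar>g k x - g k y\<bar> \<le> C * b" .
  qed
qed

lemma graph_at_lip:
  assumes G: "graph_at (Suc r) n M S a"
  obtains d C where "0 < d" "lip_on n (M \<inter> cube a d) S C"
proof -
  from G obtain e g where lg: "local_graph (Suc r) n M S a e g"
    unfolding graph_at_def by blast
  note g = local_graphD[OF lg]
  have U: "openF n (cube a e)" using openF_cube[of a e] g(1) by simp
  obtain d0 C where d0: "0 < d0" and C1: "1 \<le> C" and gC:
    "\<And>k x y b. k \<in> {..<n} - S \<Longrightarrow> x \<in> cube a d0 \<Longrightarrow> y \<in> cube a d0 \<Longrightarrow> 0 \<le> b \<Longrightarrow>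
      \<forall>i<n. \<bar>x ! i - y ! i\<bar> \<le> b \<Longrightarrow> \<bar>g k x - g k y\<bar> \<le> C * b"
    by (rule DC_lipschitz_finite[of "{..<n} - S" n r "cube a e" g a]) (use U g(5) cube_center[OF g(4)] in auto)
  define d where "d = min d0 e"
  have d: "0 < d" "d \<le> e" "d \<le> d0" using d0 g(4) by (auto simp: d_def)
  have "lip_on n (M \<inter> cube a d) S C" unfolding lip_on_def
  proof (intro ballI allI impI)
    fix x y b k assume x: "x \<in> M \<inter> cube a d" and y: "y \<in> M \<inter> cube a d" and b: "0 \<le> b" "\<forall>i\<in>S. \<bar>x ! i - y ! i\<bar> \<le> b"
      and k: "k < n"
    show "\<bar>x ! k - y ! k\<bar> \<le> C * b"
    proof (cases "k \<in> S")
      case True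
      have "\<bar>x ! k - y ! k\<bar> \<le> 1 * b" using b(2) True by simp
      also have "\<dots> \<le> C * b" using C1 b(1) by (rule mult_right_mono)
      finally show ?thesis .
    next
      case False
      then have k': "k \<in> {..<n} - S" using k by auto
      have l: "length x = n" "length y = n" using x y g(1) by (auto simp: cube_def)
      \<comment> \<open>Only the \<open>S\<close>-coordinates of \<open>x\<close> and
        \<open>y\<close> are known to be close. \<open>z\<close> differs from \<open>x\<close> in
        these alone, and \<open>g k\<close> cannot tell it from \<open>y\<close>.\<close>
      define z where "z = map (\<lambda>i. if i \<in> S then y ! i else x ! i) [0..<n]"
      have z: "length z = n" "\<And>i. i < n \<Longrightarrow> z ! i = (if i \<in> S then y ! i else x ! i)" by (auto simp: z_def)
      have zc: "z \<in> cube a d" using x y z g(1) unfolding cube_def by auto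
      have "g k z = g k y" using z l g(3) by (intro g(6)[OF k False]) auto
      moreover have "\<bar>g k x - g k z\<bar> \<le> C * b"
        using x zc cube_mono[OF d(3)] z b by (intro gC[OF k']) auto
      moreover have "x ! k = g k x" "y ! k = g k y" using g(7) x y cube_mono[OF d(2), of a] k False by blast+
      ultimately show ?thesis by simp
    qed
  qed
  then show thesis using d(1) that by blast
qed

end

section \<open>Discrete definable sets\<close>

text \<open>The notion of smallness: by local o-minimality a definable subset of the line without
  interior is locally finite.\<close>

definition no_interval :: "('a::linordered_field \<Rightarrow> bool) \<Rightarrow> bool" where
  "no_interval Q \<longleftrightarrow> \<not> (\<exists>l u. l < u \<and> (\<forall>x. l < x \<and> x < u \<longrightarrow> Q x))"

lemma no_interval_mono: "no_interval Q \<Longrightarrow> (\<And>x. P x \<Longrightarrow> Q x) \<Longrightarrow> no_interval P"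
  unfolding no_interval_def by blast

locale locally_o_minimal_field = def_complete +
  assumes lom: "locally_o_minimal D"
begin

text \<open>Near \<open>a\<close> only finitely many isolated points and end points occur, so the
  germ of \<open>Q\<close> to the right of \<open>a\<close> is constant. Local o-minimality enters
  the proof in this form only.\<close>

lemma right_dichotomy:
  assumes Q: "def_pred (\<lambda>\<rho>. Q (\<rho> 0))"
  shows "(\<exists>c>a. \<forall>x. a < x \<and> x < c \<longrightarrow> Q x) \<or> (\<exists>c>a. \<forall>x. a < x \<and> x < c \<longrightarrow> \<not> Q x)"
proof -
  define X where "X = {y \<in> Fn 1. Q (y ! 0)}"
  have X: "D X" unfolding X_def by (rule D_Collect) (use Q in simp)
  have QX: "[x] \<in> X \<longleftrightarrow> Q x" for x by (simp add: X_def)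
  have "X \<subseteq> Fn 1" by (auto simp: X_def)
  from lom[unfolded locally_o_minimal_def, rule_format, OF X this, of a, unfolded QX]
  obtain l u P J where lu: "l < a" "a < u" and fin: "finite P" "finite J"
    and eq: "{x. Q x \<and> l < x \<and> x < u} = P \<union> (\<Union>(c, e)\<in>J. {c<..<e})" by blast
  show ?thesis
  proof (cases "\<exists>(c, e)\<in>J. c \<le> a \<and> a < e")
    case True
    then obtain c e where ce: "(c, e) \<in> J" "c \<le> a" "a < e" by blast
    have "Q x" if "a < x" "x < e" for x
    proof -
      have "x \<in> {c<..<e}" using that ce by auto
      then have "x \<in> {x. Q x \<and> l < x \<and> x < u}" unfolding eq using ce(1) by blast
      then show ?thesis by simp
    qed
    then show ?thesis using ce(3) by blast
  next
    case False
    \<comment> \<open>As no interval of \<open>J\<close> covers the points just right of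
      \<open>a\<close>, \<open>Q\<close> can begin only at an isolated point or a left end point;
      \<open>c\<close> is the least of these and \<open>u\<close> beyond \<open>a\<close>.\<close>
    define B where "B = insert u (P \<union> fst ` J)"
    have B: "finite {b \<in> B. a < b}" "{b \<in> B. a < b} \<noteq> {}" using fin lu by (auto simp: B_def)
    define c where "c = Min {b \<in> B. a < b}"
    have c: "a < c" "\<And>b. b \<in> B \<Longrightarrow> a < b \<Longrightarrow> c \<le> b"
      using Min_in[OF B] Min_le[OF B(1)] by (auto simp: c_def)
    have "\<not> Q x" if x: "a < x" "x < c" for x
    proof
      assume "Q x"
      have "c \<le> u" using lu by (intro c(2)) (auto simp: B_def)
      then have "x \<in> {x. Q x \<and> l < x \<and> x < u}" using x lu \<open>Q x\<close> by simp
      then consider "x \<in> P" | c' e where "(c', e) \<in> J" "c' < x" "x < e" unfolding eq by auto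
      then show False
      proof cases
        case 1
        then have "c \<le> x" using x by (intro c(2)) (auto simp: B_def)
        then show ?thesis using x by simp
      next
        case 2
        have "a < c'" using False 2 x by force
        moreover have "c' \<in> B" using 2(1) by (force simp: B_def)
        ultimately have "c \<le> c'" by (intro c(2))
        then show ?thesis using 2 x by simp
      qed
    qed
    then show ?thesis using c(1) by blast
  qed
qed

lemma no_interval_right:
  assumes Q: "def_pred (\<lambda>\<rho>. Q (\<rho> 0))" and n: "no_interval Q"
  obtains c where "a < c" "\<forall>x. a < x \<and> x < c \<longrightarrow> \<not> Q x"
  using right_dichotomy[OF Q, of a] n unfolding no_interval_def by blast

text \<open>Definability matters: just right of the left end both predicates fail, whereas two
  arbitrary sets without interior may fill an interval.\<close>

lemma no_interval_disj:
  assumes P: "def_pred (\<lambda>\<rho>. P (\<rho> 0))" "no_interval P" and Q: "def_pred (\<lambda>\<rho>. Q (\<rho> 0))" "no_interval Q"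
  shows "no_interval (\<lambda>x. P x \<or> Q x)"
  unfolding no_interval_def
proof
  assume "\<exists>l u. l < u \<and> (\<forall>x. l < x \<and> x < u \<longrightarrow> P x \<or> Q x)"
  then obtain l u where lu: "l < u" "\<forall>x. l < x \<and> x < u \<longrightarrow> P x \<or> Q x" by blast
  obtain c where c: "l < c" "\<forall>x. l < x \<and> x < c \<longrightarrow> \<not> P x" by (rule no_interval_right[OF P])
  obtain d where d: "l < d" "\<forall>x. l < x \<and> x < d \<longrightarrow> \<not> Q x" by (rule no_interval_right[OF Q])
  obtain x where "l < x" "x < min u (min c d)" using dense[of l "min u (min c d)"] lu(1) c(1) d(1) by auto
  then have "l < x" "x < u" "x < c" "x < d" by simp_all
  then show False using lu(2) c(2) d(2) by blast
qed

lemma no_interval_increasing_union: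
  assumes A: "def_pred (\<lambda>\<rho>. A (\<rho> 0) (\<rho> (Suc 0)))"
    and anti: "\<And>s t x. 0 < s \<Longrightarrow> s \<le> t \<Longrightarrow> A t x \<Longrightarrow> A s x"
    and n: "\<And>s. 0 < s \<Longrightarrow> no_interval (A s)"
  shows "no_interval (\<lambda>x. \<exists>s>0. A s x)"
  unfolding no_interval_def
proof
  assume "\<exists>a b. a < b \<and> (\<forall>x. a < x \<and> x < b \<longrightarrow> (\<exists>s>0. A s x))"
  then obtain a b where ab: "a < b" "\<And>x. a < x \<Longrightarrow> x < b \<Longrightarrow> \<exists>s>0. A s x" by blast
  text \<open>The elements of the interval which are the least ones in some \<open>A s\<close> accumulate at \<open>a\<close>,
    hence fill an interval; \<open>s\<close> is a strictly increasing function of them.\<close>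
  define M where "M = (\<lambda>x. a < x \<and> x < b \<and> (\<exists>s. 0 < s \<and> A s x \<and> (\<forall>y. a < y \<and> y < x \<longrightarrow> \<not> A s y)))"
  have Aij: "def_pred (\<lambda>\<rho>. A (\<rho> i) (\<rho> j))" for i j
    using def_pred_subst[OF A, of "\<lambda>k. if k = 0 then i else j"] by simp
  have A1: "def_pred (\<lambda>\<rho>. A s (\<rho> j))" for s j
    by (rule def_pred_term[OF def_term_const[of s]]) (rule Aij)
  have M: "def_pred (\<lambda>\<rho>. M (\<rho> 0))" unfolding M_def by (intro def_intros Aij)
  have M_right: "\<exists>x. a < x \<and> x < c \<and> M x" if ac: "a < c" for c
  proof -
    obtain c' where c': "a < c'" "c' < min c b" using dense[of a "min c b"] ac ab(1) by auto
    then obtain s where s: "s > 0" "A s c'" using ab(2)[of c'] by auto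
    let ?Q = "\<lambda>x. a < x \<and> x < b \<and> A s x"
    have Q: "def_pred (\<lambda>\<rho>. ?Q (\<rho> 0))" by (intro def_intros A1)
    from inf_exists[OF Q, of c' a] c' s(2) obtain m where
      m: "\<And>x. ?Q x \<Longrightarrow> m \<le> x" "\<And>t. (\<forall>x. ?Q x \<longrightarrow> t \<le> x) \<Longrightarrow> t \<le> m" by auto
    have "a \<le> m" by (rule m(2)) simp
    have "m \<le> c'" by (rule m(1)) (use c' s in simp)
    have "no_interval ?Q" by (rule no_interval_mono[OF n[OF s(1)]]) simp
    then obtain d where d: "m < d" "\<forall>x. m < x \<and> x < d \<longrightarrow> \<not> ?Q x" by (rule no_interval_right[OF Q])
    \<comment> \<open>The infimum is attained: \<open>?Q\<close> is empty just right of
      \<open>m\<close>, so otherwise \<open>d\<close> would be a larger lower bound.\<close>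
    have Qm: "?Q m"
    proof (rule ccontr)
      assume nQ: "\<not> ?Q m"
      have "d \<le> x" if "?Q x" for x
      proof (rule ccontr)
        assume "\<not> d \<le> x"
        moreover have "m \<noteq> x" using that nQ by blast
        then have "m < x" using m(1)[OF that] by simp
        ultimately show False using d(2)[rule_format, of x] that by simp
      qed
      then have "d \<le> m" by (intro m(2)) blast
      then show False using d(1) by simp
    qed
    have "M m" unfolding M_def
    proof (intro conjI exI[of _ s] allI impI notI)
      fix y assume y: "a < y \<and> y < m" "A s y"
      then have "?Q y" using Qm by simp
      from m(1)[OF this] y(1) show False by simp
    qed (use Qm s(1) in auto)
    then show ?thesis using Qm \<open>m \<le> c'\<close> c' by (intro exI[of _ m]) simp
  qed
  obtain c where c: "a < c" "\<And>x. a < x \<Longrightarrow> x < c \<Longrightarrow> M x"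
    using right_dichotomy[OF M, of a] M_right by blast
  obtain x where x: "a < x" "x < c" using dense[OF c(1)] by blast
  then obtain s where s: "s > 0" "A s x" using c(2)[OF x] by (auto simp: M_def)
  \<comment> \<open>\<open>y\<close> is missing from \<open>A s\<close>, yet it is least in some
    \<open>A t\<close>, which therefore misses \<open>x\<close>. Whichever of \<open>s\<close> and
    \<open>t\<close> is smaller, monotonicity is violated.\<close>
  obtain y where y: "x < y" "y < c" "\<not> A s y" using n[OF s(1)] x(2) unfolding no_interval_def by blast
  have "M y" using c(2)[of y] x y by simp
  then obtain t where t: "t > 0" "A t y" "\<not> A t x" using x y by (auto simp: M_def)
  show False
  proof (cases "t \<le> s")
    case True
    then show ?thesis using anti[OF t(1) True s(2)] t(3) by simp
  next
    case False
    then show ?thesis using anti[OF s(1) _ t(2)] y(3) by simp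
  qed
qed

lemma def_vec_Cons:
  assumes "def_term t" "def_vec n v" shows "def_vec (Suc n) (\<lambda>\<rho>. t \<rho> # v \<rho>)"
  using def_vec_append[OF def_vec_single[OF assms(1)] assms(2)] by simp

text \<open>The first coordinate is swept by real induction: a strip of width less than \<open>s\<close> remains separated
  when this coordinate is dropped.\<close>

lemma no_interval_separated:
  assumes s: "0 < s"
  shows "D G \<Longrightarrow> G \<subseteq> Fn (Suc n) \<Longrightarrow> (\<And>y i. y \<in> G \<Longrightarrow> i < n \<Longrightarrow> \<bar>y ! i\<bar> \<le> b) \<Longrightarrow>
    (\<And>y z. y \<in> G \<Longrightarrow> z \<in> G \<Longrightarrow> (\<forall>i<n. \<bar>y ! i - z ! i\<bar> < s) \<Longrightarrow> y = z) \<Longrightarrow>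
    no_interval (\<lambda>v. \<exists>y\<in>G. y ! n = v)"
proof (induction n arbitrary: G)
  case 0
  have eq: "y = z" if "y \<in> G" "z \<in> G" for y z using 0(4)[OF that] by simp
  show ?case unfolding no_interval_def
  proof
    assume "\<exists>l u. l < u \<and> (\<forall>x. l < x \<and> x < u \<longrightarrow> (\<exists>y\<in>G. y ! 0 = x))"
    then obtain l u where lu: "l < u" "\<forall>x. l < x \<and> x < u \<longrightarrow> (\<exists>y\<in>G. y ! 0 = x)" by blast
    obtain v where v: "l < v" "v < u" using dense[OF lu(1)] by blast
    obtain w where w: "l < w" "w < v" using dense[OF v(1)] by blast
    have "l < v \<and> v < u" "l < w \<and> w < u" using v w by auto
    then obtain y z where yz: "y \<in> G" "y ! 0 = v" "z \<in> G" "z ! 0 = w" using lu(2) by blast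
    then have "y = z" by (intro eq)
    then show False using yz w by simp
  qed
next
  case (Suc n)
  define P where "P = (\<lambda>t. no_interval (\<lambda>v. \<exists>y\<in>Fn (Suc (Suc n)). y \<in> G \<and> y ! 0 \<le> t \<and> y ! Suc n = v))"
  have part: "def_pred (\<lambda>\<rho>. \<exists>y\<in>Fn (Suc (Suc n)). y \<in> G \<and> y ! 0 \<le> t \<and> y ! Suc n = \<rho> 0)" for t
    by (intro def_pred_ex_vec def_intros def_pred_in[OF Suc(2,3)] def_term_nth[OF def_vec_take_map]) simp_all
  have dP: "def_pred (\<lambda>\<rho>. P (\<rho> 0))" unfolding P_def no_interval_def
    by (intro def_pred_ex_vec def_intros def_pred_in[OF Suc(2,3)] def_term_nth[OF def_vec_take_map]) simp_all
  have adv: "P t" if t': "P t'" "t' < t" "t < t' + s" for t t'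
  proof -
    define H where "H = {z \<in> Fn (Suc n). \<exists>a. a # z \<in> G \<and> t' < a \<and> a \<le> t}"
    have H: "D H" unfolding H_def
      by (rule D_Collect) (intro def_intros def_pred_in[OF Suc(2,3)] def_vec_Cons)
    have HF: "H \<subseteq> Fn (Suc n)" by (auto simp: H_def)
    have Hn: "no_interval (\<lambda>v. \<exists>z\<in>H. z ! n = v)"
    proof (rule Suc.IH[OF H HF])
      show "\<bar>z ! i\<bar> \<le> b" if zi: "z \<in> H" "i < n" for z i
      proof -
        obtain a where "a # z \<in> G" using zi(1) by (auto simp: H_def)
        from Suc.prems(3)[OF this, of "Suc i"] zi(2) show ?thesis by simp
      qed
      fix y z assume yz: "y \<in> H" "z \<in> H" "\<forall>i<n. \<bar>y ! i - z ! i\<bar> < s"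
      obtain a where a: "a # y \<in> G" "t' < a" "a \<le> t" using yz(1) by (auto simp: H_def)
      obtain c where c: "c # z \<in> G" "t' < c" "c \<le> t" using yz(2) by (auto simp: H_def)
      have "\<bar>(a # y) ! i - (c # z) ! i\<bar> < s" if "i < Suc n" for i
      proof (cases i)
        case 0
        have "\<bar>a - c\<bar> < s" using a c t' by linarith
        then show ?thesis using 0 by simp
      next
        case (Suc k)
        then show ?thesis using yz(3) that by simp
      qed
      then have "a # y = c # z" using Suc.prems(4)[OF a(1) c(1)] by blast
      then show "y = z" by simp
    qed
    have dH: "def_pred (\<lambda>\<rho>. \<exists>z\<in>Fn (Suc n). z \<in> H \<and> z ! n = \<rho> 0)"
      by (intro def_pred_ex_vec def_intros def_pred_in[OF H HF] def_term_nth[OF def_vec_take_map]) simp_all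
    have Hn': "no_interval (\<lambda>v. \<exists>z\<in>Fn (Suc n). z \<in> H \<and> z ! n = v)"
      by (rule no_interval_mono[OF Hn]) blast
    show ?thesis unfolding P_def
    proof (rule no_interval_mono[OF no_interval_disj[OF part t'(1)[unfolded P_def] dH Hn']])
      fix v assume "\<exists>y\<in>Fn (Suc (Suc n)). y \<in> G \<and> y ! 0 \<le> t \<and> y ! Suc n = v"
      then obtain y where y: "length y = Suc (Suc n)" "y \<in> G" "y ! 0 \<le> t" "y ! Suc n = v" by auto
      then obtain a z where az: "y = a # z" "length z = Suc n" by (auto simp: length_Suc_conv)
      show "(\<exists>y\<in>Fn (Suc (Suc n)). y \<in> G \<and> y ! 0 \<le> t' \<and> y ! Suc n = v) \<or> (\<exists>z\<in>Fn (Suc n). z \<in> H \<and> z ! n = v)"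
      proof (cases "a \<le> t'")
        case True
        then have "y \<in> Fn (Suc (Suc n)) \<and> y \<in> G \<and> y ! 0 \<le> t' \<and> y ! Suc n = v" using y az by simp
        then show ?thesis by blast
      next
        case False
        then have "z \<in> Fn (Suc n) \<and> z \<in> H \<and> z ! n = v" using y az by (auto simp: H_def)
        then show ?thesis by blast
      qed
    qed
  qed
  \<comment> \<open>First coordinates are at least \<open>- b\<close>, so the sweep starts where no
    point of \<open>G\<close> has been met.\<close>
  have base: "P (- b - 1)"
  proof -
    have "\<not> y ! 0 \<le> - b - 1" if "y \<in> G" for y
      using Suc.prems(3)[OF that, of 0] by (simp add: abs_le_iff)
    then have no: "\<not> (\<exists>y\<in>Fn (Suc (Suc n)). y \<in> G \<and> y ! 0 \<le> - b - 1 \<and> y ! Suc n = v)" for v by blast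
    show ?thesis unfolding P_def no_interval_def
    proof
      assume "\<exists>l u. l < u \<and> (\<forall>v. l < v \<and> v < u \<longrightarrow> (\<exists>y\<in>Fn (Suc (Suc n)). y \<in> G \<and> y ! 0 \<le> - b - 1 \<and> y ! Suc n = v))"
      then obtain l u where lu: "l < u"
        "\<forall>v. l < v \<and> v < u \<longrightarrow> (\<exists>y\<in>Fn (Suc (Suc n)). y \<in> G \<and> y ! 0 \<le> - b - 1 \<and> y ! Suc n = v)" by blast
      obtain v where v: "l < v \<and> v < u" using dense[OF lu(1)] by blast
      have "\<exists>y\<in>Fn (Suc (Suc n)). y \<in> G \<and> y ! 0 \<le> - b - 1 \<and> y ! Suc n = v" by (rule lu(2)[rule_format, OF v])
      with no[of v] show False by (rule notE)
    qed
  qed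
  have P: "P t" if "- b - 1 \<le> t" for t
  proof (rule real_induction[where P = P and a = "- b - 1" and b = t, OF dP base])
    fix w assume w: "- b - 1 \<le> w" and Pw: "\<And>u. - b - 1 \<le> u \<Longrightarrow> u \<le> w \<Longrightarrow> P u"
    have "P w" by (rule Pw[OF w order_refl])
    then have "P v" if "w < v" "v < w + s" for v using adv that by blast
    then show "\<exists>u>w. \<forall>v. w < v \<and> v < u \<and> v \<le> t \<longrightarrow> P v"
      using s by (intro exI[of _ "w + s"]) simp
  next
    fix w assume w: "- b - 1 < w" and Pw: "\<And>u. - b - 1 \<le> u \<Longrightarrow> u < w \<Longrightarrow> P u"
    obtain u where u: "max (- b - 1) (w - s) < u" "u < w" using dense[of "max (- b - 1) (w - s)" w] w s by auto
    have "P u" by (rule Pw) (use u in auto)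
    moreover have "w < u + s" using u by (simp add: algebra_simps)
    ultimately show "P w" using adv u(2) by blast
  qed (use that in auto)
  \<comment> \<open>The sweep covers only \<open>t\<close> from \<open>- b - 1\<close> upwards, and
    \<open>b\<close>, not assumed positive, may lie below that.\<close>
  define B where "B = max b (- b - 1)"
  have "P B" by (rule P) (simp add: B_def)
  then show ?case unfolding P_def
  proof (rule no_interval_mono)
    fix v assume "\<exists>y\<in>G. y ! Suc n = v"
    then obtain y where y: "y \<in> G" "y ! Suc n = v" by blast
    have "y ! 0 \<le> B" using Suc.prems(3)[OF y(1), of 0] by (simp add: B_def abs_le_iff)
    then show "\<exists>y\<in>Fn (Suc (Suc n)). y \<in> G \<and> y ! 0 \<le> B \<and> y ! Suc n = v" using y Suc.prems(2) by blast
  qed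
qed

text \<open>Let \<open>rho z\<close> be the supremum of the admissible radii in
  \<open>(0, 1]\<close>. \<open>Z\<close> is exhausted by bounded separated pieces; over each of
  them the values of \<open>rho\<close> contain no interval, and neither does their increasing
  union. Being positive, these values therefore avoid some \<open>(0, u)\<close>, which replaces a
  minimum over the possibly infinite \<open>Z\<close>.\<close>

lemma uniform_radius:
  assumes Z: "D Z" "Z \<subseteq> Fn n"
    and discrete: "\<And>z. z \<in> Z \<Longrightarrow> \<exists>e>0. \<forall>z'\<in>Z. z' \<in> cube z e \<longrightarrow> z' = z"
    and R: "\<And>v t. def_vec n v \<Longrightarrow> def_term t \<Longrightarrow> def_pred (\<lambda>\<rho>. R (v \<rho>) (t \<rho>))"
    and mono: "\<And>z e e'. z \<in> Z \<Longrightarrow> R z e \<Longrightarrow> 0 < e' \<Longrightarrow> e' \<le> e \<Longrightarrow> R z e'"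
    and ex: "\<And>z. z \<in> Z \<Longrightarrow> \<exists>e>0. R z e"
  shows "\<exists>e>0. \<forall>z\<in>Z. R z e"
proof -
  \<comment> \<open>Least upper bound as a relation in \<open>z\<close> and \<open>v\<close>; the
    cut at 1 keeps the radii bounded.\<close>
  define rho where "rho = (\<lambda>z v. (\<forall>e. 0 < e \<and> e \<le> 1 \<and> R z e \<longrightarrow> e \<le> v) \<and>
    (\<forall>w. (\<forall>e. 0 < e \<and> e \<le> 1 \<and> R z e \<longrightarrow> e \<le> w) \<longrightarrow> v \<le> w))"
  have rho_unique: "v = w" if "rho z v" "rho z w" for z v w
    using that unfolding rho_def by (intro order_antisym) blast+
  have rho_ex: "\<exists>v. rho z v" if z: "z \<in> Z" for z
  proof -
    obtain e where e: "e > 0" "R z e" using ex[OF z] by blast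
    have "0 < min e 1 \<and> min e 1 \<le> 1 \<and> R z (min e 1)" using mono[OF z e(2), of "min e 1"] e(1) by simp
    moreover have "def_vec n (\<lambda>\<rho>. z)" using Z(2) z by (intro def_vec_const) auto
    then have "def_pred (\<lambda>\<rho>. 0 < \<rho> 0 \<and> \<rho> 0 \<le> 1 \<and> R z (\<rho> 0))" by (intro def_intros R)
    ultimately show ?thesis unfolding rho_def
      using sup_exists[of "\<lambda>e. 0 < e \<and> e \<le> 1 \<and> R z e" "min e 1" 1] by blast
  qed
  have rho: "def_pred (\<lambda>\<rho>. rho (v \<rho>) (t \<rho>))" if v: "def_vec n v" and t: "def_term t" for v t
    unfolding rho_def by (intro def_intros R def_vec_subst[OF v] def_term_subst[OF t])
  \<comment> \<open>The piece of \<open>Z\<close> with parameter \<open>s\<close>: points isolated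
    by distance \<open>s\<close> whose coordinates are at most \<open>1 / s\<close> in size. The
    pieces grow as \<open>s\<close> decreases.\<close>
  define B where "B = (\<lambda>z s. z \<in> Z \<and> (\<forall>i<n. \<bar>z ! i\<bar> * s \<le> 1) \<and>
    (\<forall>z'\<in>Fn n. z' \<in> Z \<and> (\<forall>i<n. \<bar>z' ! i - z ! i\<bar> < s) \<longrightarrow> (\<forall>i<n. z' ! i = z ! i)))"
  have BI: "B z s" if "z \<in> Z" "\<And>i. i < n \<Longrightarrow> \<bar>z ! i\<bar> * s \<le> 1"
    "\<And>z'. length z' = n \<Longrightarrow> z' \<in> Z \<Longrightarrow> \<forall>i<n. \<bar>z' ! i - z ! i\<bar> < s \<Longrightarrow> \<forall>i<n. z' ! i = z ! i" for z s
    unfolding B_def Ball_def Fn_iff using that by blast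
  have BD: "z \<in> Z" "\<And>i. i < n \<Longrightarrow> \<bar>z ! i\<bar> * s \<le> 1"
    "\<And>z'. length z' = n \<Longrightarrow> z' \<in> Z \<Longrightarrow> \<forall>i<n. \<bar>z' ! i - z ! i\<bar> < s \<Longrightarrow> \<forall>i<n. z' ! i = z ! i"
    if "B z s" for z s
    using that unfolding B_def Ball_def Fn_iff by blast+
  have B: "def_pred (\<lambda>\<rho>. B (v \<rho>) (t \<rho>))" if v: "def_vec n v" and t: "def_term t" for v t
    unfolding B_def
    by (intro def_intros def_pred_all_vec def_pred_in[OF Z] def_vec_subst[OF v] def_term_subst[OF t] v t
        def_term_nth[OF v] def_term_nth[OF def_vec_subst[OF v]] def_term_nth[OF def_vec_take_map])
  define A where "A = (\<lambda>s v. \<exists>z\<in>Fn n. B z s \<and> rho z v)"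
  have "no_interval (\<lambda>v. \<exists>s>0. A s v)"
  proof (rule no_interval_increasing_union)
    show "def_pred (\<lambda>\<rho>. A (\<rho> 0) (\<rho> (Suc 0)))" unfolding A_def
      by (intro def_pred_ex_vec def_intros B rho)
    show "A s v" if st: "0 < s" "s \<le> t" "A t v" for s t v
    proof -
      obtain z where z: "length z = n" "B z t" "rho z v" using st(3) by (auto simp: A_def)
      have "\<bar>z ! i\<bar> * s \<le> 1" if "i < n" for i
      proof -
        have "\<bar>z ! i\<bar> * s \<le> \<bar>z ! i\<bar> * t" using st(2) by (rule mult_left_mono) simp
        also have "\<dots> \<le> 1" by (rule BD(2)[OF z(2) that])
        finally show ?thesis .
      qed
      moreover have "\<forall>i<n. z' ! i = z ! i" if "length z' = n" "z' \<in> Z" "\<forall>i<n. \<bar>z' ! i - z ! i\<bar> < s" for z'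
      proof -
        have "\<forall>i<n. \<bar>z' ! i - z ! i\<bar> < t" using that(3) st(2) by force
        then show ?thesis by (rule BD(3)[OF z(2) that(1,2)])
      qed
      ultimately have "B z s" by (intro BI BD(1)[OF z(2)])
      then show ?thesis using z unfolding A_def by auto
    qed
    fix s :: 'a assume s: "0 < s"
    let ?z = "\<lambda>y. map (\<lambda>i. y ! i) [0..<n]"
    \<comment> \<open>The graph of \<open>rho\<close> over one piece. Points whose first
      \<open>n\<close> coordinates are \<open>s\<close>-close coincide, which is the separation that
      \<open>no_interval_separated\<close> asks for.\<close>
    define G where "G = {y \<in> Fn (Suc n). B (?z y) s \<and> rho (?z y) (y ! n)}"
    have mm: "?z (map \<rho> [0..<Suc n]) = map \<rho> [0..<n]" "map \<rho> [0..<Suc n] ! n = \<rho> n" for \<rho> :: "nat \<Rightarrow> 'a"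
      by (simp_all add: nth_append del: upt_Suc)
    have G: "D G" unfolding G_def
      by (rule D_Collect, unfold mm) (intro def_intros B rho)
    have zi: "?z y = z \<Longrightarrow> i < n \<Longrightarrow> y ! i = z ! i" for y z :: "'a list" and i by auto
    have "no_interval (\<lambda>v. \<exists>y\<in>G. y ! n = v)"
    proof (rule no_interval_separated[OF s G])
      show "G \<subseteq> Fn (Suc n)" by (auto simp: G_def)
      show "\<bar>y ! i\<bar> \<le> 1 / s" if "y \<in> G" "i < n" for y i
        using that s BD(2)[of "?z y" s i] by (simp add: G_def pos_le_divide_eq)
      fix y w assume yw: "y \<in> G" "w \<in> G" "\<forall>i<n. \<bar>y ! i - w ! i\<bar> < s"
      have By: "B (?z y) s" "rho (?z y) (y ! n)" "B (?z w) s" "rho (?z w) (w ! n)" using yw by (simp_all add: G_def)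
      have "\<forall>i<n. ?z y ! i = ?z w ! i"
        by (rule BD(3)[OF By(3) _ BD(1)[OF By(1)]]) (use yw(3) in simp_all)
      then have zz: "?z y = ?z w" by simp
      have "y ! n = w ! n" using rho_unique[OF By(2)] By(4) zz by simp
      then have "\<forall>i<Suc n. y ! i = w ! i" using zz by (simp add: less_Suc_eq)
      then show "y = w" using yw(1,2) by (intro nth_equalityI) (auto simp: G_def)
    qed
    then show "no_interval (A s)"
    proof (rule no_interval_mono)
      fix v assume "A s v"
      then obtain z where z: "length z = n" "B z s" "rho z v" by (auto simp: A_def)
      have "?z (z @ [v]) = z" using z(1) by (intro nth_equalityI) (auto simp: nth_append)
      moreover have "(z @ [v]) ! n = v" using z(1) by (simp add: nth_append)
      ultimately have "z @ [v] \<in> G" using z by (simp add: G_def)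
      then show "\<exists>y\<in>G. y ! n = v" using z(1) by (intro bexI[of _ "z @ [v]"]) auto
    qed
  qed
  moreover have "def_pred (\<lambda>\<rho>. \<exists>s>0. A s (\<rho> 0))" unfolding A_def
    by (intro def_intros def_pred_ex_vec B rho)
  ultimately obtain u where u: "0 < u" "\<forall>v. 0 < v \<and> v < u \<longrightarrow> \<not> (\<exists>s>0. A s v)"
    using no_interval_right[of "\<lambda>v. \<exists>s>0. A s v" 0] by blast
  \<comment> \<open>Half of \<open>u\<close> leaves room for a supremum that is not
    attained.\<close>
  have "R z (u / 2)" if z: "z \<in> Z" for z
  proof -
    obtain v where v: "rho z v" using rho_ex[OF z] by blast
    have lz: "length z = n" using z Z(2) by auto
    obtain e where e: "e > 0" "R z e" using ex[OF z] by blast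
    have "min e 1 \<le> v" using v mono[OF z e(2), of "min e 1"] e(1) unfolding rho_def by simp
    then have v0: "0 < v" using e(1) by auto
    obtain r where r: "r > 0" "\<forall>z'\<in>Z. z' \<in> cube z r \<longrightarrow> z' = z" using discrete[OF z] by blast
    \<comment> \<open>Bounds all coordinates of \<open>z\<close>; with \<open>s\<close> at most
      \<open>1 / K\<close> and at most the isolation radius \<open>r\<close>, the point lies in the
      piece of parameter \<open>s\<close>.\<close>
    define K where "K = 1 + (\<Sum>i<n. \<bar>z ! i\<bar>)"
    have K: "K > 0" unfolding K_def by (simp add: add_pos_nonneg sum_nonneg)
    define s where "s = min r (inverse K)"
    have s: "s > 0" "s \<le> r" "s \<le> inverse K" using r(1) K by (auto simp: s_def)
    have "\<bar>z ! i\<bar> * s \<le> 1" if "i < n" for i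
    proof -
      have "\<bar>z ! i\<bar> \<le> (\<Sum>i<n. \<bar>z ! i\<bar>)" using that by (intro member_le_sum) auto
      then have "\<bar>z ! i\<bar> \<le> K" unfolding K_def by linarith
      then have "\<bar>z ! i\<bar> * s \<le> K * inverse K" using s K by (intro mult_mono) auto
      then show ?thesis using K by simp
    qed
    moreover have "z' = z" if "length z' = n" "z' \<in> Z" "\<forall>i<n. \<bar>z' ! i - z ! i\<bar> < s" for z'
    proof -
      have "z' \<in> cube z r" using that lz s(2) by (auto simp: cube_def intro: less_le_trans)
      then show ?thesis using r(2) that(2) by blast
    qed
    ultimately have "B z s" by (intro BI z) blast+
    then have "A s v" using v lz unfolding A_def by auto
    then have "\<not> v < u" using u(2) v0 s(1) by blast
    then have "u \<le> v" by simp
    have "u / 2 < u" using u(1) by simp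
    have "\<exists>e. 0 < e \<and> e \<le> 1 \<and> R z e \<and> u / 2 < e"
    proof (rule ccontr)
      assume "\<not> ?thesis"
      then have "\<forall>e. 0 < e \<and> e \<le> 1 \<and> R z e \<longrightarrow> e \<le> u / 2" using not_less by blast
      then have "v \<le> u / 2" using v unfolding rho_def by blast
      then show False using \<open>u \<le> v\<close> \<open>u / 2 < u\<close> by simp
    qed
    then obtain e' where "R z e'" "u / 2 < e'" by blast
    then show ?thesis using mono[OF z, of e' "u / 2"] u(1) by simp
  qed
  then show ?thesis using u(1) by (intro exI[of _ "u / 2"]) simp
qed

end

section \<open>Submanifolds\<close>

context def_complete
begin

lemma def_fun_component:
  assumes f: "definable_map D V f" and V: "D V" "V \<subseteq> Fn n" and m: "\<And>x. x \<in> V \<Longrightarrow> length (f x) = m" and j: "j < m"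
  shows "def_fun n (\<lambda>x. if x \<in> V then f x ! j else 0)"
proof -
  define W where "W = {x @ f x | x. x \<in> V}"
  have W: "D W" using f by (simp add: W_def definable_map_def)
  have WF: "W \<subseteq> Fn (n + m)" using V(2) m by (auto simp: W_def)
  show ?thesis
  proof (rule def_funI, rule def_termI[where Q = "\<lambda>\<rho> a. (\<exists>w\<in>Fn m. map \<rho> [0..<n] @ w \<in> W \<and> a = w ! j) \<or>
      (map \<rho> [0..<n] \<notin> V \<and> a = 0)"])
    show "def_pred (\<lambda>\<rho>. (\<exists>w\<in>Fn m. map (\<lambda>i. \<rho> (Suc i)) [0..<n] @ w \<in> W \<and> \<rho> 0 = w ! j) \<or>
      (map (\<lambda>i. \<rho> (Suc i)) [0..<n] \<notin> V \<and> \<rho> 0 = 0))"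
      by (intro def_pred_ex_vec def_intros def_pred_in[OF W WF] def_pred_in[OF V] def_vec_append
          def_term_nth[OF def_vec_take_map j])
    fix \<rho> :: "nat \<Rightarrow> 'a" and a
    let ?x = "map \<rho> [0..<n]"
    have 1: "?x @ w \<in> W \<longleftrightarrow> ?x \<in> V \<and> w = f ?x" for w
      unfolding W_def using V(2) by auto
    show "(\<exists>w\<in>Fn m. ?x @ w \<in> W \<and> a = w ! j) \<or> (?x \<notin> V \<and> a = 0) \<longleftrightarrow> a = (if ?x \<in> V then f ?x ! j else 0)"
      unfolding 1 using m[of ?x] by (cases "?x \<in> V") auto
  qed
qed

lemma DC_component:
  assumes f: "Dr_map D n m r V f" and V: "D V" "openF n V" and j: "j < m"
  shows "DC n r V (\<lambda>x. if x \<in> V then f x ! j else 0)"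
proof (rule Cr_imp_DC[OF V])
  have "V \<subseteq> Fn n" using V by (simp add: openF_def)
  then show "def_fun n (\<lambda>x. if x \<in> V then f x ! j else 0)"
    using f j by (intro def_fun_component[OF _ V(1)]) (auto simp: Dr_map_def)
  have "Cr n r V (\<lambda>x. f x ! j)" using f j by (simp add: Dr_map_def)
  then show "Cr n r V (\<lambda>x. if x \<in> V then f x ! j else 0)" by (rule Cr_cong) simp
qed

text \<open>The graph of a chart, read as a subset of \<open>F^2n\<close>, is a graph over the first \<open>d\<close> chart coordinates.
  Since the chart is Lipschitz, these can be exchanged for coordinates of the submanifold itself.\<close>

lemma chart_graph_at:
  assumes U: "D U" "openF n U" "a \<in> U" and V: "D V" "openF n V" "replicate n 0 \<in> V"
    and f: "Dr_map D n n (Suc r) U \<phi>" "\<phi> ` U = V" and h: "Dr_map D n n (Suc r) V \<psi>"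
    and hf: "\<And>x. x \<in> U \<Longrightarrow> \<psi> (\<phi> x) = x"
    and a: "a \<in> X" "\<phi> a = replicate n 0" and d: "d \<le> n"
    and img: "\<phi> ` (X \<inter> U) = {x \<in> V. \<forall>i. d \<le> i \<and> i < n \<longrightarrow> x ! i = 0}"
  shows "graph_at (Suc r) (n + n) {\<phi> x @ x | x. x \<in> X \<inter> U} {..<d} (replicate n 0 @ a)"
proof -
  let ?A = "replicate n 0 @ a" and ?M = "{\<phi> x @ x | x. x \<in> X \<inter> U}"
  have UF: "U \<subseteq> Fn n" and VF: "V \<subseteq> Fn n" using U V by (simp_all add: openF_def)
  have la: "length a = n" using U(3) UF by auto
  have lf: "length (\<phi> x) = n" if "x \<in> U" for x using f(1) that by (simp add: Dr_map_def)
  have lh: "length (\<psi> y) = n" if "y \<in> V" for y using h that by (simp add: Dr_map_def)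
  obtain e where e: "0 < e" "cube (replicate n 0) e \<subseteq> V" using V(2,3) unfolding openF_iff by blast
  \<comment> \<open>The chart point with the first \<open>d\<close> coordinates of \<open>z\<close>
    and zeros elsewhere, in the \<open>case\<close> form of \<open>DC_reindex\<close>.\<close>
  define L where "L = (\<lambda>z :: 'a list. map (\<lambda>j. case (if j < d then Some j else None) of Some k \<Rightarrow> z ! k | None \<Rightarrow> replicate n 0 ! j) [0..<n])"
  have L: "length (L z) = n" "\<And>j. j < n \<Longrightarrow> L z ! j = (if j < d then z ! j else 0)" for z by (simp_all add: L_def)
  have LV: "L z \<in> V" if "z \<in> cube ?A e" for z
  proof -
    have "\<bar>z ! j\<bar> < e" if "j < n" for j
      using \<open>z \<in> cube ?A e\<close> that by (auto simp: cube_def nth_append dest!: spec[of _ j])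
    then have "L z \<in> cube (replicate n 0) e" using e(1) by (simp add: cube_def L)
    then show ?thesis using e(2) by blast
  qed
  let ?p = "\<lambda>j y. if y \<in> V then \<psi> y ! j else 0"
  \<comment> \<open>The chart coordinates from \<open>d\<close> on vanish; the second block is the
    inverse chart at \<open>L z\<close>.\<close>
  let ?g = "\<lambda>k. if k < n then (\<lambda>z. 0) else (\<lambda>z. ?p (k - n) (L z))"
  show ?thesis
  proof (rule graph_atI[where e = e and g = ?g])
    show "?A \<in> ?M" using a U(3) by force
    show "DC (n + n) (Suc r) (cube ?A e) (?g k)" if k: "k < n + n" "k \<notin> {..<d}" for k
    proof (cases "k < n")
      case True
      then show ?thesis by (simp add: DC_const)
    next
      case False
      have "DC (n + n) (Suc r) (cube ?A e) (\<lambda>z. ?p (k - n) (L z))"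
        unfolding L_def
      proof (rule DC_reindex[OF V(2)])
        show "openF (n + n) (cube ?A e)" using openF_cube[of ?A e] la by simp
        show "DC n (Suc r) V (?p (k - n))" by (rule DC_component[OF h V(1,2)]) (use k False in simp)
      qed (use LV[unfolded L_def] d in \<open>auto split: if_splits\<close>)
      then show ?thesis using False by simp
    qed
    show "?g k x = ?g k y" if "length x = n + n" "length y = n + n" "\<forall>i\<in>{..<d}. x ! i = y ! i" for k x y
    proof -
      have "L x = L y" using that(3) by (intro nth_equalityI) (simp_all add: L)
      then show ?thesis by simp
    qed
    fix z assume z: "z \<in> cube ?A e"
    then have lz: "length z = n + n" using la by (simp add: cube_def)
    show "z \<in> ?M \<longleftrightarrow> (\<forall>k<n + n. k \<notin> {..<d} \<longrightarrow> z ! k = ?g k z)"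
    proof
      assume "z \<in> ?M"
      then obtain x where x: "x \<in> X" "x \<in> U" "z = \<phi> x @ x" by auto
      then have "\<phi> x \<in> \<phi> ` (X \<inter> U)" by blast
      then have y: "\<phi> x \<in> V" "\<And>i. d \<le> i \<Longrightarrow> i < n \<Longrightarrow> \<phi> x ! i = 0" unfolding img by auto
      have "L z = \<phi> x" using lf[OF x(2)] x(3) y(2) by (intro nth_equalityI) (auto simp: L nth_append)
      then have "?g k z = z ! k" if "k < n + n" "\<not> k < d" for k
        using that y hf[OF x(2)] x(3) lf[OF x(2)] by (auto simp: nth_append)
      then show "\<forall>k<n + n. k \<notin> {..<d} \<longrightarrow> z ! k = ?g k z" by simp
    next
      assume eq: "\<forall>k<n + n. k \<notin> {..<d} \<longrightarrow> z ! k = ?g k z"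
      have z0: "z ! k = 0" if "d \<le> k" "k < n" for k using eq[rule_format, of k] that by simp
      have t: "take n z = L z" using lz z0 by (intro nth_equalityI) (simp_all add: L)
      have y: "take n z \<in> V" using LV[OF z] t by simp
      have "take n z \<in> \<phi> ` (X \<inter> U)" unfolding img using y z0 by simp
      then obtain x where x: "x \<in> X \<inter> U" "take n z = \<phi> x" by blast
      have "drop n z = \<psi> (take n z)"
      proof (rule nth_equalityI)
        show "length (drop n z) = length (\<psi> (take n z))" using lz lh[OF y] by simp
        fix j assume "j < length (drop n z)"
        then have j: "j < n" using lz by simp
        then show "drop n z ! j = \<psi> (take n z) ! j"
          using eq[rule_format, of "n + j"] d LV[OF z] t lz by simp
      qed
      also have "\<dots> = x" using hf x by simp
      finally have "z = \<phi> x @ x" using x(2) by (metis append_take_drop_id)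
      then show "z \<in> ?M" using x by blast
    qed
  qed (use la e d in auto)
qed

text \<open>As \<phi> is \<open>C^1\<close>, hence Lipschitz near \<open>a\<close>, the second block
  of a point of its graph controls the first. This is the condition under which chart coordinates
  can be exchanged for the last \<open>n\<close> coordinates.\<close>

lemma chart_lip:
  assumes U: "D U" "openF n U" "a \<in> U" and f: "Dr_map D n n (Suc r) U \<phi>"
  obtains e C where "0 < e" "lip_on (n + n) ({\<phi> x @ x | x. x \<in> X \<inter> U} \<inter> cube (replicate n 0 @ a) e) {n..<n + n} C"
proof -
  let ?A = "replicate n 0 @ a" and ?M = "{\<phi> x @ x | x. x \<in> X \<inter> U}"
  have UF: "U \<subseteq> Fn n" using U by (simp add: openF_def)
  have la: "length a = n" using U(3) UF by auto
  have lf: "length (\<phi> x) = n" if "x \<in> U" for x using f that by (simp add: Dr_map_def)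
  let ?q = "\<lambda>j x. if x \<in> U then \<phi> x ! j else 0"
  obtain e C where e: "0 < e" and C1: "1 \<le> C" and qC:
    "\<And>k x y b. k \<in> {..<n} \<Longrightarrow> x \<in> cube a e \<Longrightarrow> y \<in> cube a e \<Longrightarrow> 0 \<le> b \<Longrightarrow>
      \<forall>i<n. \<bar>x ! i - y ! i\<bar> \<le> b \<Longrightarrow> \<bar>?q k x - ?q k y\<bar> \<le> C * b"
    by (rule DC_lipschitz_finite[OF finite_lessThan, of n n r U ?q a]) (use DC_component[OF f U(1,2)] U(2,3) in auto)
  have "lip_on (n + n) (?M \<inter> cube ?A e) {n..<n + n} C" unfolding lip_on_def
  proof (intro ballI allI impI)
    fix z w b k assume z: "z \<in> ?M \<inter> cube ?A e" and w: "w \<in> ?M \<inter> cube ?A e"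
      and b: "0 \<le> b" "\<forall>i\<in>{n..<n + n}. \<bar>z ! i - w ! i\<bar> \<le> b" and k: "k < n + n"
    obtain x where x: "x \<in> U" "z = \<phi> x @ x" using z by auto
    obtain y where y: "y \<in> U" "w = \<phi> y @ y" using w by auto
    have l: "length x = n" "length y = n" "length (\<phi> x) = n" "length (\<phi> y) = n" using x y UF lf by auto
    show "\<bar>z ! k - w ! k\<bar> \<le> C * b"
    proof (cases "k < n")
      case False
      then have "\<bar>z ! k - w ! k\<bar> \<le> 1 * b" using b(2) k by simp
      also have "\<dots> \<le> C * b" using C1 b(1) by (rule mult_right_mono)
      finally show ?thesis .
    next
      case True
      then have k': "k \<in> {..<n}" by simp
      have xy: "\<bar>x ! i - a ! i\<bar> < e" "\<bar>y ! i - a ! i\<bar> < e" "\<bar>x ! i - y ! i\<bar> \<le> b" if "i < n" for i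
        using z w b(2) x y l la that by (auto simp: cube_def nth_append dest!: spec[of _ "n + i"] bspec[of _ _ "n + i"])
      then have "x \<in> cube a e" "y \<in> cube a e" using l la by (auto simp: cube_def)
      then have "\<bar>?q k x - ?q k y\<bar> \<le> C * b" using xy(3) b(1) by (intro qC[OF k']) auto
      then show ?thesis using x y l True by (simp add: nth_append)
    qed
  qed
  then show thesis using e that by blast
qed

text \<open>After the exchange the graph of the chart is a local graph over a set \<open>S\<close>
  inside the second block. Its component functions then depend on \<open>x\<close> alone, so the
  first block can be forgotten.\<close>

lemma submanifold_graph_at:
  assumes X: "Dr_submanifold D (Suc r) n d X" and aX: "a \<in> X"
  shows "\<exists>S\<subseteq>{..<n}. card S = d \<and> graph_at (Suc r) n X S a"
proof -
  from X have d: "d \<le> n" by (simp add: Dr_submanifold_def)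
  from X aX obtain U V \<phi> where U: "D U" "openF n U" "a \<in> U" and V: "D V" "openF n V" "replicate n 0 \<in> V"
    and diffeo: "Dr_diffeo D n (Suc r) U V \<phi>" and a0: "\<phi> a = replicate n 0"
    and img: "\<phi> ` (X \<inter> U) = {x \<in> V. \<forall>i. d \<le> i \<and> i < n \<longrightarrow> x ! i = 0}"
    unfolding Dr_submanifold_def by blast
  from diffeo obtain \<psi> where f: "Dr_map D n n (Suc r) U \<phi>" "\<phi> ` U = V" and h: "Dr_map D n n (Suc r) V \<psi>"
    and hf: "\<And>x. x \<in> U \<Longrightarrow> \<psi> (\<phi> x) = x" unfolding Dr_diffeo_def by blast
  let ?A = "replicate n 0 @ a" and ?M = "{\<phi> x @ x | x. x \<in> X \<inter> U}"
  have UF: "U \<subseteq> Fn n" using U by (simp add: openF_def)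
  have la: "length a = n" using U(3) UF by auto
  have lf: "length (\<phi> x) = n" if "x \<in> U" for x using f(1) that by (simp add: Dr_map_def)
  have G: "graph_at (Suc r) (n + n) ?M {..<d} ?A"
    by (rule chart_graph_at[OF U V f h hf aX a0 d img])
  obtain e0 C where "0 < e0" "lip_on (n + n) (?M \<inter> cube ?A e0) {n..<n + n} C"
    by (rule chart_lip[OF U f(1)]) (rule that)
  from exchange_into[OF this _ G] obtain S where S: "S \<subseteq> {n..<n + n}" "card S = d" "graph_at (Suc r) (n + n) ?M S ?A"
    by force
  from S(3) obtain e g where lg: "local_graph (Suc r) (n + n) ?M S ?A e g"
    unfolding graph_at_def by blast
  note g = local_graphD[OF lg]
  have oC: "openF (n + n) (cube ?A e)" using openF_cube[of ?A e] la by simp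
  have AC: "?A \<in> cube ?A e" by (rule cube_center[OF g(4)])
  \<comment> \<open>The first block is filled with zeros, which is immaterial to the
    \<open>g k\<close>, as they see only coordinates in \<open>S\<close>.\<close>
  define L where "L = (\<lambda>x :: 'a list. map (\<lambda>j. case (if j < n then None else Some (j - n)) of Some k \<Rightarrow> x ! k | None \<Rightarrow> ?A ! j) [0..<n + n])"
  have L: "L x = replicate n 0 @ x" if "length x = n" for x
    using that by (intro nth_equalityI) (auto simp: L_def nth_append)
  have Lc: "replicate n 0 @ x \<in> cube ?A t" if "x \<in> cube a t" "0 < t" for x t
    using that la unfolding cube_def by (auto simp: nth_append)
  have gA: "g k ?A = 0" if k: "k < n" for k
  proof -
    have "k < n + n" "k \<notin> S" using k S(1) by auto
    then have "?A ! k = g k ?A" using g(7)[OF AC] g(2) by blast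
    then show ?thesis using k by (simp add: nth_append)
  qed
  obtain e1 where e1: "0 < e1" "\<And>k z. k \<in> {..<n} \<Longrightarrow> z \<in> cube ?A e1 \<Longrightarrow> \<bar>g k z - g k ?A\<bar> < e"
  proof (rule contF_cube_finite[OF oC AC finite_lessThan _ g(4), where f = g])
    show "contF (cube ?A e) (g k)" if "k \<in> {..<n}" for k
      by (rule DC_contF[OF g(5)]) (use that S(1) in auto)
  qed (rule that)
  let ?q = "\<lambda>k x. if x \<in> U then \<phi> x ! k else 0"
  obtain e2 where e2: "0 < e2" "cube a e2 \<subseteq> U" "\<And>k x. k \<in> {..<n} \<Longrightarrow> x \<in> cube a e2 \<Longrightarrow> \<bar>?q k x - ?q k a\<bar> < e"
  proof (rule contF_cube_finite[OF U(2,3) finite_lessThan _ g(4), where f = ?q])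
    show "contF U (?q k)" if "k \<in> {..<n}" for k
      by (rule DC_contF[OF DC_component[OF f(1) U(1,2)]]) (use that in simp)
  qed (rule that)
  \<comment> \<open>\<open>e2\<close> keeps \<phi> \<open>x\<close> and \<open>e1\<close> keeps the
    values \<open>g k (L x)\<close> within \<open>e\<close> of 0, so the lifted points of both
    directions lie in \<open>cube ?A e\<close>.\<close>
  define t where "t = min e (min e1 e2)"
  have t: "0 < t" "t \<le> e" "t \<le> e1" "t \<le> e2" using g(4) e1(1) e2(1) by (auto simp: t_def min.coboundedI2)
  define S0 where "S0 = {j. j < n \<and> n + j \<in> S}"
  have S0: "S0 \<subseteq> {..<n}" by (auto simp: S0_def)
  have SS0: "S = (\<lambda>j. n + j) ` S0"
  proof
    show "S \<subseteq> (\<lambda>j. n + j) ` S0"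
    proof
      fix k assume k: "k \<in> S"
      then have "n \<le> k" "k < n + n" using S(1) by auto
      then show "k \<in> (\<lambda>j. n + j) ` S0" using k by (intro image_eqI[of _ _ "k - n"]) (auto simp: S0_def)
    qed
  qed (auto simp: S0_def)
  have "card S0 = d" using S(2) unfolding SS0 by (subst (asm) card_image) auto
  moreover have "graph_at (Suc r) n X S0 a"
  proof (rule graph_atI[where e = t and g = "\<lambda>j x. g (n + j) (L x)"])
    have nS: "n + j < n + n" "n + j \<notin> S" if "j < n" "j \<notin> S0" for j using that by (auto simp: S0_def)
    show "DC n (Suc r) (cube a t) (\<lambda>x. g (n + j) (L x))" if j: "j < n" "j \<notin> S0" for j
      unfolding L_def
    proof (rule DC_reindex[OF oC _ _ _ _ g(5)[OF nS[OF j]]])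
      show "openF n (cube a t)" using openF_cube[of a t] la by simp
      fix x assume x: "x \<in> cube a t"
      then have "L x = replicate n 0 @ x" using la by (intro L) (simp add: cube_def)
      then show "map (\<lambda>j. case (if j < n then None else Some (j - n)) of Some k \<Rightarrow> x ! k | None \<Rightarrow> ?A ! j) [0..<n + n] \<in> cube ?A e"
        using Lc[OF _ g(4)] x cube_mono[OF t(2), of a] unfolding L_def by auto
    qed (auto split: if_splits)
    show "g (n + j) (L x) = g (n + j) (L y)"
      if j: "j < n" "j \<notin> S0" and xy: "length x = n" "length y = n" "\<forall>i\<in>S0. x ! i = y ! i" for j x y
      using xy by (intro g(6)[OF nS[OF j]]) (auto simp: L SS0 nth_append)
    fix x assume x: "x \<in> cube a t"
    have lx: "length x = n" using x la by (simp add: cube_def)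
    have xs: "x \<in> cube a e" "x \<in> cube a e1" "x \<in> cube a e2" using x cube_mono t(2-4) by blast+
    have xU: "x \<in> U" using xs e2(2) by blast
    show "x \<in> X \<longleftrightarrow> (\<forall>j<n. j \<notin> S0 \<longrightarrow> x ! j = g (n + j) (L x))"
    proof
      assume "x \<in> X"
      then have zM: "\<phi> x @ x \<in> ?M" using xU by blast
      have "\<bar>\<phi> x ! k\<bar> < e" if "k < n" for k
        using e2(3)[of k x] xs(3) that xU U(3) a0 by simp
      then have "\<phi> x @ x \<in> cube ?A e" using xs(1) lf[OF xU] lx la unfolding cube_def by (auto simp: nth_append)
      from g(7)[OF this] zM have eq: "(\<phi> x @ x) ! k = g k (\<phi> x @ x)" if "k < n + n" "k \<notin> S" for k using that by blast
      show "\<forall>j<n. j \<notin> S0 \<longrightarrow> x ! j = g (n + j) (L x)"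
      proof (intro allI impI)
        fix j assume j: "j < n" "j \<notin> S0"
        have "g (n + j) (\<phi> x @ x) = g (n + j) (L x)"
          using lf[OF xU] lx by (intro g(6)[OF nS[OF j]]) (auto simp: L SS0 nth_append)
        then show "x ! j = g (n + j) (L x)" using eq[OF nS[OF j]] lf[OF xU] by (simp add: nth_append)
      qed
    next
      assume eq: "\<forall>j<n. j \<notin> S0 \<longrightarrow> x ! j = g (n + j) (L x)"
      \<comment> \<open>The candidate over \<open>x\<close>: its first block is read off from the
        component functions. Once it is in \<open>?M\<close>, its second block \<open>x\<close> is
        in \<open>X\<close>.\<close>
      define z where "z = map (\<lambda>k. if k < n then g k (L x) else x ! (k - n)) [0..<n + n]"
      have z: "length z = n + n" "\<And>k. k < n + n \<Longrightarrow> z ! k = (if k < n then g k (L x) else x ! (k - n))"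
        by (simp_all add: z_def)
      have dz: "drop n z = x" using z lx by (intro nth_equalityI) auto
      have gz: "g k z = g k (L x)" if "k < n + n" "k \<notin> S" for k
      proof (intro g(6)[OF that] ballI)
        show "length (L x) = n + n" using L[OF lx] lx by simp
        fix i assume "i \<in> S"
        then obtain j where "i = n + j" "j < n" using SS0 S0 by auto
        then show "z ! i = L x ! i" using z(2)[of i] L[OF lx] by (simp add: nth_append)
      qed (rule z(1))
      have "\<bar>g k (L x)\<bar> < e" if "k < n" for k
        using e1(2)[of k "L x"] Lc[OF xs(2) e1(1)] that L[OF lx] gA by simp
      then have zC: "z \<in> cube ?A e" using z lx la xs(1) unfolding cube_def by (auto simp: nth_append)
      have "z ! k = g k z" if k: "k < n + n" "k \<notin> S" for k
      proof (cases "k < n")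
        case True
        then show ?thesis using z(2)[OF k(1)] gz[OF k] by simp
      next
        case False
        have "k - n < n" "k - n \<notin> S0" using k False by (auto simp: S0_def)
        then have "x ! (k - n) = g k (L x)" using eq[rule_format, of "k - n"] False by simp
        then show ?thesis using z(2)[OF k(1)] gz[OF k] False by simp
      qed
      then have "z \<in> ?M" using g(7)[OF zC] by blast
      then obtain x' where x': "x' \<in> X \<inter> U" "z = \<phi> x' @ x'" by blast
      have "drop n z = x'" using x' lf by simp
      then show "x \<in> X" using dz x'(1) by simp
    qed
  qed (use la aX S0 t(1) in auto)
  ultimately show ?thesis using S0 by blast
qed

end

text \<open>Two radii, because \<open>e\<close> is to be common to a whole fibre whereas the height
  \<open>d\<close> transverse to \<open>S\<close> may depend on the point.\<close>

definition tube :: "nat \<Rightarrow> nat set \<Rightarrow> 'a::linordered_field list \<Rightarrow> 'a \<Rightarrow> 'a \<Rightarrow> 'a list set" where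
  "tube n S y e d = {v \<in> Fn n. (\<forall>i\<in>S. \<bar>v ! i - y ! i\<bar> < e) \<and> (\<forall>k\<in>{..<n} - S. \<bar>v ! k - y ! k\<bar> < d)}"

lemma open_box_tube:
  assumes y: "length y = n" and S: "S \<subseteq> {..<n}" and ed: "0 < e" "0 < d" shows "open_box n (tube n S y e d)"
proof -
  let ?w = "\<lambda>i. if i \<in> S then e else d"
  have w: "0 < ?w i" for i using ed by simp
  let ?a = "map (\<lambda>i. y ! i - ?w i) [0..<n]" and ?b = "map (\<lambda>i. y ! i + ?w i) [0..<n]"
  show ?thesis unfolding open_box_def
  proof (rule exI[of _ ?a], rule exI[of _ ?b], intro conjI allI impI)
    show "?a ! i < ?b ! i" if "i < n" for i
      using that w[of i] by simp
    have *: "\<bar>v - u\<bar> < t \<longleftrightarrow> u - t < v \<and> v < u + t" for u v t :: 'a by (auto simp: abs_less_iff algebra_simps)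
    show "tube n S y e d = {v \<in> Fn n. \<forall>i<n. ?a ! i < v ! i \<and> v ! i < ?b ! i}"
    proof (intro equalityI subsetI)
      fix v assume v: "v \<in> tube n S y e d"
      have "\<bar>v ! i - y ! i\<bar> < ?w i" if "i < n" for i using v that by (auto simp: tube_def)
      then show "v \<in> {v \<in> Fn n. \<forall>i<n. ?a ! i < v ! i \<and> v ! i < ?b ! i}" using v by (simp add: tube_def *)
    next
      fix v assume v: "v \<in> {v \<in> Fn n. \<forall>i<n. ?a ! i < v ! i \<and> v ! i < ?b ! i}"
      have vw: "\<bar>v ! i - y ! i\<bar> < ?w i" if "i < n" for i using v that by (simp add: *)
      have "\<bar>v ! i - y ! i\<bar> < e" if "i \<in> S" for i using vw[of i] that S by auto
      moreover have "\<bar>v ! k - y ! k\<bar> < d" if "k \<in> {..<n} - S" for k using vw[of k] that by simp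
      ultimately show "v \<in> tube n S y e d" using v by (simp add: tube_def)
    qed
  qed simp_all
qed

lemma open_box_cube:
  assumes "length x = n" "0 < e" shows "open_box n (cube x e)"
proof -
  \<comment> \<open>With no coordinate outside \<open>S\<close> the height 1 is arbitrary.\<close>
  have "cube x e = tube n {..<n} x e 1" using assms by (auto simp: cube_def tube_def)
  then show ?thesis using open_box_tube[OF assms(1) order_refl assms(2) zero_less_one] by simp
qed

context def_complete
begin

text \<open>By continuity the graph over a small cube of \<open>S\<close>-coordinates stays in
  \<open>cube y m\<close>. The base point is a vector \<open>w\<close> of full length, of which only
  the \<open>S\<close>-coordinates count, so the condition fits into formulas over
  \<open>F^n\<close>.\<close>

lemma graph_at_open:
  assumes G: "graph_at r n Y S y" and m: "0 < m"
  obtains d where "0 < d" "d \<le> m"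
    "\<forall>w\<in>Fn n. (\<forall>i\<in>S. \<bar>w ! i - y ! i\<bar> < d) \<longrightarrow> (\<exists>v\<in>Y. v \<in> cube y m \<and> (\<forall>i\<in>S. v ! i = w ! i))"
proof -
  from G obtain e g where lg: "local_graph r n Y S y e g"
    unfolding graph_at_def by blast
  note g = local_graphD[OF lg]
  have oC: "openF n (cube y e)" using openF_cube[of y e] g(1) by simp
  have yC: "y \<in> cube y e" by (rule cube_center[OF g(4)])
  define p where "p = min m e"
  have p: "0 < p" "p \<le> m" "p \<le> e" using m g(4) by (auto simp: p_def)
  have gy: "g k y = y ! k" if "k \<in> {..<n} - S" for k using g(7)[OF yC] g(2) that by simp
  obtain d0 where d0: "0 < d0" "\<And>k z. k \<in> {..<n} - S \<Longrightarrow> z \<in> cube y d0 \<Longrightarrow> \<bar>g k z - g k y\<bar> < p"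
  proof (rule contF_cube_finite[OF oC yC finite_Diff[OF finite_lessThan] _ p(1), where f = g])
    show "contF (cube y e) (g k)" if "k \<in> {..<n} - S" for k by (rule DC_contF[OF g(5)]) (use that in auto)
  qed (rule that)
  define d where "d = min d0 p"
  have d: "0 < d" "d \<le> p" "d \<le> d0" using d0 p by (auto simp: d_def)
  have "\<exists>v\<in>Y. v \<in> cube y m \<and> (\<forall>i\<in>S. v ! i = w ! i)" if w: "length w = n" "\<forall>i\<in>S. \<bar>w ! i - y ! i\<bar> < d" for w
  proof -
    define w' where "w' = map (\<lambda>k. if k \<in> S then w ! k else y ! k) [0..<n]"
    define v where "v = map (\<lambda>k. if k \<in> S then w ! k else g k w') [0..<n]"
    have w': "length w' = n" "\<And>k. k < n \<Longrightarrow> w' ! k = (if k \<in> S then w ! k else y ! k)" by (simp_all add: w'_def)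
    have v: "length v = n" "\<And>k. k < n \<Longrightarrow> v ! k = (if k \<in> S then w ! k else g k w')" by (simp_all add: v_def)
    have w'C: "w' \<in> cube y d" using w' w(2) d(1) g(1) by (auto simp: cube_def)
    have "\<bar>v ! k - y ! k\<bar> < p" if "k < n" for k
    proof (cases "k \<in> S")
      case True
      then show ?thesis using v(2)[OF that] w(2) d(2) by force
    next
      case False
      then have k: "k \<in> {..<n} - S" using that by simp
      have "w' \<in> cube y d0" using w'C cube_mono[OF d(3)] by blast
      from d0(2)[OF k this] show ?thesis using v(2)[OF that] gy[OF k] False by simp
    qed
    then have "v \<in> cube y p" using v(1) g(1) by (simp add: cube_def)
    then have vC: "v \<in> cube y m" "v \<in> cube y e" using cube_mono[OF p(2)] cube_mono[OF p(3)] by blast+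
    have "v ! k = g k v" if k: "k < n" "k \<notin> S" for k
    proof -
      have "g k v = g k w'" using v w' g(3) by (intro g(6)[OF k]) auto
      then show ?thesis using v(2)[OF k(1)] k(2) by simp
    qed
    then have "v \<in> Y" using g(7)[OF vC(2)] by blast
    moreover have "\<forall>i\<in>S. v ! i = w ! i" using v(2) g(3) by auto
    ultimately show ?thesis using vC(1) by blast
  qed
  then show thesis using that[of d] d p by auto
qed

end

context locally_o_minimal_field
begin

text \<open>Each point has a box with a section, and \<open>uniform_radius\<close> along the fibre
  makes the bases of these boxes equal. Only the predicate \<open>R\<close> is carried over to the
  common radius; the section is rebuilt from it and compared with the local graphs for
  smoothness.\<close>

lemma quasi_special_if_graph_at:
  assumes Y: "D Y" "Y \<subseteq> Fn n" and S: "S \<subseteq> {..<n}"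
    and G: "\<And>y. y \<in> Y \<Longrightarrow> graph_at (Suc r) n Y S y"
  shows "quasi_special_wrt D (Suc r) n S Y"
proof -
  have finS: "finite S" using S finite_subset by blast
  define ss where "ss = sorted_list_of_set S"
  define d where "d = card S"
  have ss: "length ss = d" "set ss = S" "distinct ss" using finS by (simp_all add: ss_def d_def)
  \<comment> \<open>Translates an element of \<open>S\<close> into its place in the increasing
    enumeration used by \<open>proj\<close>.\<close>
  define pos where "pos = inv_into {..<d} ((!) ss)"
  have bij: "bij_betw ((!) ss) {..<d} S" using bij_betw_nth[OF ss(3)] ss by (simp add: lessThan_atLeast0)
  have pos: "pos i < d" "ss ! pos i = i" if "i \<in> S" for i
    using bij_betwE[OF bij_betw_inv_into[OF bij]] bij_betw_inv_into_right[OF bij] that by (auto simp: pos_def)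
  have pos': "ss ! p \<in> S" "pos (ss ! p) = p" if "p < d" for p
    using bij_betwE[OF bij] bij_betw_inv_into_left[OF bij] that by (auto simp: pos_def)
  have proj: "length (proj S x) = d" "\<And>p. p < d \<Longrightarrow> proj S x ! p = x ! (ss ! p)" for x :: "'a list"
    using ss(1) by (simp_all add: proj_def ss_def)
  have proj_eq: "proj S x = proj S z \<longleftrightarrow> (\<forall>i\<in>S. x ! i = z ! i)" for x z :: "'a list"
    using ss(2) by (auto simp: proj_def ss_def)
  define E where "E = (\<lambda>(c :: 'a list) w. map (\<lambda>j. case (if j \<in> S then Some (pos j) else None) of Some k \<Rightarrow> w ! k | None \<Rightarrow> c ! j) [0..<n])"
  have E: "length (E c w) = n" "\<And>j. j < n \<Longrightarrow> E c w ! j = (if j \<in> S then w ! pos j else c ! j)" for c w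
    by (simp_all add: E_def)
  have E_S: "E c w ! i = w ! pos i" if "i \<in> S" for c w i using E(2)[of i c w] that S by auto
  have proj_E: "proj S (E c w) = w" if "length w = d" for c w
    using that proj pos' E_S by (intro nth_equalityI) auto
  have YL: "length y = n" if "y \<in> Y" for y using Y(2) that by auto

  \<comment> \<open>Over the cube of radius \<open>e\<close> there is a point of \<open>Y\<close> in
    a tube of height \<open>t\<close>, and the Lipschitz bound makes it unique. \<open>t\<close> and
    \<open>C\<close> are bound inside and so may vary with \<open>y\<close>; everything is written
    out to be visibly first-order.\<close>
  define R where "R = (\<lambda>y e. \<exists>t C. 0 < t \<and>
    (\<forall>w\<in>Fn n. (\<forall>i\<in>S. \<bar>w ! i - y ! i\<bar> < e) \<longrightarrow> (\<exists>v\<in>Fn n. v \<in> Y \<and> (\<forall>i\<in>S. v ! i = w ! i) \<and> (\<forall>k\<in>{..<n} - S. \<bar>v ! k - y ! k\<bar> < t))) \<and>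
    (\<forall>u\<in>Fn n. \<forall>v\<in>Fn n. u \<in> Y \<and> v \<in> Y \<and>
      ((\<forall>i\<in>S. \<bar>u ! i - y ! i\<bar> < e) \<and> (\<forall>k\<in>{..<n} - S. \<bar>u ! k - y ! k\<bar> < t)) \<and>
      ((\<forall>i\<in>S. \<bar>v ! i - y ! i\<bar> < e) \<and> (\<forall>k\<in>{..<n} - S. \<bar>v ! k - y ! k\<bar> < t)) \<longrightarrow>
      (\<forall>b. 0 \<le> b \<and> (\<forall>i\<in>S. \<bar>u ! i - v ! i\<bar> \<le> b) \<longrightarrow> (\<forall>k<n. \<bar>u ! k - v ! k\<bar> \<le> C * b))))"
  have R_iff: "R y e \<longleftrightarrow> (\<exists>t C. 0 < t \<and>
    (\<forall>w\<in>Fn n. (\<forall>i\<in>S. \<bar>w ! i - y ! i\<bar> < e) \<longrightarrow> (\<exists>v\<in>Y. (\<forall>i\<in>S. v ! i = w ! i) \<and> (\<forall>k\<in>{..<n} - S. \<bar>v ! k - y ! k\<bar> < t))) \<and>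
    lip_on n (Y \<inter> tube n S y e t) S C)" for y e
    unfolding R_def lip_on_def tube_def using Y(2) by (intro ex_cong1 conj_cong refl) blast+
  have Sn: "i < n" if "i \<in> S" for i using S that by auto
  have R_def_pred: "def_pred (\<lambda>\<rho>. R (v \<rho>) (t \<rho>))" if v: "def_vec n v" and t: "def_term t" for v t
    unfolding R_def
    by (intro def_intros def_pred_ex_vec def_pred_all_vec def_pred_ball_finite[OF finS] def_pred_ball_finite[OF finite_Diff[OF finite_lessThan]]
        def_pred_in[OF Y] def_term_subst[OF t] def_term_nth[OF def_vec_subst[OF v]] def_term_nth[OF def_vec_take_map])
      (use Sn in auto)
  have R_mono: "R z e'" if "z \<in> Y" "R z e" "0 < e'" "e' \<le> e" for z e e'
  proof -
    from that(2) obtain t C where tC: "0 < t"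
      "\<forall>w\<in>Fn n. (\<forall>i\<in>S. \<bar>w ! i - z ! i\<bar> < e) \<longrightarrow> (\<exists>v\<in>Y. (\<forall>i\<in>S. v ! i = w ! i) \<and> (\<forall>k\<in>{..<n} - S. \<bar>v ! k - z ! k\<bar> < t))"
      "lip_on n (Y \<inter> tube n S z e t) S C" unfolding R_iff by blast
    have less: "\<bar>u\<bar> < e" if "\<bar>u\<bar> < e'" for u using that \<open>e' \<le> e\<close> by simp
    have "Y \<inter> tube n S z e' t \<subseteq> Y \<inter> tube n S z e t" unfolding tube_def using less by blast
    from lip_on_subset[OF tC(3) this] show ?thesis unfolding R_iff using tC(1,2) less by blast
  qed
  have R_ex: "\<exists>e>0. R y e" if y: "y \<in> Y" for y
  proof -
    obtain m C where m: "0 < m" "lip_on n (Y \<inter> cube y m) S C" by (rule graph_at_lip[OF G[OF y]])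
    obtain e where e: "0 < e" "e \<le> m"
      "\<forall>w\<in>Fn n. (\<forall>i\<in>S. \<bar>w ! i - y ! i\<bar> < e) \<longrightarrow> (\<exists>v\<in>Y. v \<in> cube y m \<and> (\<forall>i\<in>S. v ! i = w ! i))"
      by (rule graph_at_open[OF G[OF y] m(1)])
    have "tube n S y e m \<subseteq> cube y m"
    proof
      fix v assume v: "v \<in> tube n S y e m"
      have "\<bar>v ! i - y ! i\<bar> < m" if "i < n" for i
      proof (cases "i \<in> S")
        case True
        then have "\<bar>v ! i - y ! i\<bar> < e" using v by (simp add: tube_def)
        then show ?thesis using e(2) by simp
      next
        case False
        then show ?thesis using v that by (simp add: tube_def)
      qed
      then show "v \<in> cube y m" using v YL[OF y] by (simp add: cube_def tube_def)
    qed
    then have "lip_on n (Y \<inter> tube n S y e m) S C" using m(2) by (elim lip_on_subset) blast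
    moreover have "\<exists>v\<in>Y. (\<forall>i\<in>S. v ! i = w ! i) \<and> (\<forall>k\<in>{..<n} - S. \<bar>v ! k - y ! k\<bar> < m)"
      if w: "w \<in> Fn n" "\<forall>i\<in>S. \<bar>w ! i - y ! i\<bar> < e" for w
    proof -
      obtain v where v: "v \<in> Y" "v \<in> cube y m" "\<forall>i\<in>S. v ! i = w ! i" using e(3) w by blast
      then have "\<forall>k\<in>{..<n} - S. \<bar>v ! k - y ! k\<bar> < m" using YL[OF y] by (simp add: cube_def)
      then show ?thesis using v by blast
    qed
    ultimately have "R y e" unfolding R_iff using m(1) by blast
    then show ?thesis using e(1) by blast
  qed

  show ?thesis unfolding quasi_special_wrt_def d_def[symmetric]
  proof (intro conjI ballI Y S)
    show "openF d (proj S ` Y)" unfolding openF_iff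
    proof (intro conjI ballI)
      show "proj S ` Y \<subseteq> Fn d" using proj by auto
      fix x assume "x \<in> proj S ` Y"
      then obtain y where y: "y \<in> Y" "x = proj S y" by blast
      obtain e where e: "0 < e" "R y e" using R_ex[OF y(1)] by blast
      have "cube x e \<subseteq> proj S ` Y"
      proof
        fix w assume w: "w \<in> cube x e"
        have lw: "length w = d" using w y proj by (simp add: cube_def)
        have "\<bar>E y w ! i - y ! i\<bar> < e" if i: "i \<in> S" for i
        proof -
          have "x ! pos i = y ! i" using proj(2)[OF pos(1)[OF i]] pos(2)[OF i] y(2) by simp
          then show ?thesis using w pos(1)[OF i] E_S[OF i] y(2) proj(1) by (auto simp: cube_def)
        qed
        then obtain v where v: "v \<in> Y" "\<forall>i\<in>S. v ! i = E y w ! i" using e(2) E(1) unfolding R_iff by (metis Fn_iff)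
        then have "proj S v = proj S (E y w)" unfolding proj_eq by blast
        then have "w = proj S v" using proj_E[OF lw] by simp
        then show "w \<in> proj S ` Y" using v(1) by blast
      qed
      then show "\<exists>e>0. cube x e \<subseteq> proj S ` Y" using e(1) by blast
    qed
    fix x assume "x \<in> proj S ` Y"
    then obtain c where c: "c \<in> Y" "x = proj S c" by blast
    have lx: "length x = d" using c proj by simp
    define Z where "Z = {y \<in> Fn n. y \<in> Y \<and> (\<forall>i\<in>S. y ! i = c ! i)}"
    have Z: "D Z" unfolding Z_def
      by (rule D_Collect) (intro def_intros def_pred_ball_finite[OF finS] def_pred_in[OF Y] def_term_nth[OF def_vec_take_map] Sn)
    have ZY: "Z \<subseteq> Y" "Z \<subseteq> Fn n" by (auto simp: Z_def)
    have "\<exists>e>0. \<forall>z'\<in>Z. z' \<in> cube z e \<longrightarrow> z' = z" if z: "z \<in> Z" for z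
    proof -
      have zY: "z \<in> Y" using z ZY by blast
      obtain m C where m: "0 < m" "lip_on n (Y \<inter> cube z m) S C" by (rule graph_at_lip[OF G[OF zY]])
      have "z' = z" if z': "z' \<in> Z" "z' \<in> cube z m" for z'
      proof (rule nth_equalityI)
        show "length z' = length z" using z z' by (simp add: Z_def)
        fix k assume "k < length z'"
        then have k: "k < n" using z' by (simp add: Z_def)
        \<comment> \<open>Points of one fibre share their \<open>S\<close>-coordinates, so the
          Lipschitz condition applies with \<open>b = 0\<close>: near \<open>z\<close> the fibre is
          \<open>z\<close> alone.\<close>
        have "\<bar>z' ! k - z ! k\<bar> \<le> C * 0"
          by (rule lip_onD[OF m(2) _ _ order_refl _ k])
            (use z z' ZY cube_center[OF m(1)] in \<open>auto simp: Z_def\<close>)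
        then show "z' ! k = z ! k" by simp
      qed
      then show ?thesis using m(1) by blast
    qed
    then obtain e where e: "0 < e" "\<And>z. z \<in> Z \<Longrightarrow> R z e"
      using uniform_radius[OF Z ZY(2), of R] R_def_pred R_mono R_ex ZY(1) by blast
    let ?U = "cube x e"
    show "\<exists>U. open_box d U \<and> x \<in> U \<and> (\<forall>y\<in>Y. proj S y = x \<longrightarrow>
           (\<exists>V \<tau>. open_box n V \<and> y \<in> V \<and> Dr_map D d n (Suc r) U \<tau> \<and>
              proj S ` V = U \<and> \<tau> ` U = Y \<inter> V \<and> (\<forall>u\<in>U. proj S (\<tau> u) = u)))"
    proof (rule exI[of _ ?U], intro conjI ballI impI)
      show "open_box d ?U" by (rule open_box_cube[OF lx e(1)])
      show "x \<in> ?U" by (rule cube_center[OF e(1)])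
      fix y assume y: "y \<in> Y" "proj S y = x"
      have "y \<in> Z" using y c YL proj_eq[of y c] by (simp add: Z_def)
      from e(2)[OF this] obtain t C where t: "0 < t"
        and sec: "\<And>w. w \<in> Fn n \<Longrightarrow> \<forall>i\<in>S. \<bar>w ! i - y ! i\<bar> < e \<Longrightarrow> \<exists>v\<in>Y. (\<forall>i\<in>S. v ! i = w ! i) \<and> (\<forall>k\<in>{..<n} - S. \<bar>v ! k - y ! k\<bar> < t)"
        and lip: "lip_on n (Y \<inter> tube n S y e t) S C" unfolding R_iff by blast
      let ?V = "tube n S y e t"
      have ly: "length y = n" by (rule YL[OF y(1)])
      have xy: "x ! p = y ! (ss ! p)" if "p < d" for p using proj(2)[OF that, of y] y(2) by simp
      have ES: "\<bar>E y w ! i - y ! i\<bar> < e" if w: "w \<in> ?U" and i: "i \<in> S" for w i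
        using w pos[OF i] E_S[OF i] xy[OF pos(1)[OF i]] lx by (auto simp: cube_def)
      have VU: "proj S v \<in> ?U" if v: "v \<in> ?V" for v
        using v proj lx xy pos' by (auto simp: cube_def tube_def)
      have lU: "length w = d" if "w \<in> ?U" for w using that lx by (simp add: cube_def)
      \<comment> \<open>The choice is forced on \<open>?U\<close>, as \<open>uniq\<close> shows;
        this is what makes \<tau> definable there in spite of \<open>SOME\<close>.\<close>
      define \<tau> where "\<tau> = (\<lambda>w. SOME v. v \<in> Y \<inter> ?V \<and> proj S v = w)"
      have \<tau>: "\<tau> w \<in> Y" "\<tau> w \<in> ?V" "proj S (\<tau> w) = w" if w: "w \<in> ?U" for w
      proof -
        have "\<exists>v\<in>Y. (\<forall>i\<in>S. v ! i = E y w ! i) \<and> (\<forall>k\<in>{..<n} - S. \<bar>v ! k - y ! k\<bar> < t)"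
          using E(1) ES[OF w] by (intro sec) auto
        then obtain v where v: "v \<in> Y" "\<forall>i\<in>S. v ! i = E y w ! i" "\<forall>k\<in>{..<n} - S. \<bar>v ! k - y ! k\<bar> < t" by blast
        have "v \<in> ?V" using v ES[OF w] YL by (simp add: tube_def)
        moreover have "proj S v = proj S (E y w)" unfolding proj_eq using v(2) by blast
        then have "proj S v = w" using proj_E[OF lU[OF w]] by simp
        ultimately have "v \<in> Y \<inter> ?V \<and> proj S v = w" using v(1) by blast
        from someI[of "\<lambda>v. v \<in> Y \<inter> ?V \<and> proj S v = w", OF this]
        show "\<tau> w \<in> Y" "\<tau> w \<in> ?V" "proj S (\<tau> w) = w" unfolding \<tau>_def by auto
      qed
      have uniq: "u = v" if u: "u \<in> Y \<inter> ?V" and v: "v \<in> Y \<inter> ?V" and uv: "proj S u = proj S v" for u v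
      proof (rule nth_equalityI)
        show "length u = length v" using u v by (simp add: tube_def)
        fix k assume "k < length u"
        then have k: "k < n" using u by (simp add: tube_def)
        have "\<bar>u ! k - v ! k\<bar> \<le> C * 0"
          by (rule lip_onD[OF lip u v order_refl _ k]) (use uv[unfolded proj_eq] in simp)
        then show "u ! k = v ! k" by simp
      qed
      have \<tau>S: "\<tau> w ! i = w ! pos i" if w: "w \<in> ?U" and i: "i \<in> S" for w i
        using proj(2)[OF pos(1)[OF i], of "\<tau> w"] pos(2)[OF i] \<tau>(3)[OF w] by simp
      have \<tau>_proj: "\<tau> (proj S v) = v" if v: "v \<in> Y \<inter> ?V" for v
      proof (rule uniq[OF _ v])
        have vU: "proj S v \<in> ?U" using VU v by blast
        show "\<tau> (proj S v) \<in> Y \<inter> ?V" using \<tau>(1,2)[OF vU] by simp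
        show "proj S (\<tau> (proj S v)) = proj S v" by (rule \<tau>(3)[OF vU])
      qed
      have dV: "D (Y \<inter> ?V)"
      proof (rule D_Int[OF Y(1)])
        show "D ?V" unfolding tube_def
          by (rule D_Collect) (intro def_intros def_pred_ball_finite[OF finS] def_pred_ball_finite[OF finite_Diff[OF finite_lessThan]]
            def_term_nth[OF def_vec_take_map], use Sn in auto)
      qed
      show "\<exists>V \<tau>. open_box n V \<and> y \<in> V \<and> Dr_map D d n (Suc r) ?U \<tau> \<and>
              proj S ` V = ?U \<and> \<tau> ` ?U = Y \<inter> V \<and> (\<forall>u\<in>?U. proj S (\<tau> u) = u)"
      proof (intro exI[of _ ?V] exI[of _ \<tau>] conjI ballI)
        show "open_box n ?V" by (rule open_box_tube[OF ly S e(1) t])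
        show "y \<in> ?V" using ly e(1) t by (simp add: tube_def)
        show "proj S ` ?V = ?U"
        proof
          show "?U \<subseteq> proj S ` ?V"
          proof
            fix w assume w: "w \<in> ?U"
            show "w \<in> proj S ` ?V" by (rule image_eqI[of _ _ "\<tau> w"]) (rule \<tau>(3)[OF w, symmetric], rule \<tau>(2)[OF w])
          qed
        qed (use VU in blast)
        show "\<tau> ` ?U = Y \<inter> ?V"
        proof
          show "\<tau> ` ?U \<subseteq> Y \<inter> ?V" using \<tau> by blast
          show "Y \<inter> ?V \<subseteq> \<tau> ` ?U"
          proof
            fix v assume v: "v \<in> Y \<inter> ?V"
            show "v \<in> \<tau> ` ?U" 
              by (rule image_eqI[of _ _ "proj S v"]) (rule \<tau>_proj[OF v, symmetric], use VU v in blast)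
          qed
        qed
        show "proj S (\<tau> u) = u" if "u \<in> ?U" for u by (rule \<tau>(3)[OF that])
        show "Dr_map D d n (Suc r) ?U \<tau>" unfolding Dr_map_def
        proof (intro conjI ballI allI impI)
          have VF: "Y \<inter> ?V \<subseteq> Fn n" using Y(2) by blast
          \<comment> \<open>The graph of \<tau> described without \<tau>: the second block lies in
            \<open>Y \<inter> ?V\<close> and the first is its projection.\<close>
          have "D {z \<in> Fn (d + n). map (\<lambda>i. z ! (d + i)) [0..<n] \<in> Y \<inter> ?V \<and> (\<forall>p<d. z ! p = z ! (d + ss ! p))}"
            by (rule D_Collect) (intro def_intros def_pred_in[OF dV VF] def_vec_map def_term_nth[OF def_vec_take_map], use Sn pos' in auto)
          moreover have "{z \<in> Fn (d + n). map (\<lambda>i. z ! (d + i)) [0..<n] \<in> Y \<inter> ?V \<and> (\<forall>p<d. z ! p = z ! (d + ss ! p))}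
             = {w @ \<tau> w | w. w \<in> ?U}" (is "?P = ?Q")
          proof (intro equalityI subsetI)
            fix z assume z: "z \<in> ?P"
            then have lz: "length z = d + n" by simp
            have dz: "map (\<lambda>i. z ! (d + i)) [0..<n] = drop d z" using lz by (intro nth_equalityI) auto
            have v: "drop d z \<in> Y \<inter> ?V" using z unfolding dz[symmetric] by blast
            have "take d z = proj S (drop d z)"
            proof (rule nth_equalityI)
              fix p assume "p < length (take d z)"
              then have p: "p < d" using lz by simp
              then show "take d z ! p = proj S (drop d z) ! p" using proj(2)[OF p] z lz Sn[OF pos'(1)[OF p]] by simp
            qed (use proj lz in simp)
            then have "z = proj S (drop d z) @ \<tau> (proj S (drop d z))" using \<tau>_proj[OF v] by (metis append_take_drop_id)
            moreover have "proj S (drop d z) \<in> ?U" using VU v by blast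
            ultimately show "z \<in> ?Q" by blast
          next
            fix z assume "z \<in> ?Q"
            then obtain w where w: "w \<in> ?U" "z = w @ \<tau> w" by blast
            have l: "length w = d" "length (\<tau> w) = n" using lU[OF w(1)] YL[OF \<tau>(1)[OF w(1)]] .
            have "map (\<lambda>i. z ! (d + i)) [0..<n] = \<tau> w" using l w(2) by (intro nth_equalityI) (auto simp: nth_append)
            moreover have "z ! p = z ! (d + ss ! p)" if "p < d" for p
              using w(2) l that \<tau>S[OF w(1) pos'(1)[OF that]] pos'(2)[OF that] by (simp add: nth_append)
            ultimately show "z \<in> ?P" using \<tau>(1,2)[OF w(1)] l w(2) by simp
          qed
          ultimately show "definable_map D ?U \<tau>" unfolding definable_map_def by simp
          show "length (\<tau> w) = n" if "w \<in> ?U" for w by (rule YL[OF \<tau>(1)[OF that]])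
          fix j assume j: "j < n"
          have UF: "?U \<subseteq> Fn d" using lU by auto
          show "Cr d (Suc r) ?U (\<lambda>w. \<tau> w ! j)"
          proof (rule Cr_local[OF _ UF])
            fix w0 assume w0: "w0 \<in> ?U"
            let ?v = "\<tau> w0"
            obtain e1 g where lg: "local_graph (Suc r) n Y S ?v e1 g"
              using G[OF \<tau>(1)[OF w0]] unfolding graph_at_def by blast
            note g = local_graphD[OF lg]
            have "openF d ?U" using openF_cube[of x e] lx by simp
            then obtain q where q: "0 < q" "cube w0 q \<subseteq> ?U" using w0 unfolding openF_iff by blast
            \<comment> \<open>Three demands: stay in \<open>?U\<close>, keep \<open>E ?v w\<close>
              in the cube of the local graph at \<open>?v\<close>, and, through the Lipschitz
              constant, keep \<tau> \<open>w\<close> there too.\<close>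
            define s where "s = min q (min e1 (e1 * inverse (\<bar>C\<bar> + 1)))"
            have C1: "0 < \<bar>C\<bar> + 1" by (simp add: add_nonneg_pos)
            have s: "0 < s" "s \<le> q" "s \<le> e1" "s \<le> e1 * inverse (\<bar>C\<bar> + 1)" using q g(4) C1 by (auto simp: s_def)
            have Cs: "C * s < e1"
            proof -
              have "C * s < (\<bar>C\<bar> + 1) * s" using s(1) by (intro mult_strict_right_mono) auto
              also have "\<dots> \<le> (\<bar>C\<bar> + 1) * (e1 * inverse (\<bar>C\<bar> + 1))" using s(4) C1 by (intro mult_left_mono) auto
              also have "\<dots> = e1" using C1 by simp
              finally show ?thesis .
            qed
            have sU: "cube w0 s \<subseteq> ?U" using cube_mono[OF s(2)] q(2) by blast
            have sF: "cube w0 s \<subseteq> Fn d" using sU UF by blast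
            have os: "openF d (cube w0 s)" using openF_cube[of w0 s] lU[OF w0] by simp
            have "Cr d (Suc r) (cube w0 s) (\<lambda>w. \<tau> w ! j)"
            proof (cases "j \<in> S")
              case True
              have "Cr d (Suc r) (cube w0 s) (\<lambda>w. w ! pos j)" by (rule DC_imp_Cr[OF DC_nth[OF sF pos(1)[OF True]]])
              then show ?thesis by (rule Cr_cong) (use \<tau>S[OF _ True] sU in auto)
            next
              case False
              \<comment> \<open>\<open>g j\<close> sees only the \<open>S\<close>-coordinates, which
                are the same in \<open>E ?v w\<close> and in \<tau> \<open>w\<close>; so \<tau> is
                expressed without reference to itself.\<close>
              have DC': "DC d (Suc r) (cube w0 s) (\<lambda>w. g j (E ?v w))" unfolding E_def
              proof (rule DC_reindex[OF _ os _ _ _ g(5)[OF j False]])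
                show "openF n (cube ?v e1)" using openF_cube[of ?v e1] g(1) by simp
                fix w assume w: "w \<in> cube w0 s"
                have "\<bar>E ?v w ! i - ?v ! i\<bar> < e1" if "i < n" for i
                proof (cases "i \<in> S")
                  case True
                  have "\<bar>w ! pos i - w0 ! pos i\<bar> < s" using w pos(1)[OF True] lU[OF w0] by (simp add: cube_def)
                  then show ?thesis using E_S[OF True] \<tau>S[OF w0 True] s(3) by simp
                next
                  case False
                  then show ?thesis using E(2)[OF that] g(4) by simp
                qed
                then have "E ?v w \<in> cube ?v e1" using E(1) g(1) by (simp add: cube_def)
                then show "map (\<lambda>j. case (if j \<in> S then Some (pos j) else None) of Some k \<Rightarrow> w ! k | None \<Rightarrow> ?v ! j) [0..<n] \<in> cube ?v e1"
                  by (simp add: E_def)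
              next
                show "k < d" if "(if i \<in> S then Some (pos i) else None) = Some k" for i k
                  using that pos(1)[of i] by (auto split: if_splits)
                show "i = i'" if "(if i \<in> S then Some (pos i) else None) = Some k" "(if i' \<in> S then Some (pos i') else None) = Some k" for i i' k
                  using that pos(2)[of i] pos(2)[of i'] by (auto split: if_splits)
              qed
              have "g j (E ?v w) = \<tau> w ! j" if w: "w \<in> cube w0 s" for w
              proof -
                have wU: "w \<in> ?U" using w sU by blast
                have "\<bar>\<tau> w ! k - ?v ! k\<bar> \<le> C * s" if k: "k < n" for k
                proof (rule lip_onD[OF lip _ _ _ _ k])
                  show "\<tau> w \<in> Y \<inter> ?V" "?v \<in> Y \<inter> ?V" using \<tau> wU w0 by auto
                  show "0 \<le> s" using s(1) by simp
                  show "\<bar>\<tau> w ! i - ?v ! i\<bar> \<le> s" if i: "i \<in> S" for i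
                    using w pos(1)[OF i] lU[OF w0] \<tau>S[OF wU i] \<tau>S[OF w0 i] by (simp add: cube_def less_imp_le)
                qed
                then have "\<tau> w \<in> cube ?v e1" using Cs g(1) YL[OF \<tau>(1)[OF wU]] by (auto simp: cube_def intro: le_less_trans)
                then have "\<tau> w ! j = g j (\<tau> w)" using g(7) \<tau>(1)[OF wU] j False by blast
                also have "\<dots> = g j (E ?v w)"
                  using E \<tau>S[OF wU] E_S YL[OF \<tau>(1)[OF wU]] by (intro g(6)[OF j False]) auto
                finally show ?thesis by simp
              qed
              then show ?thesis by (rule Cr_cong[OF DC_imp_Cr[OF DC']])
            qed
            then show "\<exists>e>0. cube w0 e \<subseteq> ?U \<and> Cr d (Suc r) (cube w0 e) (\<lambda>w. \<tau> w ! j)" using s(1) sU by blast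
          qed
        qed
      qed
    qed
  qed
qed

lemma submanifold_cover:
  assumes X: "Dr_submanifold D (Suc r) n d X"
  shows "\<exists>\<W>. finite \<W> \<and> \<Union>\<W> = X \<and> (\<forall>W\<in>\<W>. D W \<and> open_in_set X W \<and> quasi_special D (Suc r) n W)"
proof -
  have DX: "D X" "X \<subseteq> Fn n" using X by (simp_all add: Dr_submanifold_def)
  \<comment> \<open>\<open>lip_on\<close> for the part of \<open>X\<close> in a cube around
    \<open>a\<close>, unfolded into quantifiers over vectors and field elements to make
    \<open>P S\<close> definable.\<close>
  define P where "P = (\<lambda>S. {a \<in> Fn n. a \<in> X \<and> (\<exists>e. 0 < e \<and> (\<exists>C. \<forall>x\<in>Fn n. \<forall>y\<in>Fn n.
    x \<in> X \<and> y \<in> X \<and> (\<forall>i<n. \<bar>x ! i - a ! i\<bar> < e) \<and> (\<forall>i<n. \<bar>y ! i - a ! i\<bar> < e) \<longrightarrow>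
    (\<forall>b. 0 \<le> b \<and> (\<forall>i\<in>S. \<bar>x ! i - y ! i\<bar> \<le> b) \<longrightarrow> (\<forall>k<n. \<bar>x ! k - y ! k\<bar> \<le> C * b))))})"
  have P_iff: "a \<in> P S \<longleftrightarrow> a \<in> X \<and> (\<exists>e C. 0 < e \<and> lip_on n (X \<inter> cube a e) S C)" for a S
  proof (cases "a \<in> X")
    case True
    then have la: "length a = n" using DX(2) by auto
    have c: "x \<in> X \<inter> cube a e \<longleftrightarrow> x \<in> Fn n \<and> x \<in> X \<and> (\<forall>i<n. \<bar>x ! i - a ! i\<bar> < e)" for x e
      using la DX(2) by (auto simp: cube_def)
    have "lip_on n (X \<inter> cube a e) S C \<longleftrightarrow> (\<forall>x\<in>Fn n. \<forall>y\<in>Fn n.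
      x \<in> X \<and> y \<in> X \<and> (\<forall>i<n. \<bar>x ! i - a ! i\<bar> < e) \<and> (\<forall>i<n. \<bar>y ! i - a ! i\<bar> < e) \<longrightarrow>
      (\<forall>b. 0 \<le> b \<and> (\<forall>i\<in>S. \<bar>x ! i - y ! i\<bar> \<le> b) \<longrightarrow> (\<forall>k<n. \<bar>x ! k - y ! k\<bar> \<le> C * b)))" for e C
      unfolding lip_on_def Ball_def c by blast
    then show ?thesis unfolding P_def using True la by simp
  qed (simp add: P_def)
  have P: "D (P S) \<and> open_in_set X (P S) \<and> quasi_special D (Suc r) n (P S)" if S: "S \<subseteq> {..<n}" "card S = d" for S
  proof -
    have finS: "finite S" using S finite_subset by blast
    have Sn: "i < n" if "i \<in> S" for i using S that by auto
    have DP: "D (P S)" unfolding P_def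
      by (rule D_Collect) (intro def_intros def_pred_all_vec def_pred_ball_finite[OF finS] def_pred_in[OF DX]
        def_term_nth[OF def_vec_take_map], use Sn in auto)
    have PX: "P S \<subseteq> X" using P_iff by blast
    have nbhd: "\<exists>e>0. \<forall>y\<in>X. y \<in> cube a e \<longrightarrow> y \<in> P S" if a: "a \<in> P S" for a
    proof -
      obtain e C where e: "0 < e" "lip_on n (X \<inter> cube a e) S C" using a P_iff by blast
      \<comment> \<open>A cube of radius \<open>e / 2\<close> around a point of
        \<open>cube a (e / 2)\<close> stays in \<open>cube a e\<close>, so the same constant works
        nearby.\<close>
      have h: "0 < e / 2" using e(1) by simp
      have "y \<in> P S" if y: "y \<in> X" "y \<in> cube a (e / 2)" for y
      proof -
        have "cube y (e / 2) \<subseteq> cube a e" using cube_cube[OF y(2), of _ "e / 2"] by auto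
        then have "lip_on n (X \<inter> cube y (e / 2)) S C" using e(2) by (elim lip_on_subset) blast
        then show ?thesis using P_iff y(1) h by blast
      qed
      then show ?thesis using h by blast
    qed
    have "open_in_set X (P S)" unfolding open_in_set_def
    proof (intro conjI ballI PX)
      fix a assume a: "a \<in> P S"
      obtain e where e: "0 < e" "\<forall>y\<in>X. y \<in> cube a e \<longrightarrow> y \<in> P S" using nbhd[OF a] by blast
      have "ldist a y < e \<longleftrightarrow> y \<in> cube a e" if "y \<in> X" for y
      proof -
        have "y \<in> Fn n" "a \<in> Fn n" using that a PX DX(2) by blast+
        then show ?thesis by (intro ldist_less e(1)) simp
      qed
      then show "\<exists>e>0. \<forall>y\<in>X. ldist a y < e \<longrightarrow> y \<in> P S" using e by blast
    qed
    moreover have "graph_at (Suc r) n (P S) S a" if a: "a \<in> P S" for a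
    proof -
      have aX: "a \<in> X" using a PX by blast
      obtain S1 where S1: "card S1 = d" "graph_at (Suc r) n X S1 a"
        using submanifold_graph_at[OF X aX] by blast
      obtain e C where e: "0 < e" "lip_on n (X \<inter> cube a e) S C" using a P_iff by blast
      obtain S' where S': "S' \<subseteq> S" "card S' = card S1" "graph_at (Suc r) n X S' a"
        using exchange_into[OF e S(1) S1(2)] by blast
      \<comment> \<open>The exchange leads only into \<open>S\<close>; both cardinalities being
        \<open>d\<close>, the inclusion is an equality.\<close>
      have "S' = S" using card_subset_eq[OF finS S'(1)] S'(2) S1(1) S(2) by simp
      then have G: "graph_at (Suc r) n X S a" using S'(3) by simp
      obtain e' where e': "0 < e'" "\<forall>y\<in>X. y \<in> cube a e' \<longrightarrow> y \<in> P S" using nbhd[OF a] by blast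
      \<comment> \<open>\<open>P S\<close> is open in \<open>X\<close>, so the two sets agree near
        \<open>a\<close>.\<close>
      show ?thesis by (rule graph_at_cong[OF G e'(1)]) (use e'(2) PX in blast)
    qed
    then have "quasi_special_wrt D (Suc r) n S (P S)"
      using PX DX(2) by (intro quasi_special_if_graph_at DP S(1)) auto
    ultimately show ?thesis using DP unfolding quasi_special_def by blast
  qed
  have "X \<subseteq> \<Union>(P ` {S. S \<subseteq> {..<n} \<and> card S = d})"
  proof
    fix a assume a: "a \<in> X"
    obtain S where S: "S \<subseteq> {..<n}" "card S = d" "graph_at (Suc r) n X S a"
      using submanifold_graph_at[OF X a] by blast
    obtain e C where "0 < e" "lip_on n (X \<inter> cube a e) S C" by (rule graph_at_lip[OF S(3)])
    then have "a \<in> P S" using P_iff a by blast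
    then show "a \<in> \<Union>(P ` {S. S \<subseteq> {..<n} \<and> card S = d})" using S by blast
  qed
  moreover have "\<Union>(P ` {S. S \<subseteq> {..<n} \<and> card S = d}) \<subseteq> X" using P_iff by blast
  moreover have "finite {S. S \<subseteq> {..<n} \<and> card S = d}" by (rule finite_subset[of _ "Pow {..<n}"]) auto
  ultimately show ?thesis using P by (intro exI[of _ "P ` {S. S \<subseteq> {..<n} \<and> card S = d}"]) auto
qed

end

theorem theorem4p12:
  fixes D :: "'a::linordered_field list set \<Rightarrow> bool"
    and r n d :: nat and X :: "'a list set"
  assumes "definable_structure D"
    and "definably_complete D"
    and "locally_o_minimal D"
    and "1 \<le> r"
    and "Dr_submanifold D r n d X"
  shows "\<exists>\<W>. finite \<W> \<and> \<Union>\<W> = X \<and>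
           (\<forall>W\<in>\<W>. D W \<and> open_in_set X W \<and> quasi_special D r n W)"
proof -
  interpret locally_o_minimal_field D
    by unfold_locales (rule assms)+
  \<comment> \<open>The mean value estimates and the exchange use one derivative, hence the form
    \<open>Suc m\<close>.\<close>
  obtain m where r: "r = Suc m" using assms(4) by (cases r) auto
  show ?thesis unfolding r by (rule submanifold_cover[OF assms(5)[unfolded r]])
qed

end
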